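(* Let $(\mathcal P,g)$ be a Riemannian manifold with an affine connection $\nabla$ and its $g$-dual $\nabla^*$, both torsion-free, and let $\nabla^g$ be the Levi--Civita connection. Let $\mathcal N\subset\mathcal P$ be a one-dimensional embedded submanifold that is autoparallel with respect to both $\nabla$ and $\nabla^g$, that is, $\nabla_XY$ and $\nabla^g_XY$ are tangent to $\mathcal N$ whenever $X,Y$ are vector fields tangent to $\mathcal N$. Then: (i) $\mathcal N$ is autoparallel with respect to $\nabla^*=2\nabla^g-\nabla$. (ii) $\nabla^*|_{\mathcal N}$ is the $g|_{\mathcal N}$-dual of $\nabla|_{\mathcal N}$, and $\nabla^g|_{\mathcal N}$ is the Levi--Civita connection of $g|_{\mathcal N}$. (iii) Let $\mathcal U\subset\mathcal N$ be a connected open arc which is geodesically convex with respect to each of the induced connections $\nabla|_{\mathcal U}$, $\nabla^*|_{\mathcal U}$, $\nabla^g|_{\mathcal U}$; that is, every pair of points in $\mathcal U$ is joined by a unique geodesic segment of each induced connection that remains in $\mathcal U$. Assume moreover that, for every $P,Q\in\mathcal U$, the corresponding ambient geodesic segment is unique for each of $\nabla$, $\nabla^*$ and $\nabla^g$. Then, for all $P,Q\in\mathcal U$, the ambient midpoint means $A(P,Q)$, $M(P,Q)$, $M_g(P,Q)$ lie in $\mathcal U$ and coincide with the corresponding midpoint means $A_{\mathcal U}(P,Q)$, $M_{\mathcal U}(P,Q)$, $M_{g,\mathcal U}(P,Q)$ of the induced one-dimensional structure on $\mathcal U$. Consequently, if the invariance identity $M_g(A(P,Q),M(P,Q))=M_g(P,Q)$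 holds on $\mathcal P$, then $$M_{g,\mathcal U}\bigl(A_{\mathcal U}(P,Q),M_{\mathcal U}(P,Q)\bigr)=M_{g,\mathcal U}(P,Q),\qquad P,Q\in\mathcal U,$$ and, after identifying $\mathcal U$ with an open interval by a $\nabla|_{\mathcal U}$-affine coordinate $x$ and writing $g|_{\mathcal U}=w(x)\,dx^2$, either $w$ is constant or $w(x)=c/(x-x_0)^2$ for some $c>0$ and some $x_0\in\mathbb R$ outside the interval.
   Context: The $g$-dual $\nabla^*$ of $\nabla$ is determined by $X[g(Y,Z)]=g(\nabla_XY,Z)+g(Y,\nabla^*_XZ)$. When $\nabla$ and $\nabla^*$ are both torsion-free, $\frac12(\nabla+\nabla^* )=\nabla^g$. The midpoint mean of a connection $D$ is $M_D(P,Q)=\gamma(1/2)$, where $\gamma:[0,1]\to\mathcal P$ is the unique affinely parametrized $D$-geodesic from $P$ to $Q$; $A=M_\nabla$, $M=M_{\nabla^*}$, $M_g=M_{\nabla^g}$. $A_{\mathcal U},M_{\mathcal U},M_{g,\mathcal U}$ are the analogous midpoint means on $\mathcal U$ of the induced connections $\nabla|_{\mathcal U},\nabla^*|_{\mathcal U},\nabla^g|_{\mathcal U}$. "The invariance identity holds on $\mathcal P$" means that it holds for all pairs $(P,Q)$ for which the midpoints occurring in it are uniquely defined. A coordinate $x$ on $\mathcal U$ is $\nabla|_{\mathcal U}$-affine if $\nabla_{\partial_x}\partial_x=0$. *)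

theory Defs
  imports "HOL-Analysis.Analysis"
begin

section \<open>Smooth functions between normed spaces\<close>

text \<open>Used on open sets of Euclidean spaces, where continuity of all iterated directional
  derivatives is the usual notion of class \<open>C\<^sup>k\<close>.\<close>

primrec Ck_on :: "nat \<Rightarrow> 'e::real_normed_vector set \<Rightarrow> ('e \<Rightarrow> 'f::real_normed_vector) \<Rightarrow> bool" where
  "Ck_on 0 S f \<longleftrightarrow> continuous_on S f"
| "Ck_on (Suc k) S f \<longleftrightarrow>
     (\<forall>x\<in>S. f differentiable (at x)) \<and> (\<forall>v. Ck_on k S (\<lambda>x. frechet_derivative f (at x) v))"

definition smooth_on :: "'e::real_normed_vector set \<Rightarrow> ('e \<Rightarrow> 'f::real_normed_vector) \<Rightarrow> bool" where
  "smooth_on S f \<longleftrightarrow> (\<forall>k. Ck_on k S f)"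


section \<open>Smooth manifolds\<close>

text \<open>A manifold is a set of points with the subspace topology of the ambient type, together with
  a smooth atlas; its dimension is the dimension of the model space \<open>'e\<close>. A chart is a pair of
  its domain and its coordinate map, whose values off the domain are irrelevant.\<close>

type_synonym ('a, 'e) chart = "'a set \<times> ('a \<Rightarrow> 'e)"

record ('a, 'e) manifold =
  pts :: "'a set"
  charts :: "('a, 'e) chart set"

abbreviation open_in :: "('a::topological_space, 'e) manifold \<Rightarrow> 'a set \<Rightarrow> bool" where
  "open_in M W \<equiv> openin (top_of_set (pts M)) W"

definition transition_smooth ::
  "('a, 'd::euclidean_space) chart \<Rightarrow> ('a, 'e::euclidean_space) chart \<Rightarrow> bool" where
  "transition_smooth = (\<lambda>(U, \<phi>) (V, \<psi>). smooth_on (\<phi> ` (U \<inter> V)) (\<psi> \<circ> inv_into U \<phi>))"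

definition admissible_chart ::
  "('a::topological_space, 'e::euclidean_space) manifold \<Rightarrow> ('a, 'e) chart \<Rightarrow> bool" where
  "admissible_chart M c \<longleftrightarrow>
     open_in M (fst c) \<and> open (snd c ` fst c) \<and>
     homeomorphism (fst c) (snd c ` fst c) (snd c) (inv_into (fst c) (snd c)) \<and>
     (\<forall>c'\<in>charts M. transition_smooth c c' \<and> transition_smooth c' c)"

definition smooth_manifold ::
  "('a::{t2_space, second_countable_topology}, 'e::euclidean_space) manifold \<Rightarrow> bool" where
  "smooth_manifold M \<longleftrightarrow> (\<Union>c\<in>charts M. fst c) = pts M \<and> (\<forall>c\<in>charts M. admissible_chart M c)"

definition smooth_fun ::
  "('a::topological_space, 'e::euclidean_space) manifold \<Rightarrow> 'a set \<Rightarrow> ('a \<Rightarrow> real) \<Rightarrow> bool" where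
  "smooth_fun M W f \<longleftrightarrow> (\<forall>(U, \<phi>)\<in>charts M. smooth_on (\<phi> ` (U \<inter> W)) (f \<circ> inv_into U \<phi>))"

definition smooth_near ::
  "('a::topological_space, 'e::euclidean_space) manifold \<Rightarrow> 'a \<Rightarrow> ('a \<Rightarrow> real) \<Rightarrow> bool" where
  "smooth_near M p f \<longleftrightarrow> (\<exists>W. open_in M W \<and> p \<in> W \<and> smooth_fun M W f)"


section \<open>Tangent vectors and vector fields\<close>

text \<open>A tangent vector at \<open>p\<close> is identified with its action on the functions that are smooth near
  \<open>p\<close>. To make this functional unique, it is \<open>0\<close> on all other functions.\<close>

type_synonym 'a tvec = "('a \<Rightarrow> real) \<Rightarrow> real"
type_synonym 'a vfield = "'a \<Rightarrow> 'a tvec"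

text \<open>The vector \<open>\<Sum>\<^sub>i u\<^sup>i \<partial>\<^sub>i\<close> at \<open>p\<close> in the coordinates given by the chart.\<close>

definition coord_vec ::
  "('a::topological_space, 'e::euclidean_space) manifold \<Rightarrow> ('a, 'e) chart \<Rightarrow> 'e \<Rightarrow> 'a vfield" where
  "coord_vec M = (\<lambda>(U, \<phi>) u p f.
     if p \<in> U \<and> smooth_near M p f
     then frechet_derivative (f \<circ> inv_into U \<phi>) (at (\<phi> p)) u else 0)"

definition components :: "('a, 'e::euclidean_space) chart \<Rightarrow> 'a tvec \<Rightarrow> 'e" where
  "components c v = (\<Sum>b\<in>Basis. v (\<lambda>q. snd c q \<bullet> b) *\<^sub>R b)"

definition tangent_space ::
  "('a::topological_space, 'e::euclidean_space) manifold \<Rightarrow> 'a \<Rightarrow> 'a tvec set" where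
  "tangent_space M p = {coord_vec M c u p | c u. c \<in> charts M \<and> p \<in> fst c}"

text \<open>Smooth vector fields on an open set \<open>W\<close>, extended by \<open>0\<close> outside \<open>W\<close>.\<close>

definition vfields ::
  "('a::topological_space, 'e::euclidean_space) manifold \<Rightarrow> 'a set \<Rightarrow> 'a vfield set" where
  "vfields M W = {X.
     (\<forall>p\<in>W. X p \<in> tangent_space M p) \<and> (\<forall>p. p \<notin> W \<longrightarrow> X p = (\<lambda>_. 0)) \<and>
     (\<forall>V f. open_in M V \<and> V \<subseteq> W \<and> smooth_fun M V f \<longrightarrow> smooth_fun M V (\<lambda>p. X p f))}"

definition restrict_vfield :: "'a set \<Rightarrow> 'a vfield \<Rightarrow> 'a vfield" where
  "restrict_vfield V X = (\<lambda>p. if p \<in> V then X p else (\<lambda>_. 0))"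

definition lie_bracket ::
  "('a::topological_space, 'e::euclidean_space) manifold \<Rightarrow> 'a vfield \<Rightarrow> 'a vfield \<Rightarrow> 'a vfield" where
  "lie_bracket M X Y = (\<lambda>p f.
     if smooth_near M p f then X p (\<lambda>q. Y q f) - Y p (\<lambda>q. X q f) else 0)"


section \<open>Metrics and connections\<close>

type_synonym 'a metric = "'a \<Rightarrow> 'a tvec \<Rightarrow> 'a tvec \<Rightarrow> real"

definition riemannian_metric ::
  "('a::topological_space, 'e::euclidean_space) manifold \<Rightarrow> 'a metric \<Rightarrow> bool" where
  "riemannian_metric M g \<longleftrightarrow>
     (\<forall>p\<in>pts M. \<forall>u\<in>tangent_space M p. \<forall>v\<in>tangent_space M p.
        g p u v = g p v u \<and>
        (\<forall>w\<in>tangent_space M p. \<forall>a. g p (\<lambda>f. a * u f + v f) w = a * g p u w + g p v w) \<and>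
        (u \<noteq> (\<lambda>_. 0) \<longrightarrow> g p u u > 0)) \<and>
     (\<forall>W. open_in M W \<longrightarrow>
        (\<forall>X\<in>vfields M W. \<forall>Y\<in>vfields M W. smooth_fun M W (\<lambda>p. g p (X p) (Y p))))"

definition riemannian_manifold ::
  "('a::{t2_space, second_countable_topology}, 'e::euclidean_space) manifold
     \<Rightarrow> 'a metric \<Rightarrow> bool" where
  "riemannian_manifold M g \<longleftrightarrow> smooth_manifold M \<and> riemannian_metric M g"

text \<open>\<open>D W X Y\<close> is the covariant derivative \<open>D\<^sub>X Y\<close> of vector fields on the open set \<open>W\<close>. As a
  connection is a local operator, it acts on vector fields on all open sets, compatibly
  with restriction.\<close>

type_synonym 'a connection = "'a set \<Rightarrow> 'a vfield \<Rightarrow> 'a vfield \<Rightarrow> 'a vfield"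

definition affine_connection ::
  "('a::topological_space, 'e::euclidean_space) manifold \<Rightarrow> 'a connection \<Rightarrow> bool" where
  "affine_connection M D \<longleftrightarrow> (\<forall>W. open_in M W \<longrightarrow> (\<forall>X\<in>vfields M W. \<forall>Y\<in>vfields M W.
     D W X Y \<in> vfields M W \<and>
     (\<forall>Z\<in>vfields M W. \<forall>f. smooth_fun M W f \<longrightarrow>
        D W (\<lambda>p h. f p * X p h + Z p h) Y = (\<lambda>p h. f p * D W X Y p h + D W Z Y p h)) \<and>
     (\<forall>Z\<in>vfields M W. \<forall>f. smooth_fun M W f \<longrightarrow>
        D W X (\<lambda>p h. f p * Y p h + Z p h) =
          (\<lambda>p h. X p f * Y p h + f p * D W X Y p h + D W X Z p h)) \<and>
     (\<forall>V. open_in M V \<and> V \<subseteq> W \<longrightarrow>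
        D V (restrict_vfield V X) (restrict_vfield V Y) = restrict_vfield V (D W X Y))))"

definition torsion_free ::
  "('a::topological_space, 'e::euclidean_space) manifold \<Rightarrow> 'a connection \<Rightarrow> bool" where
  "torsion_free M D \<longleftrightarrow> (\<forall>W. open_in M W \<longrightarrow> (\<forall>X\<in>vfields M W. \<forall>Y\<in>vfields M W.
     (\<lambda>p h. D W X Y p h - D W Y X p h) = lie_bracket M X Y))"

definition dual_connections ::
  "('a::topological_space, 'e::euclidean_space) manifold \<Rightarrow> 'a metric
     \<Rightarrow> 'a connection \<Rightarrow> 'a connection \<Rightarrow> bool" where
  "dual_connections M g D D' \<longleftrightarrow> affine_connection M D \<and> affine_connection M D' \<and>
     (\<forall>W. open_in M W \<longrightarrow>
       (\<forall>X\<in>vfields M W. \<forall>Y\<in>vfields M W. \<forall>Z\<in>vfields M W. \<forall>p\<in>W.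
          X p (\<lambda>q. g q (Y q) (Z q)) = g p (D W X Y p) (Z p) + g p (Y p) (D' W X Z p)))"

definition levi_civita ::
  "('a::topological_space, 'e::euclidean_space) manifold \<Rightarrow> 'a metric \<Rightarrow> 'a connection \<Rightarrow> bool" where
  "levi_civita M g D \<longleftrightarrow> affine_connection M D \<and> torsion_free M D \<and>
     (\<forall>W. open_in M W \<longrightarrow>
       (\<forall>X\<in>vfields M W. \<forall>Y\<in>vfields M W. \<forall>Z\<in>vfields M W. \<forall>p\<in>W.
          X p (\<lambda>q. g q (Y q) (Z q)) = g p (D W X Y p) (Z p) + g p (Y p) (D W X Z p)))"


section \<open>Submanifolds and induced structures\<close>

text \<open>The differential at \<open>p\<close> of the inclusion of a submanifold into \<open>M\<close>: the restriction of a
  function to the submanifold is the same HOL function, so only the cut-off changes.\<close>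

definition push ::
  "('a::topological_space, 'e::euclidean_space) manifold \<Rightarrow> 'a \<Rightarrow> 'a tvec \<Rightarrow> 'a tvec" where
  "push M p v = (\<lambda>f. if smooth_near M p f then v f else 0)"

text \<open>The inclusion is a smooth immersion. It is a topological embedding because both
  manifolds carry the subspace topology of the same type.\<close>

definition embedded_submanifold ::
  "('a::{t2_space, second_countable_topology}, 'e::euclidean_space) manifold
     \<Rightarrow> ('a, 'd::euclidean_space) manifold \<Rightarrow> bool" where
  "embedded_submanifold M N \<longleftrightarrow> smooth_manifold N \<and> pts N \<subseteq> pts M \<and>
     (\<forall>c\<in>charts N. \<forall>c'\<in>charts M. transition_smooth c c') \<and>
     (\<forall>p\<in>pts N. inj_on (push M p) (tangent_space N p))"

definition open_submanifold :: "('a, 'e) manifold \<Rightarrow> 'a set \<Rightarrow> ('a, 'e) manifold" where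
  "open_submanifold N U = \<lparr>pts = U, charts = (\<lambda>(V, \<psi>). (V \<inter> U, \<psi>)) ` charts N\<rparr>"

definition tangent_to ::
  "('a::topological_space, 'e::euclidean_space) manifold \<Rightarrow> ('a, 'd::euclidean_space) manifold
     \<Rightarrow> 'a set \<Rightarrow> 'a vfield \<Rightarrow> bool" where
  "tangent_to M N W X \<longleftrightarrow> (\<forall>p\<in>W \<inter> pts N. X p \<in> push M p ` tangent_space N p)"

definition autoparallel ::
  "('a::topological_space, 'e::euclidean_space) manifold \<Rightarrow> ('a, 'd::euclidean_space) manifold
     \<Rightarrow> 'a connection \<Rightarrow> bool" where
  "autoparallel M N D \<longleftrightarrow> (\<forall>W. open_in M W \<longrightarrow> (\<forall>X\<in>vfields M W. \<forall>Y\<in>vfields M W.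
     tangent_to M N W X \<and> tangent_to M N W Y \<longrightarrow> tangent_to M N W (D W X Y)))"

definition induced_metric ::
  "('a::topological_space, 'e::euclidean_space) manifold \<Rightarrow> 'a metric \<Rightarrow> 'a metric" where
  "induced_metric M g = (\<lambda>p u v. g p (push M p u) (push M p v))"

definition extends_vfield ::
  "('a::topological_space, 'e::euclidean_space) manifold \<Rightarrow> ('a, 'd::euclidean_space) manifold
     \<Rightarrow> 'a set \<Rightarrow> 'a vfield \<Rightarrow> 'a vfield \<Rightarrow> bool" where
  "extends_vfield M N W X X' \<longleftrightarrow> X' \<in> vfields M W \<and> (\<forall>q\<in>W \<inter> pts N. X' q = push M q (X q))"

text \<open>At \<open>p\<close>, the induced derivative of fields \<open>X\<close>, \<open>Y\<close> on the open set \<open>V\<close> of \<open>N\<close> is the tangent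
  vector of \<open>N\<close> that represents the ambient derivative of local extensions of \<open>X\<close> and \<open>Y\<close>. If
  \<open>N\<close> is autoparallel, then it exists and does not depend on the extensions.\<close>

definition induced_connection ::
  "('a::topological_space, 'e::euclidean_space) manifold \<Rightarrow> ('a, 'd::euclidean_space) manifold
     \<Rightarrow> 'a connection \<Rightarrow> 'a connection" where
  "induced_connection M N D = (\<lambda>V X Y p.
     if p \<in> V then
       (THE v. v \<in> tangent_space N p \<and>
          (\<exists>W X' Y'. open_in M W \<and> p \<in> W \<and> W \<inter> pts N \<subseteq> V \<and>
             extends_vfield M N W X X' \<and> extends_vfield M N W Y Y' \<and>
             push M p v = D W X' Y' p))
     else (\<lambda>_. 0))"


section \<open>Geodesics and midpoint means\<close>

text \<open>The geodesic equation \<open>c''\<^sup>k + \<Gamma>\<^sup>k\<^sub>i\<^sub>j c'\<^sup>i c'\<^sup>j = 0\<close> in every chart of the atlas, with one-sided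
  derivatives at the end points. For constant \<open>u\<close>, the components of the derivative of
  \<open>u\<^sup>j \<partial>\<^sub>j\<close> along \<open>u\<^sup>i \<partial>\<^sub>i\<close> are \<open>\<Gamma>\<^sup>k\<^sub>i\<^sub>j u\<^sup>i u\<^sup>j\<close>.\<close>

definition geodesic ::
  "('a::topological_space, 'e::euclidean_space) manifold \<Rightarrow> 'a connection
     \<Rightarrow> (real \<Rightarrow> 'a) \<Rightarrow> bool" where
  "geodesic M D \<gamma> \<longleftrightarrow> continuous_on {0..1} \<gamma> \<and> \<gamma> ` {0..1} \<subseteq> pts M \<and>
     (\<forall>(U, \<phi>)\<in>charts M. \<exists>c'. \<forall>t\<in>{0..1}. \<gamma> t \<in> U \<longrightarrow>
        ((\<phi> \<circ> \<gamma>) has_vector_derivative c' t) (at t within {0..1}) \<and>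
        (c' has_vector_derivative
           - components (U, \<phi>)
               (D U (coord_vec M (U, \<phi>) (c' t)) (coord_vec M (U, \<phi>) (c' t)) (\<gamma> t)))
          (at t within {0..1}))"

definition geodesic_from_to ::
  "('a::topological_space, 'e::euclidean_space) manifold \<Rightarrow> 'a connection
     \<Rightarrow> 'a \<Rightarrow> 'a \<Rightarrow> (real \<Rightarrow> 'a) \<Rightarrow> bool" where
  "geodesic_from_to M D p q \<gamma> \<longleftrightarrow> geodesic M D \<gamma> \<and> \<gamma> 0 = p \<and> \<gamma> 1 = q"

definition unique_geodesic ::
  "('a::topological_space, 'e::euclidean_space) manifold \<Rightarrow> 'a connection
     \<Rightarrow> 'a \<Rightarrow> 'a \<Rightarrow> bool" where
  "unique_geodesic M D p q \<longleftrightarrow> (\<exists>\<gamma>. geodesic_from_to M D p q \<gamma> \<and>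
     (\<forall>\<delta>. geodesic_from_to M D p q \<delta> \<longrightarrow> (\<forall>t\<in>{0..1}. \<delta> t = \<gamma> t)))"

definition midpoint_mean ::
  "('a::topological_space, 'e::euclidean_space) manifold \<Rightarrow> 'a connection
     \<Rightarrow> 'a \<Rightarrow> 'a \<Rightarrow> 'a" where
  "midpoint_mean M D p q = (THE m. \<exists>\<gamma>. geodesic_from_to M D p q \<gamma> \<and> \<gamma> (1/2) = m)"

definition geodesically_convex ::
  "('a::topological_space, 'e::euclidean_space) manifold \<Rightarrow> 'a connection \<Rightarrow> bool" where
  "geodesically_convex M D \<longleftrightarrow> (\<forall>p\<in>pts M. \<forall>q\<in>pts M. unique_geodesic M D p q)"

text \<open>\<open>M\<^sub>g(A, M) = M\<^sub>g\<close> for the midpoint means of \<open>D\<close>, \<open>D'\<close>, \<open>Dg\<close>, wherever all four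
  midpoints are uniquely defined.\<close>

definition invariance_identity ::
  "('a::topological_space, 'e::euclidean_space) manifold
     \<Rightarrow> 'a connection \<Rightarrow> 'a connection \<Rightarrow> 'a connection \<Rightarrow> bool" where
  "invariance_identity M D D' Dg \<longleftrightarrow> (\<forall>p\<in>pts M. \<forall>q\<in>pts M.
     unique_geodesic M D p q \<and> unique_geodesic M D' p q \<and> unique_geodesic M Dg p q \<and>
     unique_geodesic M Dg (midpoint_mean M D p q) (midpoint_mean M D' p q) \<longrightarrow>
     midpoint_mean M Dg (midpoint_mean M D p q) (midpoint_mean M D' p q)
       = midpoint_mean M Dg p q)"


section \<open>Open arcs and affine coordinates\<close>

definition open_arc :: "('a::topological_space, real) manifold \<Rightarrow> 'a set \<Rightarrow> bool" where
  "open_arc N U \<longleftrightarrow> open_in N U \<and> connected U \<and> U homeomorphic {0<..<1::real}"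

text \<open>A global coordinate identifying a one-dimensional manifold with an open interval, in which
  \<open>D\<^sub>\<partial>\<^sub>x \<partial>\<^sub>x = 0\<close>; the coordinate field is \<open>\<partial>\<^sub>x\<close>.\<close>

definition coordinate_field ::
  "('a::topological_space, real) manifold \<Rightarrow> ('a \<Rightarrow> real) \<Rightarrow> 'a vfield" where
  "coordinate_field M x = coord_vec M (pts M, x) 1"

definition affine_coordinate ::
  "('a::topological_space, real) manifold \<Rightarrow> 'a connection \<Rightarrow> ('a \<Rightarrow> real) \<Rightarrow> bool" where
  "affine_coordinate M D x \<longleftrightarrow> admissible_chart M (pts M, x) \<and> is_interval (x ` pts M) \<and>
     (\<forall>p\<in>pts M. D (pts M) (coordinate_field M x) (coordinate_field M x) p = (\<lambda>_. 0))"

end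

theory Submission
  imports Defs
begin

text \<open>Twice the Levi-Civita connection minus \<open>D + D'\<close> is a tensor that is symmetric by
  torsion-freeness and skew by metric compatibility, hence zero; this gives \<open>D' = 2 Dg - D\<close> and the
  autoparallelity of \<open>N\<close> for \<open>D'\<close>. The induced structure on \<open>N\<close> is computed with local extensions
  obtained from a smooth local retraction of \<open>P\<close> onto \<open>N\<close>, and an induced geodesic is an ambient one, so
  by uniqueness the midpoints agree.

  In an affine coordinate \<open>x\<close> of the arc with \<open>g = w dx\<^sup>2\<close>, duality makes \<open>\<integral> w\<close> and \<open>\<integral> \<surd>w\<close> affine
  coordinates for \<open>D'\<close> and \<open>Dg\<close>, so the three midpoints are quasi-arithmetic means. The invariance
  identity, expanded to fourth order around the diagonal, says \<open>\<sigma>' (2 \<sigma>'\<^sup>2 - \<sigma> \<sigma>'') = 0\<close> for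
  \<open>\<sigma> = \<surd>w\<close>, that is, \<open>\<rho>' \<rho>'' = 0\<close> for \<open>\<rho> = 1/\<sigma>\<close>. Hence \<open>\<rho>\<close> is an affine function of \<open>x\<close>. The affine
  coordinate itself exists because locally defined arc-length functions, oriented along the arc,
  differ by constants and can therefore be glued.\<close>

section \<open>Calculus of smooth functions\<close>

text \<open>Order four is the first that carries information: around the midpoint the invariance
  equation is even in the step t, so odd orders are void, and the second order holds by itself
  because the density of \<open>y\<close> is the square of the density of \<open>s\<close>. The
  three means come from one differential equation. In a chart with Christoffel symbol Gamma, a
  function with f'' = Gamma f' is affine in time along geodesics. In a coordinate where
  \<open>D\<close> is flat, duality gives w'/w as the symbol of \<open>D'\<close>, and compatibility
  gives w'/(2w) for \<open>Dg\<close>; this is where w and its square root come from as densities.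
  Two obstacles shape the geometry. The induced connection is described through ambient extensions,
  so these must exist near each point and must not matter; the latter holds because the coordinate
  formula of a tangential derivative involves values along \<open>N\<close> only. Moreover an arc is
  only known to be homeomorphic to an interval, while its atlas may cut it into many charts. Arc
  length is a coordinate that is determined up to sign and constant without reference to a chart,
  and orientation removes the sign.\<close>

lemma has_derivative_cong_open:
  assumes "open S" "x \<in> S" "\<And>y. y \<in> S \<Longrightarrow> f y = g y"
  shows "(f has_derivative L) (at x) \<longleftrightarrow> (g has_derivative L) (at x)"
  using assms has_derivative_transform_within_open[of f L x UNIV S g]
    has_derivative_transform_within_open[of g L x UNIV S f] by auto

lemma frechet_derivative_cong_open:
  assumes "open S" "x \<in> S" "\<And>y. y \<in> S \<Longrightarrow> f y = g y"
  shows "frechet_derivative f (at x) = frechet_derivative g (at x)"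
  unfolding frechet_derivative_def using has_derivative_cong_open[OF assms] by simp

lemma Ck_on_cong:
  assumes "open S" "\<And>x. x \<in> S \<Longrightarrow> f x = g x"
  shows "Ck_on k S f \<longleftrightarrow> Ck_on k S g"
  using assms(2)
proof (induction k arbitrary: f g)
  case 0
  then show ?case by (simp cong: continuous_on_cong)
next
  case (Suc k)
  have "f differentiable (at x) \<longleftrightarrow> g differentiable (at x)" if "x \<in> S" for x
    unfolding differentiable_def
    using has_derivative_cong_open[OF assms(1) that, of f g] Suc.prems by simp
  moreover have "Ck_on k S (\<lambda>x. frechet_derivative f (at x) v)
      \<longleftrightarrow> Ck_on k S (\<lambda>x. frechet_derivative g (at x) v)" for v
    using frechet_derivative_cong_open[OF assms(1) _ Suc.prems] by (intro Suc.IH) simp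
  ultimately show ?case by simp
qed

lemma Ck_on_subset: "Ck_on k S f \<Longrightarrow> T \<subseteq> S \<Longrightarrow> Ck_on k T f"
  by (induction k arbitrary: f) (auto intro: continuous_on_subset)

lemma Ck_on_local:
  assumes "\<And>x. x \<in> S \<Longrightarrow> \<exists>T. open T \<and> x \<in> T \<and> Ck_on k T f"
  shows "Ck_on k S f"
  using assms
proof (induction k arbitrary: f)
  case 0
  have "continuous (at x) f" if "x \<in> S" for x
    using 0[OF that] by (auto simp: continuous_on_eq_continuous_at)
  then show ?case by (simp add: continuous_at_imp_continuous_on)
next
  case (Suc k)
  have "Ck_on k S (\<lambda>x. frechet_derivative f (at x) v)" for v
    using Suc.prems by (intro Suc.IH) fastforce
  then show ?case using Suc.prems by fastforce
qed

lemma Ck_on_Suc_imp: "Ck_on (Suc k) S f \<Longrightarrow> Ck_on k S f"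
proof (induction k arbitrary: f)
  case 0
  then show ?case
    by (auto intro!: continuous_at_imp_continuous_on differentiable_imp_continuous_within)
next
  case (Suc k)
  then show ?case by (metis Ck_on.simps(2))
qed

text \<open>\<open>Ck_on\<close> speaks about the chosen \<open>frechet_derivative\<close>; on an
  open set every derivative given by a formula coincides with it. Inductions can therefore use the
  product and chain rules directly.\<close>

lemma Ck_on_SucI:
  assumes "open S" "\<And>x. x \<in> S \<Longrightarrow> (f has_derivative f' x) (at x)"
    and "\<And>v. Ck_on k S (\<lambda>x. f' x v)"
  shows "Ck_on (Suc k) S f"
proof -
  have "frechet_derivative f (at x) = f' x" if "x \<in> S" for x
    using assms(2)[OF that] frechet_derivative_at by metis
  then have "Ck_on k S (\<lambda>x. frechet_derivative f (at x) v) = Ck_on k S (\<lambda>x. f' x v)" for v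
    by (intro Ck_on_cong[OF assms(1)]) simp
  then show ?thesis using assms(2,3) by (auto simp: differentiable_def)
qed

lemma Ck_on_SucD:
  assumes "Ck_on (Suc k) S f" "x \<in> S"
  shows "(f has_derivative frechet_derivative f (at x)) (at x)"
  using assms frechet_derivative_works by auto

lemma Ck_on_const: "open S \<Longrightarrow> Ck_on k S (\<lambda>x. a)"
proof (induction k arbitrary: a)
  case (Suc k)
  show ?case using Suc.prems Suc.IH[of 0] by (intro Ck_on_SucI[where f' = "\<lambda>x v. 0"]) auto
qed simp

lemma Ck_on_bounded_linear:
  assumes "open S" "bounded_linear L"
  shows "Ck_on k S L"
proof (cases k)
  case 0
  then show ?thesis using assms(2) by (simp add: linear_continuous_on)
next
  case (Suc j)
  show ?thesis
    unfolding Suc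
    by (rule Ck_on_SucI[OF assms(1) bounded_linear_imp_has_derivative[OF assms(2)]])
      (rule Ck_on_const[OF assms(1)])
qed

lemma Ck_on_add:
  assumes "open S" "Ck_on k S f" "Ck_on k S g"
  shows "Ck_on k S (\<lambda>x. f x + g x)"
  using assms(2,3)
proof (induction k arbitrary: f g)
  case 0
  then show ?case by (auto intro: continuous_intros)
next
  case (Suc k)
  show ?case
  proof (rule Ck_on_SucI[OF assms(1)])
    fix x assume x: "x \<in> S"
    show "((\<lambda>x. f x + g x) has_derivative
        (\<lambda>v. frechet_derivative f (at x) v + frechet_derivative g (at x) v)) (at x)"
      by (rule has_derivative_add[OF Ck_on_SucD[OF Suc.prems(1) x] Ck_on_SucD[OF Suc.prems(2) x]])
  qed (use Suc in simp)
qed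

text \<open>The product rule expresses the derivative through \<open>B\<close> again, so the
  induction closes. A general bounded bilinear \<open>B\<close> covers scaling, real multiplication
  and the inner product at once.\<close>

lemma Ck_on_bilinear:
  assumes "open S" "bounded_bilinear B" "Ck_on k S f" "Ck_on k S g"
  shows "Ck_on k S (\<lambda>x. B (f x) (g x))"
  using assms(3,4)
proof (induction k arbitrary: f g)
  case 0
  then show ?case using bounded_bilinear.continuous_on[OF assms(2)] by auto
next
  case (Suc k)
  show ?case
  proof (rule Ck_on_SucI[OF assms(1)])
    fix x assume "x \<in> S"
    then show "((\<lambda>x. B (f x) (g x)) has_derivative
        (\<lambda>v. B (f x) (frechet_derivative g (at x) v) + B (frechet_derivative f (at x) v) (g x))) (at x)"
      by (intro bounded_bilinear.FDERIV[OF assms(2)] Ck_on_SucD[OF Suc.prems(1)] Ck_on_SucD[OF Suc.prems(2)]) auto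
  next
    fix v
    \<comment> \<open>The product rule keeps one factor undifferentiated, so the factors themselves
      are needed at the lower order.\<close>
    have "Ck_on k S f" "Ck_on k S g" using Suc.prems Ck_on_Suc_imp by blast+
    then show "Ck_on k S (\<lambda>x. B (f x) (frechet_derivative g (at x) v)
        + B (frechet_derivative f (at x) v) (g x))"
      using Suc by (intro Ck_on_add assms(1) Suc.IH) auto
  qed
qed

lemma Ck_on_sum:
  assumes "open S" "\<And>i. i \<in> I \<Longrightarrow> Ck_on k S (f i)"
  shows "Ck_on k S (\<lambda>x. \<Sum>i\<in>I. f i x)"
  using assms(2)
  by (induction I rule: infinite_finite_induct) (auto intro: Ck_on_const Ck_on_add assms(1))

text \<open>In the chain rule the outer derivative is taken in a direction that varies with x, while
  \<open>Ck_on\<close> controls fixed directions only. Expanding the direction in a finite basis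
  repairs this, hence the Euclidean type in the middle.\<close>

lemma Ck_on_compose:
  fixes g :: "'e::real_normed_vector \<Rightarrow> 'd::euclidean_space"
  assumes "open S" "open T" "g ` S \<subseteq> T" "Ck_on k S g" "Ck_on k T f"
  shows "Ck_on k S (\<lambda>x. f (g x))"
  using assms(4,5)
proof (induction k arbitrary: f)
  case 0
  then show ?case using assms(3) by (auto intro: continuous_on_compose2)
next
  case (Suc k)
  let ?g' = "\<lambda>x. frechet_derivative g (at x)" and ?f' = "\<lambda>x. frechet_derivative f (at x)"
  show ?case
  proof (rule Ck_on_SucI[OF assms(1)])
    fix x assume x: "x \<in> S"
    have f: "(f has_derivative ?f' (g x)) (at (g x))"
      using Ck_on_SucD[OF Suc.prems(2)] x assms(3) by auto
    have "?f' (g x) u = (\<Sum>b\<in>Basis. (u \<bullet> b) *\<^sub>R ?f' (g x) b)" for u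
      using linear_sum[OF has_derivative_linear[OF f], of "\<lambda>b. (u \<bullet> b) *\<^sub>R b" Basis]
        linear_cmul[OF has_derivative_linear[OF f]]
      by (simp add: euclidean_representation)
    then have eq: "(\<lambda>v. ?f' (g x) (?g' x v))
        = (\<lambda>v. \<Sum>b\<in>Basis. (?g' x v \<bullet> b) *\<^sub>R ?f' (g x) b)"
      by blast
    show "((\<lambda>x. f (g x)) has_derivative
        (\<lambda>v. \<Sum>b\<in>Basis. (?g' x v \<bullet> b) *\<^sub>R ?f' (g x) b)) (at x)"
      using has_derivative_compose[OF Ck_on_SucD[OF Suc.prems(1) x] f] unfolding eq .
  next
    fix v
    have g: "Ck_on k S g" using Suc.prems Ck_on_Suc_imp by blast
    have "Ck_on k S (\<lambda>x. (?g' x v \<bullet> b) *\<^sub>R ?f' (g x) b)" for b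
      using Suc.prems Suc.IH[OF g, of "\<lambda>x. ?f' x b"]
      by (intro Ck_on_bilinear[OF assms(1) bounded_bilinear_scaleR]
          Ck_on_bilinear[OF assms(1) bounded_bilinear_inner] Ck_on_const[OF assms(1)]) auto
    then show "Ck_on k S (\<lambda>x. \<Sum>b\<in>Basis. (?g' x v \<bullet> b) *\<^sub>R ?f' (g x) b)"
      by (rule Ck_on_sum[OF assms(1)])
  qed
qed

text \<open>The derivative of 1/f is a product of f' with two copies of 1/f, so the order is raised
  step by step. The sign is a factor -1 so that the bilinear rule applies throughout.\<close>

lemma Ck_on_inverse:
  fixes f :: "'e::real_normed_vector \<Rightarrow> real"
  assumes "open S" "Ck_on k S f" "\<And>x. x \<in> S \<Longrightarrow> f x \<noteq> 0"
  shows "Ck_on k S (\<lambda>x. inverse (f x))"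
  using assms(2)
proof (induction k)
  case 0
  then show ?case using assms(3) by (auto intro: continuous_intros)
next
  case (Suc k)
  let ?f' = "\<lambda>x. frechet_derivative f (at x)"
  show ?case
  proof (rule Ck_on_SucI[OF assms(1)])
    fix x assume x: "x \<in> S"
    show "((\<lambda>x. inverse (f x)) has_derivative (\<lambda>v. - 1 * (inverse (f x) * ?f' x v * inverse (f x)))) (at x)"
      using Ck_on_SucD[OF Suc.prems x] assms(3)[OF x]
      by (auto intro!: derivative_eq_intros)
  next
    fix v
    have "Ck_on k S (\<lambda>x. inverse (f x))" using Suc Ck_on_Suc_imp by blast
    then show "Ck_on k S (\<lambda>x. - 1 * (inverse (f x) * ?f' x v * inverse (f x)))"
      using Suc.prems
      by (intro Ck_on_bilinear[OF assms(1) bounded_bilinear_mult] Ck_on_const[OF assms(1)]) auto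
  qed
qed

text \<open>On the line an antiderivative gains one order; this drives the bootstrapping arguments
  below.\<close>

lemma Ck_on_vector_derivative:
  fixes f :: "real \<Rightarrow> 'f::real_normed_vector"
  assumes "open S" "\<And>x. x \<in> S \<Longrightarrow> (f has_vector_derivative f' x) (at x)" "Ck_on k S f'"
  shows "Ck_on (Suc k) S f"
proof (rule Ck_on_SucI[OF assms(1)])
  show "(f has_derivative (\<lambda>v. v *\<^sub>R f' x)) (at x)" if "x \<in> S" for x
    using assms(2)[OF that] by (simp add: has_vector_derivative_def)
  show "Ck_on k S (\<lambda>x. v *\<^sub>R f' x)" for v
    by (intro Ck_on_bilinear[OF assms(1) bounded_bilinear_scaleR] Ck_on_const assms)
qed

lemma smooth_on_cong: "open S \<Longrightarrow> (\<And>x. x \<in> S \<Longrightarrow> f x = g x) \<Longrightarrow> smooth_on S f \<longleftrightarrow> smooth_on S g"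
  unfolding smooth_on_def using Ck_on_cong by blast

lemma smooth_on_subset: "smooth_on S f \<Longrightarrow> T \<subseteq> S \<Longrightarrow> smooth_on T f"
  unfolding smooth_on_def using Ck_on_subset by blast

lemma smooth_on_local:
  assumes "\<And>x. x \<in> S \<Longrightarrow> \<exists>T. open T \<and> x \<in> T \<and> smooth_on T f"
  shows "smooth_on S f"
  unfolding smooth_on_def using Ck_on_local assms unfolding smooth_on_def by metis

lemma smooth_on_const: "open S \<Longrightarrow> smooth_on S (\<lambda>x. a)"
  unfolding smooth_on_def using Ck_on_const by blast

lemma smooth_on_bounded_linear: "open S \<Longrightarrow> bounded_linear L \<Longrightarrow> smooth_on S L"
  unfolding smooth_on_def using Ck_on_bounded_linear by blast

lemma smooth_on_add: "open S \<Longrightarrow> smooth_on S f \<Longrightarrow> smooth_on S g \<Longrightarrow> smooth_on S (\<lambda>x. f x + g x)"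
  unfolding smooth_on_def using Ck_on_add by blast

lemma smooth_on_scaleR:
  "open S \<Longrightarrow> smooth_on S f \<Longrightarrow> smooth_on S g \<Longrightarrow> smooth_on S (\<lambda>x. f x *\<^sub>R g x)"
  unfolding smooth_on_def using Ck_on_bilinear[OF _ bounded_bilinear_scaleR] by blast

lemma smooth_on_mult:
  fixes f g :: "'e::real_normed_vector \<Rightarrow> real"
  shows "open S \<Longrightarrow> smooth_on S f \<Longrightarrow> smooth_on S g \<Longrightarrow> smooth_on S (\<lambda>x. f x * g x)"
  unfolding smooth_on_def using Ck_on_bilinear[OF _ bounded_bilinear_mult] by blast

lemma smooth_on_inner:
  fixes f g :: "'e::real_normed_vector \<Rightarrow> 'f::real_inner"
  shows "open S \<Longrightarrow> smooth_on S f \<Longrightarrow> smooth_on S g \<Longrightarrow> smooth_on S (\<lambda>x. f x \<bullet> g x)"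
  unfolding smooth_on_def using Ck_on_bilinear[OF _ bounded_bilinear_inner] by blast

lemma smooth_on_compose:
  fixes g :: "'e::real_normed_vector \<Rightarrow> 'd::euclidean_space"
  shows "open S \<Longrightarrow> open T \<Longrightarrow> g ` S \<subseteq> T \<Longrightarrow> smooth_on S g \<Longrightarrow> smooth_on T f
    \<Longrightarrow> smooth_on S (\<lambda>x. f (g x))"
  unfolding smooth_on_def using Ck_on_compose by blast

lemma smooth_on_has_derivative:
  "smooth_on S f \<Longrightarrow> x \<in> S \<Longrightarrow> (f has_derivative frechet_derivative f (at x)) (at x)"
  unfolding smooth_on_def using Ck_on_SucD by blast

lemma smooth_on_frechet_derivative:
  "smooth_on S f \<Longrightarrow> smooth_on S (\<lambda>x. frechet_derivative f (at x) v)"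
  unfolding smooth_on_def by (metis Ck_on.simps(2))

lemma smooth_on_imp_continuous_on: "smooth_on S f \<Longrightarrow> continuous_on S f"
  unfolding smooth_on_def by (metis Ck_on.simps(1))

lemma smooth_on_has_vector_derivative:
  fixes f :: "real \<Rightarrow> 'f::real_normed_vector"
  assumes "smooth_on S f" "x \<in> S"
  shows "(f has_vector_derivative frechet_derivative f (at x) 1) (at x)"
proof -
  let ?L = "frechet_derivative f (at x)"
  have "?L v = v *\<^sub>R ?L 1" for v
    using linear_cmul[OF has_derivative_linear[OF smooth_on_has_derivative[OF assms]], of v 1] by simp
  then have eq: "?L = (\<lambda>v. v *\<^sub>R ?L 1)" by (rule ext)
  show ?thesis
    unfolding has_vector_derivative_def
    by (rule has_derivative_eq_rhs[OF smooth_on_has_derivative[OF assms] eq])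
qed

lemma smooth_on_antiderivative:
  fixes f :: "real \<Rightarrow> 'f::real_normed_vector"
  assumes "open S" "\<And>x. x \<in> S \<Longrightarrow> (f has_vector_derivative f' x) (at x)" "smooth_on S f'"
  shows "smooth_on S f"
  using Ck_on_vector_derivative[OF assms(1,2)] assms(3) Ck_on_Suc_imp
  unfolding smooth_on_def by blast

section \<open>Smoothness by bootstrapping: exponential, square root, inverse functions\<close>

lemma smooth_on_exp: "smooth_on UNIV (exp :: real \<Rightarrow> real)"
proof -
  have "Ck_on k UNIV (exp :: real \<Rightarrow> real)" for k
  proof (induction k)
    case (Suc k)
    then show ?case
      by (intro Ck_on_vector_derivative)
        (auto simp: has_real_derivative_iff_has_vector_derivative[symmetric] intro!: derivative_eq_intros)
  qed (auto intro: continuous_intros)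
  then show ?thesis by (simp add: smooth_on_def)
qed

text \<open>The derivative is half the reciprocal of \<open>sqrt\<close> itself, so regularity of
  order k passes to order k + 1.\<close>

lemma smooth_on_sqrt: "smooth_on {0<..} sqrt"
proof -
  have "Ck_on k {0<..} sqrt" for k
  proof (induction k)
    case 0
    then show ?case by (auto intro: continuous_intros)
  next
    case (Suc k)
    have "Ck_on k {0<..} (\<lambda>x. inverse (sqrt x) * (1/2))"
      by (intro Ck_on_bilinear[OF _ bounded_bilinear_mult] Ck_on_inverse Suc Ck_on_const) auto
    then show ?case
      by (intro Ck_on_vector_derivative[where f' = "\<lambda>x. inverse (sqrt x) * (1/2)"])
        (auto simp: has_real_derivative_iff_has_vector_derivative[symmetric] intro!: derivative_eq_intros)
  qed
  then show ?thesis by (simp add: smooth_on_def)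
qed

text \<open>The derivative of \<open>k\<close> is the reciprocal of f' composed with
  \<open>k\<close>: whatever order \<open>k\<close> has, its derivative has too. Continuity of
  \<open>k\<close> starts the process and also makes the inverse function rule applicable.\<close>

lemma smooth_on_inverse_function:
  fixes f :: "real \<Rightarrow> real"
  assumes "open S" "open T" "smooth_on S f" "\<And>x. x \<in> S \<Longrightarrow> frechet_derivative f (at x) 1 \<noteq> 0"
    and "continuous_on T k" "k ` T \<subseteq> S" "\<And>y. y \<in> T \<Longrightarrow> f (k y) = y"
  shows "smooth_on T k"
proof -
  let ?f' = "\<lambda>x. frechet_derivative f (at x) 1"
  have k': "(k has_vector_derivative inverse (?f' (k y))) (at y)" if y: "y \<in> T" for y
  proof -
    obtain e where e: "e > 0" "ball y e \<subseteq> T"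
      using assms(2) y open_contains_ball by blast
    have "(f has_field_derivative ?f' (k y)) (at (k y))"
      using smooth_on_has_vector_derivative[OF assms(3)] y assms(6)
      by (auto simp: has_real_derivative_iff_has_vector_derivative)
    moreover have "isCont k y"
      using assms(2,5) y continuous_on_eq_continuous_at by blast
    moreover have "f (k z) = z" if "y - e < z" "z < y + e" for z
      using e that assms(7) by (auto simp: dist_real_def ball_def subset_iff)
    ultimately have "(k has_field_derivative inverse (?f' (k y))) (at y)"
      using assms(4,6) y e
      by (intro DERIV_inverse_function[where a = "y - e" and b = "y + e"]) auto
    then show ?thesis by (simp add: has_real_derivative_iff_has_vector_derivative)
  qed
  have "Ck_on n T k" for n
  proof (induction n)
    case 0
    then show ?case using assms(5) by simp
  next
    case (Suc n)
    have "Ck_on n S ?f'" using assms(3) smooth_on_frechet_derivative smooth_on_def by blast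
    then have "Ck_on n T (\<lambda>y. ?f' (k y))"
      by (rule Ck_on_compose[OF assms(2,1,6) Suc])
    then have "Ck_on n T (\<lambda>y. inverse (?f' (k y)))"
      by (rule Ck_on_inverse[OF assms(2)]) (use assms(4,6) in auto)
    then show ?case using Ck_on_vector_derivative[OF assms(2), of k "\<lambda>y. inverse (?f' (k y))"] k' by blast
  qed
  then show ?thesis by (simp add: smooth_on_def)
qed

section \<open>Charts, tangent vectors and vector fields\<close>

abbreviation chart_inv :: "('a, 'e) chart \<Rightarrow> 'e \<Rightarrow> 'a" where
  "chart_inv c \<equiv> inv_into (fst c) (snd c)"

text \<open>Smoothness read in a single chart, with values in any normed space. One notion then
  serves real functions and coordinate maps, and \<open>c\<close> may be a chart of a submanifold
  while \<open>F\<close> is an ambient map.\<close>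

definition chart_smooth :: "('a, 'e::real_normed_vector) chart \<Rightarrow> 'a set \<Rightarrow> ('a \<Rightarrow> 'f::real_normed_vector) \<Rightarrow> bool" where
  "chart_smooth c W F \<longleftrightarrow> smooth_on (snd c ` (fst c \<inter> W)) (\<lambda>x. F (chart_inv c x))"

lemma transition_smooth_iff: "transition_smooth c c' \<longleftrightarrow> chart_smooth c (fst c') (snd c')"
  by (simp add: transition_smooth_def chart_smooth_def split_beta comp_def)

lemma smooth_fun_def': "smooth_fun M W f \<longleftrightarrow> (\<forall>c\<in>charts M. chart_smooth c W f)"
  by (simp add: smooth_fun_def chart_smooth_def split_beta comp_def)

lemma chart_smooth_subset: "chart_smooth c W F \<Longrightarrow> V \<subseteq> W \<Longrightarrow> chart_smooth c V F"
  unfolding chart_smooth_def by (erule smooth_on_subset) blast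

lemma coord_vec_apply:
  "coord_vec M c u p f = (if p \<in> fst c \<and> smooth_near M p f
     then frechet_derivative (\<lambda>x. f (chart_inv c x)) (at (snd c p)) u else 0)"
  by (simp add: coord_vec_def split_beta comp_def)

lemma admissible_chartD:
  assumes "admissible_chart M c"
  shows "open_in M (fst c)" "open (snd c ` fst c)" "inj_on (snd c) (fst c)"
    and "continuous_on (fst c) (snd c)" "continuous_on (snd c ` fst c) (chart_inv c)"
    and "fst c \<subseteq> pts M"
    and "\<And>p. p \<in> fst c \<Longrightarrow> chart_inv c (snd c p) = p"
proof -
  have h: "homeomorphism (fst c) (snd c ` fst c) (snd c) (chart_inv c)"
    and o: "open_in M (fst c)" and "open (snd c ` fst c)"
    using assms by (auto simp: admissible_chart_def)
  show "open_in M (fst c)" "open (snd c ` fst c)" by fact+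
  show inv: "chart_inv c (snd c p) = p" if "p \<in> fst c" for p
    using h that by (auto simp: homeomorphism_def)
  show "inj_on (snd c) (fst c)" by (metis inj_on_inverseI inv)
  show "continuous_on (fst c) (snd c)" "continuous_on (snd c ` fst c) (chart_inv c)"
    using h by (auto simp: homeomorphism_def)
  show "fst c \<subseteq> pts M" using openin_imp_subset[OF o] .
qed

lemma chart_image_open:
  assumes "admissible_chart M c" "open_in M W"
  shows "open (snd c ` (fst c \<inter> W))"
proof -
  have h: "homeomorphism (fst c) (snd c ` fst c) (snd c) (chart_inv c)"
    using assms by (auto simp: admissible_chart_def)
  have "openin (top_of_set (fst c)) (fst c \<inter> W)"
    using assms(2) admissible_chartD(6)[OF assms(1)] by (auto simp: openin_open)
  from homeomorphism_imp_open_map[OF h this] show ?thesis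
    using admissible_chartD(2)[OF assms(1)] openin_open_eq by blast
qed

lemma chart_preimage_open:
  assumes "admissible_chart M c" "open O'" "open_in M W"
  shows "open_in M {p \<in> fst c \<inter> W. snd c p \<in> O'}"
proof -
  have "openin (top_of_set (fst c)) (fst c \<inter> snd c -` O')"
    using continuous_openin_preimage_gen[OF admissible_chartD(4)[OF assms(1)] assms(2)] .
  then have "open_in M (fst c \<inter> snd c -` O')"
    using admissible_chartD(1)[OF assms(1)] openin_trans by blast
  then have "open_in M ((fst c \<inter> snd c -` O') \<inter> W)" using assms(3) by (rule openin_Int)
  then show ?thesis by (simp add: Int_def conj_ac)
qed

lemma chart_smooth_local:
  assumes "admissible_chart M c"
    and "\<And>p. p \<in> W \<inter> fst c \<Longrightarrow> \<exists>W'. open_in M W' \<and> p \<in> W' \<and> chart_smooth c W' F"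
  shows "chart_smooth c W F"
  unfolding chart_smooth_def
proof (rule smooth_on_local)
  fix x assume "x \<in> snd c ` (fst c \<inter> W)"
  then obtain p where p: "p \<in> W \<inter> fst c" "x = snd c p" by blast
  then obtain W' where "open_in M W'" "p \<in> W'" "chart_smooth c W' F" using assms(2) by blast
  then show "\<exists>T. open T \<and> x \<in> T \<and> smooth_on T (\<lambda>x. F (chart_inv c x))"
    using chart_image_open[OF assms(1)] p unfolding chart_smooth_def by blast
qed

lemma chart_smooth_cong:
  assumes "admissible_chart M c" "open_in M W" "\<And>p. p \<in> W \<inter> fst c \<Longrightarrow> F p = G p"
  shows "chart_smooth c W F \<longleftrightarrow> chart_smooth c W G"
  unfolding chart_smooth_def
  by (rule smooth_on_cong[OF chart_image_open[OF assms(1,2)]])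
    (use assms admissible_chartD(7)[OF assms(1)] in auto)

text \<open>\<open>c\<close> and \<open>c'\<close> may be charts of different manifolds: this also covers the restriction of a
  smooth map to a submanifold.\<close>

lemma chart_smooth_change:
  fixes c' :: "('a::topological_space, 'd::euclidean_space) chart"
  assumes "admissible_chart M c" "admissible_chart M' c'"
    and "open_in M V" "V \<subseteq> W \<inter> fst c'" "open_in M' W"
    and "chart_smooth c V (snd c')" "chart_smooth c' W F"
  shows "chart_smooth c V F"
proof -
  let ?S = "snd c ` (fst c \<inter> V)"
  have S: "open ?S" using chart_image_open[OF assms(1,3)] .
  have "(\<lambda>x. snd c' (chart_inv c x)) ` ?S \<subseteq> snd c' ` (fst c' \<inter> W)"
    using assms(4) admissible_chartD(7)[OF assms(1)] by auto
  from smooth_on_compose[OF S chart_image_open[OF assms(2,5)] this assms(6,7)[unfolded chart_smooth_def]]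
  have "smooth_on ?S (\<lambda>x. F (chart_inv c' (snd c' (chart_inv c x))))" .
  moreover have "F (chart_inv c' (snd c' (chart_inv c x))) = F (chart_inv c x)" if "x \<in> ?S" for x
    using that assms(4) admissible_chartD(7)[OF assms(1)] admissible_chartD(7)[OF assms(2)] by auto
  ultimately show ?thesis
    unfolding chart_smooth_def
    using smooth_on_cong[OF S, of "\<lambda>x. F (chart_inv c' (snd c' (chart_inv c x)))" "\<lambda>x. F (chart_inv c x)"]
    by simp
qed

lemma chart_smooth_const: "admissible_chart M c \<Longrightarrow> open_in M W \<Longrightarrow> chart_smooth c W (\<lambda>p. a)"
  unfolding chart_smooth_def by (intro smooth_on_const chart_image_open)

lemma chart_smooth_add:
  "admissible_chart M c \<Longrightarrow> open_in M W \<Longrightarrow> chart_smooth c W F \<Longrightarrow> chart_smooth c W G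
    \<Longrightarrow> chart_smooth c W (\<lambda>p. F p + G p)"
  unfolding chart_smooth_def by (intro smooth_on_add chart_image_open)

lemma chart_smooth_mult:
  fixes F G :: "'a::topological_space \<Rightarrow> real"
  shows "admissible_chart M c \<Longrightarrow> open_in M W \<Longrightarrow> chart_smooth c W F \<Longrightarrow> chart_smooth c W G
    \<Longrightarrow> chart_smooth c W (\<lambda>p. F p * G p)"
  unfolding chart_smooth_def by (intro smooth_on_mult chart_image_open)

lemma chart_smooth_post:
  fixes F :: "_ \<Rightarrow> 'd::euclidean_space"
  assumes "admissible_chart M c" "open_in M W" "chart_smooth c W F" "open T" "F ` W \<subseteq> T" "smooth_on T h"
  shows "chart_smooth c W (\<lambda>p. h (F p))"
proof -
  have "(\<lambda>x. F (chart_inv c x)) ` snd c ` (fst c \<inter> W) \<subseteq> T"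
    using assms(5) admissible_chartD(7)[OF assms(1)] by auto
  from smooth_on_compose[OF chart_image_open[OF assms(1,2)] assms(4) this
      assms(3)[unfolded chart_smooth_def] assms(6)]
  show ?thesis unfolding chart_smooth_def .
qed

lemma chart_smooth_self:
  assumes "admissible_chart M c" "open_in M W"
  shows "chart_smooth c W (snd c)"
proof -
  note S = chart_image_open[OF assms]
  have "smooth_on (snd c ` (fst c \<inter> W)) (\<lambda>x. x)"
    using smooth_on_bounded_linear[OF S bounded_linear_ident] .
  then show ?thesis
    unfolding chart_smooth_def
    using admissible_chartD(7)[OF assms(1)] by (subst smooth_on_cong[OF S, where g = "\<lambda>x. x"]) auto
qed

lemma openin_local:
  assumes "\<And>p. p \<in> W \<Longrightarrow> \<exists>V. openin T V \<and> p \<in> V \<and> V \<subseteq> W"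
  shows "openin T W"
  using assms openin_subopen by blast

section \<open>Smooth functions on a manifold\<close>

locale smooth_mfd =
  fixes M :: "('a::{t2_space, second_countable_topology}, 'e::euclidean_space) manifold"
  assumes smooth: "smooth_manifold M"
begin

abbreviation "adm \<equiv> admissible_chart M"

lemma charts_adm: "c \<in> charts M \<Longrightarrow> adm c"
  using smooth by (simp add: smooth_manifold_def)

lemma obtain_chart:
  assumes "p \<in> pts M"
  obtains c where "c \<in> charts M" "adm c" "p \<in> fst c"
proof -
  have "p \<in> (\<Union>c\<in>charts M. fst c)" using smooth assms by (simp add: smooth_manifold_def)
  then show ?thesis using that charts_adm by blast
qed

lemma open_pts: "open_in M (pts M)"
  by simp

lemma open_in_pts: "open_in M W \<Longrightarrow> p \<in> W \<Longrightarrow> p \<in> pts M"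
  using openin_imp_subset by blast

text \<open>\<open>smooth_fun\<close> tests atlas charts only. Near each point an admissible chart
  factors through an atlas chart by a smooth transition.\<close>

lemma chart_smooth_of_smooth_fun:
  assumes "adm c" "open_in M W" "smooth_fun M W f"
  shows "chart_smooth c W f"
proof (rule chart_smooth_local[OF assms(1)])
  fix p assume p: "p \<in> W \<inter> fst c"
  then obtain c0 where c0: "c0 \<in> charts M" "adm c0" "p \<in> fst c0"
    using obtain_chart open_in_pts[OF assms(2)] by blast
  have o: "open_in M (W \<inter> fst c0)" using assms(2) admissible_chartD(1)[OF c0(2)] by blast
  have "chart_smooth c (fst c0) (snd c0)"
    using assms(1) c0(1) by (auto simp: admissible_chart_def transition_smooth_iff)
  then have "chart_smooth c (W \<inter> fst c0) (snd c0)"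
    by (rule chart_smooth_subset) blast
  moreover have "chart_smooth c0 W f" using assms(3) c0(1) by (simp add: smooth_fun_def')
  ultimately have "chart_smooth c (W \<inter> fst c0) f"
    using chart_smooth_change[OF assms(1) c0(2) o _ assms(2)] by blast
  then show "\<exists>W'. open_in M W' \<and> p \<in> W' \<and> chart_smooth c W' f" using o p c0 by blast
qed

text \<open>Admissibility compares a chart with the atlas, not with other admissible charts; locally
  an atlas chart is inserted between the two.\<close>

lemma chart_transition:
  assumes "adm c" "adm c'"
  shows "chart_smooth c (fst c') (snd c')"
proof (rule chart_smooth_local[OF assms(1)])
  fix p assume p: "p \<in> fst c' \<inter> fst c"
  then obtain c0 where c0: "c0 \<in> charts M" "adm c0" "p \<in> fst c0"
    using obtain_chart admissible_chartD(6)[OF assms(1)] by blast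
  have o: "open_in M (fst c' \<inter> fst c0)" using admissible_chartD(1) assms c0(2) by blast
  have "chart_smooth c (fst c0) (snd c0)" and c': "chart_smooth c0 (fst c') (snd c')"
    using assms c0(1) by (auto simp: admissible_chart_def transition_smooth_iff)
  then have "chart_smooth c (fst c' \<inter> fst c0) (snd c0)"
    by (elim chart_smooth_subset) blast
  then have "chart_smooth c (fst c' \<inter> fst c0) (snd c')"
    using chart_smooth_change[OF assms(1) c0(2) o _ admissible_chartD(1)[OF assms(2)] _ c'] by blast
  then show "\<exists>W'. open_in M W' \<and> p \<in> W' \<and> chart_smooth c W' (snd c')" using o p c0 by blast
qed

lemma smooth_fun_of_chart_smooth:
  assumes "adm c" "open_in M W" "W \<subseteq> fst c" "chart_smooth c W f"
  shows "smooth_fun M W f"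
  unfolding smooth_fun_def'
proof
  fix c0 assume c0: "c0 \<in> charts M"
  have "chart_smooth c0 W (snd c)"
    using chart_transition[OF charts_adm[OF c0] assms(1)] chart_smooth_subset assms(3) by blast
  then show "chart_smooth c0 W f"
    using chart_smooth_change[OF charts_adm[OF c0] assms(1,2) _ assms(2) _ assms(4)] assms(3) by blast
qed

lemma smooth_fun_subset: "smooth_fun M W f \<Longrightarrow> V \<subseteq> W \<Longrightarrow> smooth_fun M V f"
  unfolding smooth_fun_def' using chart_smooth_subset by blast

lemma smooth_fun_local:
  assumes "\<And>p. p \<in> W \<Longrightarrow> \<exists>W'. open_in M W' \<and> p \<in> W' \<and> smooth_fun M W' f"
  shows "smooth_fun M W f"
  unfolding smooth_fun_def'
proof
  fix c assume c: "c \<in> charts M"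
  show "chart_smooth c W f"
    by (rule chart_smooth_local[OF charts_adm[OF c]]) (use assms c in \<open>fastforce simp: smooth_fun_def'\<close>)
qed

lemma smooth_fun_cong:
  assumes "open_in M W" "\<And>p. p \<in> W \<Longrightarrow> f p = g p"
  shows "smooth_fun M W f \<longleftrightarrow> smooth_fun M W g"
proof -
  have "chart_smooth c W f \<longleftrightarrow> chart_smooth c W g" if "c \<in> charts M" for c
    by (rule chart_smooth_cong[OF charts_adm[OF that] assms(1)]) (use assms(2) in auto)
  then show ?thesis by (simp add: smooth_fun_def')
qed

lemma smooth_fun_const: "open_in M W \<Longrightarrow> smooth_fun M W (\<lambda>p. a)"
  unfolding smooth_fun_def' using chart_smooth_const charts_adm by blast

lemma smooth_fun_add:
  "open_in M W \<Longrightarrow> smooth_fun M W f \<Longrightarrow> smooth_fun M W g \<Longrightarrow> smooth_fun M W (\<lambda>p. f p + g p)"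
  unfolding smooth_fun_def' using chart_smooth_add charts_adm by blast

lemma smooth_fun_mult:
  "open_in M W \<Longrightarrow> smooth_fun M W f \<Longrightarrow> smooth_fun M W g \<Longrightarrow> smooth_fun M W (\<lambda>p. f p * g p)"
  unfolding smooth_fun_def' using chart_smooth_mult charts_adm by blast

lemma smooth_fun_sum:
  assumes "open_in M W" "\<And>i. i \<in> I \<Longrightarrow> smooth_fun M W (f i)"
  shows "smooth_fun M W (\<lambda>p. \<Sum>i\<in>I. f i p)"
  using assms(2)
proof (induction I rule: infinite_finite_induct)
  case (insert i I)
  then show ?case using smooth_fun_add[OF assms(1), of "f i"] by simp
qed (simp_all add: smooth_fun_const[OF assms(1)])

lemma smooth_fun_compose:
  fixes h :: "real \<Rightarrow> real"
  assumes "open_in M W" "smooth_fun M W f" "open T" "f ` W \<subseteq> T" "smooth_on T h"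
  shows "smooth_fun M W (\<lambda>p. h (f p))"
  using assms chart_smooth_post[OF charts_adm assms(1) _ assms(3,4,5)] unfolding smooth_fun_def' by blast

lemma smooth_fun_coordinate:
  assumes "adm c" "open_in M W" "W \<subseteq> fst c"
  shows "smooth_fun M W (\<lambda>q. snd c q \<bullet> b)"
proof (rule smooth_fun_of_chart_smooth[OF assms])
  show "chart_smooth c W (\<lambda>q. snd c q \<bullet> b)"
    using chart_smooth_self[OF assms(1,2)] chart_image_open[OF assms(1,2)] unfolding chart_smooth_def
    by (intro smooth_on_inner smooth_on_const)
qed

lemma smooth_nearI: "open_in M W \<Longrightarrow> p \<in> W \<Longrightarrow> smooth_fun M W f \<Longrightarrow> smooth_near M p f"
  unfolding smooth_near_def by blast

lemma smooth_near_coordinate: "adm c \<Longrightarrow> p \<in> fst c \<Longrightarrow> smooth_near M p (\<lambda>q. snd c q \<bullet> b)"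
  by (rule smooth_nearI[OF admissible_chartD(1) _ smooth_fun_coordinate[OF _ admissible_chartD(1)]]) auto

lemma smooth_near_cong:
  assumes "open_in M W" "p \<in> W" "\<And>q. q \<in> W \<Longrightarrow> f q = g q"
  shows "smooth_near M p f \<longleftrightarrow> smooth_near M p g"
proof -
  have "smooth_near M p k" if h: "smooth_near M p h" and hk: "\<And>q. q \<in> W \<Longrightarrow> h q = k q" for h k
  proof -
    obtain V where V: "open_in M V" "p \<in> V" "smooth_fun M V h"
      using h by (auto simp: smooth_near_def)
    then have "smooth_fun M (V \<inter> W) k"
      using smooth_fun_cong[of "V \<inter> W" h k] smooth_fun_subset[of V h "V \<inter> W"] assms(1) hk by blast
    then show ?thesis using smooth_nearI V assms by blast
  qed
  then show ?thesis using assms(3) by metis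
qed

lemma smooth_near_obtain2:
  assumes "smooth_near M p f" "smooth_near M p g"
  obtains W where "open_in M W" "p \<in> W" "smooth_fun M W f" "smooth_fun M W g"
proof -
  obtain V W where "open_in M V" "p \<in> V" "smooth_fun M V f" "open_in M W" "p \<in> W" "smooth_fun M W g"
    using assms by (auto simp: smooth_near_def)
  then show ?thesis using smooth_fun_subset that[of "V \<inter> W"] by blast
qed

lemma smooth_near_add:
  assumes "smooth_near M p f" "smooth_near M p g" shows "smooth_near M p (\<lambda>q. f q + g q)"
  using assms by (rule smooth_near_obtain2) (blast intro: smooth_nearI smooth_fun_add)

lemma smooth_near_const: "p \<in> pts M \<Longrightarrow> smooth_near M p (\<lambda>q. a)"
  using smooth_nearI[OF open_pts] smooth_fun_const open_pts by blast

section \<open>Tangent vectors in coordinates\<close>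

lemma coord_vec_has_derivative:
  assumes "adm c" "p \<in> fst c" "smooth_near M p f"
  shows "((\<lambda>x. f (chart_inv c x)) has_derivative (\<lambda>u. coord_vec M c u p f)) (at (snd c p))"
proof -
  obtain W where W: "open_in M W" "p \<in> W" "smooth_fun M W f" using assms(3) by (auto simp: smooth_near_def)
  have "smooth_on (snd c ` (fst c \<inter> W)) (\<lambda>x. f (chart_inv c x))"
    using chart_smooth_of_smooth_fun[OF assms(1) W(1,3)] by (simp add: chart_smooth_def)
  then have "((\<lambda>x. f (chart_inv c x)) has_derivative
      frechet_derivative (\<lambda>x. f (chart_inv c x)) (at (snd c p))) (at (snd c p))"
    by (rule smooth_on_has_derivative) (use assms W in blast)
  moreover have "frechet_derivative (\<lambda>x. f (chart_inv c x)) (at (snd c p)) = (\<lambda>u. coord_vec M c u p f)"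
    using assms by (auto simp: coord_vec_apply)
  ultimately show ?thesis by simp
qed

lemma coord_vecI:
  assumes "adm c" "p \<in> fst c" "smooth_near M p f"
    and "((\<lambda>x. f (chart_inv c x)) has_derivative L) (at (snd c p))"
  shows "coord_vec M c u p f = L u"
  using has_derivative_unique[OF coord_vec_has_derivative[OF assms(1-3)] assms(4)] by metis

lemma coord_vec_not_near: "\<not> smooth_near M p f \<Longrightarrow> coord_vec M c u p f = 0"
  by (simp add: coord_vec_apply)

text \<open>On functions that are not smooth near \<open>p\<close> the vector is 0 by convention, so
  linearity in \<open>u\<close> needs no condition on \<open>f\<close>.\<close>

lemma coord_vec_linear:
  assumes "adm c" "p \<in> fst c"
  shows "linear (\<lambda>u. coord_vec M c u p f)"
proof (cases "smooth_near M p f")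
  case True
  then show ?thesis using has_derivative_linear[OF coord_vec_has_derivative[OF assms]] by blast
qed (simp add: coord_vec_not_near linear_zero)

lemma coord_vec_cong:
  assumes "adm c" "open_in M W" "p \<in> W" "\<And>q. q \<in> W \<Longrightarrow> f q = g q"
  shows "coord_vec M c u p f = coord_vec M c u p g"
proof -
  have "frechet_derivative (\<lambda>x. f (chart_inv c x)) (at (snd c p))
      = frechet_derivative (\<lambda>x. g (chart_inv c x)) (at (snd c p))" if "p \<in> fst c"
    by (rule frechet_derivative_cong_open[OF chart_image_open[OF assms(1,2)]])
      (use assms that admissible_chartD(7)[OF assms(1)] in auto)
  then show ?thesis using smooth_near_cong[OF assms(2-4)] by (simp add: coord_vec_apply)
qed

lemma coord_vec_add:
  assumes "adm c" "smooth_near M p f" "smooth_near M p g"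
  shows "coord_vec M c u p (\<lambda>q. f q + g q) = coord_vec M c u p f + coord_vec M c u p g"
proof (cases "p \<in> fst c")
  case True
  show ?thesis
    by (rule coord_vecI[OF assms(1) True smooth_near_add[OF assms(2,3)]
        has_derivative_add[OF coord_vec_has_derivative[OF assms(1) True assms(2)]
          coord_vec_has_derivative[OF assms(1) True assms(3)]]])
qed (simp add: coord_vec_apply)

lemma coord_vec_const: "coord_vec M c u p (\<lambda>q. a) = 0"
  by (simp add: coord_vec_apply)

text \<open>Chain rule through the transition map: its derivative converts the components.\<close>

lemma coord_vec_change:
  assumes "adm c" "adm c'" "p \<in> fst c" "p \<in> fst c'"
  shows "coord_vec M c u p
    = coord_vec M c' (frechet_derivative (\<lambda>x. snd c' (chart_inv c x)) (at (snd c p)) u) p"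
proof
  fix f
  show "coord_vec M c u p f
    = coord_vec M c' (frechet_derivative (\<lambda>x. snd c' (chart_inv c x)) (at (snd c p)) u) p f"
  proof (cases "smooth_near M p f")
    case True
    let ?W = "fst c \<inter> fst c'"
    have W: "open_in M ?W" using assms admissible_chartD(1) by blast
    have inv: "chart_inv c (snd c p) = p" using admissible_chartD(7) assms by blast
    have "((\<lambda>x. snd c' (chart_inv c x)) has_derivative
        frechet_derivative (\<lambda>x. snd c' (chart_inv c x)) (at (snd c p))) (at (snd c p))"
      by (rule smooth_on_has_derivative[OF chart_transition[OF assms(1,2), unfolded chart_smooth_def]])
        (use assms in blast)
    moreover have "((\<lambda>x. f (chart_inv c' x)) has_derivative (\<lambda>u. coord_vec M c' u p f))
        (at (snd c' (chart_inv c (snd c p))))"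
      using coord_vec_has_derivative[OF assms(2,4) True] inv by simp
    ultimately have "((\<lambda>x. f (chart_inv c' (snd c' (chart_inv c x)))) has_derivative
        (\<lambda>u. coord_vec M c' (frechet_derivative (\<lambda>x. snd c' (chart_inv c x)) (at (snd c p)) u) p f))
        (at (snd c p))"
      using has_derivative_compose by fast
    then have "((\<lambda>x. f (chart_inv c x)) has_derivative
        (\<lambda>u. coord_vec M c' (frechet_derivative (\<lambda>x. snd c' (chart_inv c x)) (at (snd c p)) u) p f))
        (at (snd c p))"
      by (rule has_derivative_transform_within_open[OF _ chart_image_open[OF assms(1) W]])
        (use assms admissible_chartD(7)[OF assms(1)] admissible_chartD(7)[OF assms(2)] in auto)
    then show ?thesis by (rule coord_vecI[OF assms(1,3) True])
  qed (simp add: coord_vec_not_near)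
qed

lemma components_coord_vec:
  assumes "adm c" "p \<in> fst c"
  shows "components c (coord_vec M c u p) = u"
proof -
  have "coord_vec M c u p (\<lambda>q. snd c q \<bullet> b) = u \<bullet> b" for b
  proof (rule coord_vecI[OF assms smooth_near_coordinate[OF assms]])
    show "((\<lambda>x. snd c (chart_inv c x) \<bullet> b) has_derivative (\<lambda>u. u \<bullet> b)) (at (snd c p))"
      by (rule has_derivative_transform_within_open[OF _ admissible_chartD(2)[OF assms(1)],
            where f = "\<lambda>x. x \<bullet> b"])
        (use assms admissible_chartD(7)[OF assms(1)] in \<open>auto intro!: derivative_eq_intros\<close>)
  qed
  then show ?thesis by (simp add: components_def euclidean_representation)
qed

text \<open>The definition collects vectors over all atlas charts; by the change of components any
  one admissible chart already gives all of them.\<close>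

lemma tangent_space_eq:
  assumes "adm c" "p \<in> fst c"
  shows "tangent_space M p = range (\<lambda>u. coord_vec M c u p)"
proof
  show "tangent_space M p \<subseteq> range (\<lambda>u. coord_vec M c u p)"
    using coord_vec_change[OF _ assms(1) _ assms(2)] charts_adm unfolding tangent_space_def by blast
  obtain c0 where "c0 \<in> charts M" "adm c0" "p \<in> fst c0"
    using obtain_chart admissible_chartD(6)[OF assms(1)] assms(2) by blast
  then show "range (\<lambda>u. coord_vec M c u p) \<subseteq> tangent_space M p"
    using coord_vec_change[OF assms(1) _ assms(2)] unfolding tangent_space_def by blast
qed

lemma coord_vec_in_tangent: "adm c \<Longrightarrow> p \<in> fst c \<Longrightarrow> coord_vec M c u p \<in> tangent_space M p"
  using tangent_space_eq by blast

lemma tangent_eq_coord_vec: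
  assumes "adm c" "p \<in> fst c" "v \<in> tangent_space M p"
  shows "v = coord_vec M c (components c v) p"
  using assms tangent_space_eq[OF assms(1,2)] components_coord_vec[OF assms(1,2)] by auto

lemma tangent_eqI:
  assumes "adm c" "p \<in> fst c" "v \<in> tangent_space M p" "w \<in> tangent_space M p"
    and "components c v = components c w"
  shows "v = w"
  using tangent_eq_coord_vec[OF assms(1,2)] assms by metis

lemma tangent_obtain:
  assumes "v \<in> tangent_space M p"
  obtains c u where "c \<in> charts M" "adm c" "p \<in> fst c" "v = coord_vec M c u p"
  using assms charts_adm unfolding tangent_space_def by blast

lemma tangent_in_pts: "v \<in> tangent_space M p \<Longrightarrow> p \<in> pts M"
  by (metis tangent_obtain admissible_chartD(6) subsetD)

lemma tangent_lincomb:
  assumes "v \<in> tangent_space M p" "w \<in> tangent_space M p"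
  shows "(\<lambda>f. a * v f + b * w f) \<in> tangent_space M p"
proof -
  obtain c u where c: "adm c" "p \<in> fst c" "v = coord_vec M c u p"
    using assms(1) tangent_obtain by metis
  obtain u' where u': "w = coord_vec M c u' p" using assms(2) tangent_space_eq[OF c(1,2)] by blast
  have "(\<lambda>f. a * v f + b * w f) = coord_vec M c (a *\<^sub>R u + b *\<^sub>R u') p"
    using linear_add[OF coord_vec_linear[OF c(1,2)]] linear_cmul[OF coord_vec_linear[OF c(1,2)]] c(3) u'
    by (intro ext) simp
  then show ?thesis using coord_vec_in_tangent[OF c(1,2)] by simp
qed

lemma tangent_zero: "p \<in> pts M \<Longrightarrow> (\<lambda>f. 0) \<in> tangent_space M p"
  by (erule obtain_chart) (use tangent_lincomb[of _ p _ 0 0] coord_vec_in_tangent in fastforce)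

text \<open>A tangent vector sees only germs: neither the derivative nor the cut-off notices a
  change away from \<open>p\<close>.\<close>

lemma tangent_cong:
  assumes "v \<in> tangent_space M p" "open_in M W" "p \<in> W" "\<And>q. q \<in> W \<Longrightarrow> f q = g q"
  shows "v f = v g"
proof -
  obtain c u where c: "adm c" "v = coord_vec M c u p" using tangent_obtain[OF assms(1)] by metis
  show ?thesis unfolding c(2) by (rule coord_vec_cong[OF c(1) assms(2-4)])
qed

lemma tangent_add:
  assumes "v \<in> tangent_space M p" "smooth_near M p f" "smooth_near M p g"
  shows "v (\<lambda>q. f q + g q) = v f + v g"
proof -
  obtain c u where c: "adm c" "v = coord_vec M c u p" using tangent_obtain[OF assms(1)] by metis
  show ?thesis unfolding c(2) by (rule coord_vec_add[OF c(1) assms(2,3)])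
qed

lemma tangent_const: "v \<in> tangent_space M p \<Longrightarrow> v (\<lambda>q. a) = 0"
  by (metis tangent_obtain coord_vec_const)

lemma tangent_not_near: "v \<in> tangent_space M p \<Longrightarrow> \<not> smooth_near M p f \<Longrightarrow> v f = 0"
  by (metis tangent_obtain coord_vec_not_near)

section \<open>Smooth vector fields\<close>

lemma vfieldsD:
  assumes "X \<in> vfields M W"
  shows "p \<in> W \<Longrightarrow> X p \<in> tangent_space M p" "p \<notin> W \<Longrightarrow> X p = (\<lambda>_. 0)"
    "open_in M V \<Longrightarrow> V \<subseteq> W \<Longrightarrow> smooth_fun M V f \<Longrightarrow> smooth_fun M V (\<lambda>p. X p f)"
  using assms by (auto simp: vfields_def)

lemma components_inner: "b \<in> Basis \<Longrightarrow> components c v \<bullet> b = v (\<lambda>q. snd c q \<bullet> b)"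
  by (simp add: components_def inner_sum_left inner_Basis if_distrib[where f = "\<lambda>x. _ * x"] cong: if_cong)

lemma components_lincomb: "components c (\<lambda>f. a * v f + b * w f) = a *\<^sub>R components c v + b *\<^sub>R components c w"
  by (simp add: components_def scaleR_sum_right sum.distrib algebra_simps)

lemma vfields_components:
  assumes "adm c" "X \<in> vfields M W" "open_in M V" "V \<subseteq> W" "V \<subseteq> fst c" "b \<in> Basis"
  shows "smooth_fun M V (\<lambda>p. components c (X p) \<bullet> b)"
  using vfieldsD(3)[OF assms(2,3,4) smooth_fun_coordinate[OF assms(1,3,5)]] assms(6)
  by (simp add: components_inner)

lemma coord_vec_expand:
  assumes "adm c" "p \<in> fst c"
  shows "coord_vec M c u p f = (\<Sum>b\<in>Basis. (u \<bullet> b) * coord_vec M c b p f)"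
  using linear_sum[OF coord_vec_linear[OF assms], of "\<lambda>b. (u \<bullet> b) *\<^sub>R b" Basis]
    linear_cmul[OF coord_vec_linear[OF assms]]
  by (simp add: euclidean_representation)

lemma coord_vec_smooth:
  assumes "adm c" "open_in M V" "V \<subseteq> fst c" "smooth_fun M V f"
  shows "smooth_fun M V (\<lambda>p. coord_vec M c u p f)"
proof (rule smooth_fun_of_chart_smooth[OF assms(1-3)])
  let ?S = "snd c ` (fst c \<inter> V)"
  have S: "open ?S" using chart_image_open[OF assms(1,2)] .
  have "smooth_on ?S (\<lambda>x. frechet_derivative (\<lambda>x. f (chart_inv c x)) (at x) u)"
    using chart_smooth_of_smooth_fun[OF assms(1,2,4)] unfolding chart_smooth_def
    by (rule smooth_on_frechet_derivative)
  moreover have "frechet_derivative (\<lambda>x. f (chart_inv c x)) (at x) u = coord_vec M c u (chart_inv c x) f"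
    if x: "x \<in> ?S" for x
    using x smooth_nearI[OF assms(2) _ assms(4)] admissible_chartD(7)[OF assms(1)]
    by (auto simp: coord_vec_apply)
  ultimately show "chart_smooth c V (\<lambda>p. coord_vec M c u p f)"
    unfolding chart_smooth_def
    using smooth_on_cong[OF S, of "\<lambda>x. frechet_derivative (\<lambda>x. f (chart_inv c x)) (at x) u"
        "\<lambda>x. coord_vec M c u (chart_inv c x) f"] by simp
qed

text \<open>Within one chart X f is the sum of the components of X times the coordinate derivatives
  of f, so smooth components suffice.\<close>

lemma vfieldsI_components:
  assumes "adm c" "open_in M W" "W \<subseteq> fst c"
    and "\<And>p. p \<in> W \<Longrightarrow> X p \<in> tangent_space M p" "\<And>p. p \<notin> W \<Longrightarrow> X p = (\<lambda>_. 0)"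
    and "\<And>b. b \<in> Basis \<Longrightarrow> smooth_fun M W (\<lambda>p. components c (X p) \<bullet> b)"
  shows "X \<in> vfields M W"
proof -
  have "smooth_fun M V (\<lambda>p. X p f)" if V: "open_in M V" "V \<subseteq> W" "smooth_fun M V f" for V f
  proof -
    have "smooth_fun M V (\<lambda>p. \<Sum>b\<in>Basis. (components c (X p) \<bullet> b) * coord_vec M c b p f)"
      using assms V smooth_fun_subset[OF assms(6) V(2)]
      by (intro smooth_fun_sum smooth_fun_mult coord_vec_smooth V) auto
    moreover have "X p f = (\<Sum>b\<in>Basis. (components c (X p) \<bullet> b) * coord_vec M c b p f)" if "p \<in> V" for p
      using coord_vec_expand[OF assms(1)] tangent_eq_coord_vec[OF assms(1) _ assms(4)] assms(3) V(2) that
      by (metis subsetD)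
    ultimately show ?thesis
      using smooth_fun_cong[OF V(1), of "\<lambda>p. X p f"
          "\<lambda>p. \<Sum>b\<in>Basis. (components c (X p) \<bullet> b) * coord_vec M c b p f"] by simp
  qed
  then show ?thesis using assms(4,5) by (simp add: vfields_def)
qed

lemma coord_vec_vfield:
  assumes "adm c"
  shows "coord_vec M c u \<in> vfields M (fst c)"
proof (rule vfieldsI_components[OF assms admissible_chartD(1)[OF assms] order_refl])
  note o = admissible_chartD(1)[OF assms]
  show "smooth_fun M (fst c) (\<lambda>p. components c (coord_vec M c u p) \<bullet> b)" for b
    using smooth_fun_cong[OF o, of "\<lambda>p. components c (coord_vec M c u p) \<bullet> b" "\<lambda>p. u \<bullet> b"]
      components_coord_vec[OF assms] smooth_fun_const[OF o] by simp
qed (auto simp: coord_vec_in_tangent[OF assms] coord_vec_apply)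

lemma vfields_restrict:
  assumes "X \<in> vfields M W" "V \<subseteq> W" "open_in M V"
  shows "restrict_vfield V X \<in> vfields M V"
proof -
  have "smooth_fun M V' (\<lambda>p. restrict_vfield V X p f)"
    if "open_in M V'" "V' \<subseteq> V" "smooth_fun M V' f" for V' f
    using vfieldsD(3)[OF assms(1) that(1) _ that(3)] assms(2) that(2)
      smooth_fun_cong[OF that(1), of "\<lambda>p. restrict_vfield V X p f" "\<lambda>p. X p f"]
    by (auto simp: restrict_vfield_def subset_iff)
  then show ?thesis
    using vfieldsD(1)[OF assms(1)] assms(2) by (auto simp: vfields_def restrict_vfield_def)
qed

lemma vfields_scale_add:
  assumes "open_in M W" "X \<in> vfields M W" "Z \<in> vfields M W" "smooth_fun M W f"
  shows "(\<lambda>p h. f p * X p h + Z p h) \<in> vfields M W"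
proof -
  have "smooth_fun M V (\<lambda>p. f p * X p h + Z p h)"
    if "open_in M V" "V \<subseteq> W" "smooth_fun M V h" for V h
    using vfieldsD(3)[OF assms(2) that] vfieldsD(3)[OF assms(3) that] smooth_fun_subset[OF assms(4) that(2)]
    by (intro smooth_fun_add smooth_fun_mult that)
  moreover have "(\<lambda>h. f p * X p h + Z p h) \<in> tangent_space M p" if "p \<in> W" for p
    using tangent_lincomb[OF vfieldsD(1)[OF assms(2) that] vfieldsD(1)[OF assms(3) that], of "f p" 1] by simp
  ultimately show ?thesis
    using vfieldsD(2)[OF assms(2)] vfieldsD(2)[OF assms(3)] by (simp add: vfields_def)
qed

lemma vfields_zero: "open_in M W \<Longrightarrow> (\<lambda>p h. 0) \<in> vfields M W"
  using tangent_zero open_in_pts smooth_fun_const by (auto simp: vfields_def)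

lemma vfields_sum:
  assumes "open_in M W" "finite B" "\<And>b. b \<in> B \<Longrightarrow> X b \<in> vfields M W" "\<And>b. b \<in> B \<Longrightarrow> smooth_fun M W (f b)"
  shows "(\<lambda>p h. \<Sum>b\<in>B. f b p * X b p h) \<in> vfields M W"
  using assms(2-4)
proof (induction B)
  case empty
  then show ?case using vfields_zero[OF assms(1)] by simp
next
  case (insert b B)
  then show ?case using vfields_scale_add[OF assms(1), of "X b" _ "f b"] by simp
qed

end

section \<open>Affine connections\<close>

context smooth_mfd
begin

lemma affine_connectionD:
  assumes "affine_connection M D" "open_in M W" "X \<in> vfields M W" "Y \<in> vfields M W"
  shows "D W X Y \<in> vfields M W"
    and "Z \<in> vfields M W \<Longrightarrow> smooth_fun M W f \<Longrightarrow>
        D W (\<lambda>p h. f p * X p h + Z p h) Y = (\<lambda>p h. f p * D W X Y p h + D W Z Y p h)"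
    and "Z \<in> vfields M W \<Longrightarrow> smooth_fun M W f \<Longrightarrow>
        D W X (\<lambda>p h. f p * Y p h + Z p h)
          = (\<lambda>p h. X p f * Y p h + f p * D W X Y p h + D W X Z p h)"
    and "open_in M V \<Longrightarrow> V \<subseteq> W \<Longrightarrow>
        D V (restrict_vfield V X) (restrict_vfield V Y) = restrict_vfield V (D W X Y)"
proof -
  note * = assms(1)[unfolded affine_connection_def, THEN spec, THEN mp, OF assms(2),
      THEN bspec, OF assms(3), THEN bspec, OF assms(4)]
  show "D W X Y \<in> vfields M W" using *[THEN conjunct1] .
  show "D W (\<lambda>p h. f p * X p h + Z p h) Y = (\<lambda>p h. f p * D W X Y p h + D W Z Y p h)"
    if "Z \<in> vfields M W" "smooth_fun M W f"
    using *[THEN conjunct2, THEN conjunct1, THEN bspec, OF that(1), THEN spec, THEN mp, OF that(2)] .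
  show "D W X (\<lambda>p h. f p * Y p h + Z p h)
      = (\<lambda>p h. X p f * Y p h + f p * D W X Y p h + D W X Z p h)"
    if "Z \<in> vfields M W" "smooth_fun M W f"
    using *[THEN conjunct2, THEN conjunct2, THEN conjunct1, THEN bspec, OF that(1), THEN spec, THEN mp, OF that(2)] .
  show "D V (restrict_vfield V X) (restrict_vfield V Y) = restrict_vfield V (D W X Y)"
    if "open_in M V" "V \<subseteq> W"
    using *[THEN conjunct2, THEN conjunct2, THEN conjunct2, THEN spec, THEN mp, OF conjI, OF that] .
qed

lemma connection_restrict_at:
  assumes "affine_connection M D" "open_in M W" "X \<in> vfields M W" "Y \<in> vfields M W"
    and "open_in M V" "V \<subseteq> W" "p \<in> V"
  shows "D W X Y p = D V (restrict_vfield V X) (restrict_vfield V Y) p"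
  using affine_connectionD(4)[OF assms(1-6)] assms(7) by (simp add: restrict_vfield_def)

lemma connection_sum_left:
  assumes "affine_connection M D" "open_in M W" "Y \<in> vfields M W" "finite B"
    and "\<And>b. b \<in> B \<Longrightarrow> X b \<in> vfields M W" "\<And>b. b \<in> B \<Longrightarrow> smooth_fun M W (f b)"
  shows "D W (\<lambda>p h. \<Sum>b\<in>B. f b p * X b p h) Y = (\<lambda>p h. \<Sum>b\<in>B. f b p * D W (X b) Y p h)"
  using assms(4-6)
proof (induction B)
  case empty
  note z = vfields_zero[OF assms(2)]
  \<comment> \<open>Additivity with coefficient 1 at the zero field gives d = d + d, so the
    derivative vanishes.\<close>
  have "D W (\<lambda>p h. 1 * 0 + 0) Y = (\<lambda>p h. 1 * D W (\<lambda>p h. 0) Y p h + D W (\<lambda>p h. 0) Y p h)"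
    by (rule affine_connectionD(2)[OF assms(1,2) z assms(3) z smooth_fun_const[OF assms(2)]])
  then have "D W (\<lambda>p h. 0) Y p h = D W (\<lambda>p h. 0) Y p h + D W (\<lambda>p h. 0) Y p h" for p h
    by (simp add: fun_eq_iff)
  then show ?case by simp
next
  case (insert b B)
  have "D W (\<lambda>p h. f b p * X b p h + (\<Sum>b\<in>B. f b p * X b p h)) Y
      = (\<lambda>p h. f b p * D W (X b) Y p h + D W (\<lambda>p h. \<Sum>b\<in>B. f b p * X b p h) Y p h)"
    by (rule affine_connectionD(2)[OF assms(1,2) _ assms(3)])
      (use insert vfields_sum[OF assms(2) insert.hyps(1), of X f] in auto)
  then show ?case using insert by simp
qed

lemma connection_sum_right:
  assumes "affine_connection M D" "open_in M W" "X \<in> vfields M W" "finite B"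
    and "\<And>b. b \<in> B \<Longrightarrow> Y b \<in> vfields M W" "\<And>b. b \<in> B \<Longrightarrow> smooth_fun M W (f b)"
  shows "D W X (\<lambda>p h. \<Sum>b\<in>B. f b p * Y b p h)
    = (\<lambda>p h. \<Sum>b\<in>B. X p (f b) * Y b p h + f b p * D W X (Y b) p h)"
  using assms(4-6)
proof (induction B)
  case empty
  note z = vfields_zero[OF assms(2)]
  have "D W X (\<lambda>p h. 1 * 0 + 0)
      = (\<lambda>p h. X p (\<lambda>p. 1) * 0 + 1 * D W X (\<lambda>p h. 0) p h + D W X (\<lambda>p h. 0) p h)"
    by (rule affine_connectionD(3)[OF assms(1,2,3) z z smooth_fun_const[OF assms(2)]])
  then have "D W X (\<lambda>p h. 0) p h = D W X (\<lambda>p h. 0) p h + D W X (\<lambda>p h. 0) p h" for p h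
    by (simp add: fun_eq_iff)
  then show ?case by simp
next
  case (insert b B)
  have "D W X (\<lambda>p h. f b p * Y b p h + (\<Sum>b\<in>B. f b p * Y b p h))
      = (\<lambda>p h. X p (f b) * Y b p h + f b p * D W X (Y b) p h + D W X (\<lambda>p h. \<Sum>b\<in>B. f b p * Y b p h) p h)"
    by (rule affine_connectionD(3)[OF assms(1,2,3)])
      (use insert vfields_sum[OF assms(2) insert.hyps(1), of Y f] in auto)
  then show ?case using insert by simp
qed

text \<open>Off \<open>W\<close> both sides are 0. The equation is thus one between fields, which is
  what rewriting an argument of a connection requires.\<close>

lemma vfield_expand:
  assumes "adm c" "X \<in> vfields M W" "W \<subseteq> fst c"
  shows "X = (\<lambda>p h. \<Sum>b\<in>Basis. (components c (X p) \<bullet> b) * restrict_vfield W (coord_vec M c b) p h)"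
proof (intro ext)
  fix p h
  show "X p h = (\<Sum>b\<in>Basis. (components c (X p) \<bullet> b) * restrict_vfield W (coord_vec M c b) p h)"
  proof (cases "p \<in> W")
    case True
    then have "p \<in> fst c" using assms(3) by blast
    have "X p h = coord_vec M c (components c (X p)) p h"
      using tangent_eq_coord_vec[OF assms(1) \<open>p \<in> fst c\<close> vfieldsD(1)[OF assms(2) True]] by (rule fun_cong)
    also have "\<dots> = (\<Sum>b\<in>Basis. (components c (X p) \<bullet> b) * restrict_vfield W (coord_vec M c b) p h)"
      by (subst coord_vec_expand[OF assms(1) \<open>p \<in> fst c\<close>]) (simp add: restrict_vfield_def True)
    finally show ?thesis .
  qed (simp add: vfieldsD(2)[OF assms(2)] restrict_vfield_def)
qed

lemma components_sum: "components c (\<lambda>h. \<Sum>b\<in>B. a b * v b h) = (\<Sum>b\<in>B. a b *\<^sub>R components c (v b))"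
proof -
  have "components c (\<lambda>h. \<Sum>b\<in>B. a b * v b h)
      = (\<Sum>i\<in>Basis. \<Sum>b\<in>B. a b *\<^sub>R v b (\<lambda>q. snd c q \<bullet> i) *\<^sub>R i)"
    by (simp add: components_def scaleR_sum_left)
  also have "\<dots> = (\<Sum>b\<in>B. \<Sum>i\<in>Basis. a b *\<^sub>R v b (\<lambda>q. snd c q \<bullet> i) *\<^sub>R i)"
    by (rule sum.swap)
  finally show ?thesis by (simp add: components_def scaleR_sum_right)
qed

text \<open>The classical expression X(Y^k) + Gamma^k(X, Y). The Christoffel part is written as the
  derivative of fields with constant components on the whole chart domain, the form in which the
  geodesic equation uses it.\<close>

lemma components_connection:
  assumes D: "affine_connection M D" and c: "adm c" and W: "open_in M W"
    and X: "X \<in> vfields M W" and Y: "Y \<in> vfields M W" and p: "p \<in> W" "p \<in> fst c"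
  shows "components c (D W X Y p) =
    (\<Sum>b\<in>Basis. X p (\<lambda>q. components c (Y q) \<bullet> b) *\<^sub>R b) +
    components c (D (fst c) (coord_vec M c (components c (X p))) (coord_vec M c (components c (Y p))) p)"
proof -
  define V where "V = W \<inter> fst c"
  have V: "open_in M V" "V \<subseteq> W" "V \<subseteq> fst c" "p \<in> V"
    using W admissible_chartD(1)[OF c] p by (auto simp: V_def)
  define E where "E u = restrict_vfield V (coord_vec M c u)" for u
  have E: "E u \<in> vfields M V" for u
    unfolding E_def by (rule vfields_restrict[OF coord_vec_vfield[OF c] V(3,1)])
  have E_comp: "components c (E u q) = u" if "q \<in> V" for u q
    using components_coord_vec[OF c] V(3) that by (auto simp: E_def restrict_vfield_def)
  have comp_smooth: "smooth_fun M V (\<lambda>q. components c (Z q) \<bullet> b)" if "Z \<in> vfields M V" "b \<in> Basis" for Z b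
    using vfields_components[OF c that(1) V(1) order_refl V(3) that(2)] .
  have expand: "Z = (\<lambda>q h. \<Sum>b\<in>Basis. (components c (Z q) \<bullet> b) * E b q h)" if "Z \<in> vfields M V" for Z
    using vfield_expand[OF c that V(3)] by (simp add: E_def)
  \<comment> \<open>Linearity over functions in the first slot: only the value of the field at
    \<open>p\<close> matters.\<close>
  have left: "D V Z Z2 p = D V (E (components c (Z p))) Z2 p"
    if Z: "Z \<in> vfields M V" "Z2 \<in> vfields M V" for Z Z2
  proof -
    have *: "D V Z' Z2 p = (\<lambda>h. \<Sum>b\<in>Basis. (components c (Z' p) \<bullet> b) * D V (E b) Z2 p h)"
      if Z': "Z' \<in> vfields M V" for Z'
    proof -
      have "D V (\<lambda>q h. \<Sum>b\<in>Basis. (components c (Z' q) \<bullet> b) * E b q h) Z2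
          = (\<lambda>q h. \<Sum>b\<in>Basis. (components c (Z' q) \<bullet> b) * D V (E b) Z2 q h)"
        by (rule connection_sum_left[OF D V(1) Z(2) finite_Basis E comp_smooth[OF Z']])
      then show ?thesis using expand[OF Z'] by (metis (no_types, lifting))
    qed
    show ?thesis using *[OF Z(1)] *[OF E, of "components c (Z p)"] E_comp[OF V(4)] by simp
  qed
  define X1 where "X1 = restrict_vfield V X"
  define Y1 where "Y1 = restrict_vfield V Y"
  have X1: "X1 \<in> vfields M V" and Y1: "Y1 \<in> vfields M V"
    unfolding X1_def Y1_def using vfields_restrict X Y V by blast+
  have XY: "X1 p = X p" "Y1 p = Y p" using V(4) by (auto simp: X1_def Y1_def restrict_vfield_def)
  have right: "D V X1 Z p = (\<lambda>h. \<Sum>b\<in>Basis. X1 p (\<lambda>q. components c (Z q) \<bullet> b) * E b p h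
      + (components c (Z p) \<bullet> b) * D V X1 (E b) p h)" if Z: "Z \<in> vfields M V" for Z
  proof -
    have "D V X1 (\<lambda>q h. \<Sum>b\<in>Basis. (components c (Z q) \<bullet> b) * E b q h)
        = (\<lambda>q h. \<Sum>b\<in>Basis. X1 q (\<lambda>q. components c (Z q) \<bullet> b) * E b q h
          + (components c (Z q) \<bullet> b) * D V X1 (E b) q h)"
      by (rule connection_sum_right[OF D V(1) X1 finite_Basis E comp_smooth[OF Z]])
    then show ?thesis using expand[OF Z] by (metis (no_types, lifting))
  qed
  have X1p: "X1 p \<in> tangent_space M p" using vfieldsD(1)[OF X1 V(4)] .
  \<comment> \<open>Fields with constant components contribute no derivative term. Comparing the
    Leibniz expansions of \<open>Y1\<close> and of the constant extension of its value at
    \<open>p\<close> therefore isolates that term.\<close>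
  have const: "X1 p (\<lambda>q. components c (E u q) \<bullet> b) = 0" for u b
    using tangent_cong[OF X1p V(1,4), of "\<lambda>q. components c (E u q) \<bullet> b" "\<lambda>q. u \<bullet> b"] E_comp
      tangent_const[OF X1p] by simp
  have "D V X1 Y1 p h = (\<Sum>b\<in>Basis. X1 p (\<lambda>q. components c (Y1 q) \<bullet> b) * E b p h)
      + D V X1 (E (components c (Y1 p))) p h" for h
    using right[OF Y1] right[OF E, of "components c (Y1 p)"] const E_comp[OF V(4)]
    by (simp add: sum.distrib)
  then have "D V X1 Y1 p = (\<lambda>h. 1 * (\<Sum>b\<in>Basis. X1 p (\<lambda>q. components c (Y1 q) \<bullet> b) * E b p h)
      + 1 * D V X1 (E (components c (Y1 p))) p h)" by auto
  then have "components c (D V X1 Y1 p) = (\<Sum>b\<in>Basis. X1 p (\<lambda>q. components c (Y1 q) \<bullet> b) *\<^sub>R b)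
      + components c (D V X1 (E (components c (Y1 p))) p)"
    by (simp add: components_lincomb[of c 1 _ 1, simplified] components_sum E_comp[OF V(4)])
  also have "D V X1 (E (components c (Y1 p))) p
      = D (fst c) (coord_vec M c (components c (X p))) (coord_vec M c (components c (Y p))) p"
    using left[OF X1 E] XY connection_restrict_at[OF D admissible_chartD(1)[OF c]
        coord_vec_vfield[OF c] coord_vec_vfield[OF c] V(1,3,4)]
    by (simp add: E_def)
  also have "(\<lambda>b. X1 p (\<lambda>q. components c (Y1 q) \<bullet> b)) = (\<lambda>b. X p (\<lambda>q. components c (Y q) \<bullet> b))"
    unfolding XY[symmetric]
    by (intro ext tangent_cong[OF X1p V(1,4)]) (simp add: Y1_def restrict_vfield_def)
  also have "D V X1 Y1 p = D W X Y p"
    using connection_restrict_at[OF D W X Y V(1,2,4)] by (simp add: X1_def Y1_def)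
  finally show ?thesis .
qed

text \<open>The argument is the one for uniqueness of the Levi-Civita connection: for a trilinear
  form symmetric in the first two slots and skew in the last two, alternating the two symmetries
  three times returns to the start with the opposite sign.\<close>

lemma dual_connection_eq:
  assumes g: "riemannian_metric M g" and DD': "dual_connections M g D D'"
    and tf: "torsion_free M D" "torsion_free M D'" and lc: "levi_civita M g Dg"
    and W: "open_in M W" and X: "X \<in> vfields M W" and Y: "Y \<in> vfields M W"
  shows "D' W X Y = (\<lambda>p h. 2 * Dg W X Y p h - D W X Y p h)"
proof -
  have aff: "affine_connection M D" "affine_connection M D'" "affine_connection M Dg"
    and tfg: "torsion_free M Dg"
    using DD' lc by (auto simp: dual_connections_def levi_civita_def)
  define S where "S X Y = (\<lambda>p h. D W X Y p h + D' W X Y p h - 2 * Dg W X Y p h)" for X Y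
  have lin: "S X Y \<in> vfields M W" if XY: "X \<in> vfields M W" "Y \<in> vfields M W" for X Y
  proof -
    note v = affine_connectionD(1)[OF aff(1) W XY] affine_connectionD(1)[OF aff(2) W XY]
      affine_connectionD(1)[OF aff(3) W XY]
    have "(\<lambda>p h. (-2) * Dg W X Y p h + (1 * D W X Y p h + D' W X Y p h)) \<in> vfields M W"
      by (intro vfields_scale_add W v smooth_fun_const)
    then show ?thesis by (simp add: S_def algebra_simps)
  qed
  have sym: "S X Y = S Y X" if XY: "X \<in> vfields M W" "Y \<in> vfields M W" for X Y
  proof (intro ext)
    fix p h
    have "D0 W X Y p h - D0 W Y X p h = lie_bracket M X Y p h" if "torsion_free M D0" for D0
      using that W XY unfolding torsion_free_def by (metis (no_types, lifting))
    from this[OF tf(1)] this[OF tf(2)] this[OF tfg] show "S X Y p h = S Y X p h"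
      by (simp add: S_def)
  qed
  have g_sym: "g p u v = g p v u" if "p \<in> W" "u \<in> tangent_space M p" "v \<in> tangent_space M p" for p u v
    using g that open_in_pts[OF W] unfolding riemannian_metric_def by blast
  have g_lin: "g p (\<lambda>f. a * u f + v f) w = a * g p u w + g p v w"
    if "p \<in> W" "u \<in> tangent_space M p" "v \<in> tangent_space M p" "w \<in> tangent_space M p" for p u v w a
    using g that open_in_pts[OF W] unfolding riemannian_metric_def by blast
  have g_S: "g p (S X Y p) (Z p) = g p (D W X Y p) (Z p) + g p (D' W X Y p) (Z p) - 2 * g p (Dg W X Y p) (Z p)"
    if "X \<in> vfields M W" "Y \<in> vfields M W" "Z \<in> vfields M W" "p \<in> W" for X Y Z p
  proof -
    have t: "D W X Y p \<in> tangent_space M p" "D' W X Y p \<in> tangent_space M p"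
      "Dg W X Y p \<in> tangent_space M p" "Z p \<in> tangent_space M p"
      using affine_connectionD(1)[OF aff(1) W that(1,2)] affine_connectionD(1)[OF aff(2) W that(1,2)]
        affine_connectionD(1)[OF aff(3) W that(1,2)] that vfieldsD(1) by blast+
    have t2: "(\<lambda>h. 1 * D W X Y p h + D' W X Y p h) \<in> tangent_space M p"
      using tangent_lincomb[OF t(1,2), of 1 1] by simp
    have "S X Y p = (\<lambda>h. (-2) * Dg W X Y p h + (1 * D W X Y p h + D' W X Y p h))"
      by (auto simp: S_def)
    then have "g p (S X Y p) (Z p) = g p (\<lambda>h. (-2) * Dg W X Y p h + (1 * D W X Y p h + D' W X Y p h)) (Z p)"
      by (rule arg_cong)
    then show ?thesis
      unfolding g_lin[OF that(4) t(3) t2 t(4)] g_lin[OF that(4) t(1,2,4)] by simp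
  qed
  have skew: "g p (S X Y p) (Z p) = - g p (S X Z p) (Y p)"
    if v: "X \<in> vfields M W" "Y \<in> vfields M W" "Z \<in> vfields M W" and p: "p \<in> W" for X Y Z p
  proof -
    \<comment> \<open>Duality is not symmetric in the two connections; its instances for (Y, Z) and
      (Z, Y) add up to twice the metric compatibility of the average connection.\<close>
    have dual: "X p (\<lambda>q. g q (Y q) (Z q)) = g p (D W X Y p) (Z p) + g p (Y p) (D' W X Z p)"
      if "Y \<in> vfields M W" "Z \<in> vfields M W" for Y Z
      using DD' W v(1) that p unfolding dual_connections_def by blast
    have lcg: "X p (\<lambda>q. g q (Y q) (Z q)) = g p (Dg W X Y p) (Z p) + g p (Y p) (Dg W X Z p)"
      using lc W v p unfolding levi_civita_def by blast
    have "X p (\<lambda>q. g q (Y q) (Z q)) = X p (\<lambda>q. g q (Z q) (Y q))"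
      by (rule tangent_cong[OF vfieldsD(1)[OF v(1) p] W p])
        (use g_sym vfieldsD(1) v in blast)
    moreover have t: "Y p \<in> tangent_space M p" "Z p \<in> tangent_space M p"
      "D' W X Z p \<in> tangent_space M p" "D' W X Y p \<in> tangent_space M p" "Dg W X Z p \<in> tangent_space M p"
      using vfieldsD(1)[OF _ p] v affine_connectionD(1)[OF aff(2) W v(1)] affine_connectionD(1)[OF aff(3) W v(1)]
      by blast+
    ultimately show ?thesis
      using dual[OF v(2,3)] dual[OF v(3,2)] lcg g_S[OF v p] g_S[OF v(1,3,2) p]
        g_sym[OF p t(1,3)] g_sym[OF p t(2,4)] g_sym[OF p t(1,5)] by linarith
  qed
  have "S X Y p = (\<lambda>h. 0)" for p
  proof (cases "p \<in> W")
    case True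
    \<comment> \<open>Testing against the difference field itself turns the vanishing of the form
      into the vanishing of the field, by definiteness of \<open>g\<close>.\<close>
    let ?Z = "S X Y"
    have Z: "?Z \<in> vfields M W" using lin X Y by blast
    have "g p (S X Y p) (?Z p) = 0"
      using skew[OF X Y Z True] sym[OF X Z] skew[OF Z X Y True] sym[OF Z Y] skew[OF Y Z X True] sym[OF Y X]
      by simp
    then show ?thesis
      using g vfieldsD(1)[OF Z True] open_in_pts[OF W True] unfolding riemannian_metric_def
      by (metis less_irrefl)
  qed (use lin[OF X Y] vfieldsD(2) in blast)
  then have "D W X Y p h + D' W X Y p h - 2 * Dg W X Y p h = 0" for p h
    by (metis S_def)
  then show ?thesis by (intro ext) (simp add: algebra_simps)
qed

end

section \<open>One-dimensional submanifolds\<close>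

locale submfd = P: smooth_mfd P + N: smooth_mfd N
  for P :: "('a::{t2_space, second_countable_topology}, 'e::euclidean_space) manifold"
    and N :: "('a, real) manifold" +
  assumes emb: "embedded_submanifold P N"
begin

lemma pts_sub: "p \<in> pts N \<Longrightarrow> p \<in> pts P"
  using emb by (auto simp: embedded_submanifold_def)

lemma open_restrict: "open_in P W \<Longrightarrow> open_in N (W \<inter> pts N)"
  using pts_sub by (auto simp: openin_open)

lemma open_extend:
  assumes "open_in N A"
  obtains W where "open_in P W" "W \<inter> pts N = A"
proof -
  obtain T where "open T" "A = pts N \<inter> T" using assms by (auto simp: openin_open)
  then show ?thesis using that[of "pts P \<inter> T"] pts_sub by auto
qed

lemma inclusion_smooth: "c \<in> charts N \<Longrightarrow> c' \<in> charts P \<Longrightarrow> chart_smooth c (fst c') (snd c')"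
  using emb by (auto simp: embedded_submanifold_def transition_smooth_iff)

lemma push_inj: "p \<in> pts N \<Longrightarrow> inj_on (push P p) (tangent_space N p)"
  using emb by (simp add: embedded_submanifold_def)

text \<open>Near each point of \<open>N\<close> the inclusion is read in an ambient chart, where it
  is smooth.\<close>

lemma restrict_smooth_fun:
  assumes "open_in P W" "smooth_fun P W f"
  shows "smooth_fun N (W \<inter> pts N) f"
  unfolding smooth_fun_def'
proof
  fix c assume c: "c \<in> charts N"
  show "chart_smooth c (W \<inter> pts N) f"
  proof (rule chart_smooth_local[OF N.charts_adm[OF c]])
    fix p assume p: "p \<in> W \<inter> pts N \<inter> fst c"
    then obtain c' where c': "c' \<in> charts P" "P.adm c'" "p \<in> fst c'"
      using P.obtain_chart pts_sub by blast
    have o: "open_in N (W \<inter> fst c' \<inter> pts N)"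
      using open_restrict assms(1) admissible_chartD(1)[OF c'(2)] by blast
    have "chart_smooth c (W \<inter> fst c' \<inter> pts N) (snd c')"
      by (rule chart_smooth_subset[OF inclusion_smooth[OF c c'(1)]]) blast
    moreover have "chart_smooth c' W f" using assms(2) c'(1) by (simp add: smooth_fun_def')
    ultimately have "chart_smooth c (W \<inter> fst c' \<inter> pts N) f"
      using chart_smooth_change[OF N.charts_adm[OF c] c'(2) o _ assms(1)] by blast
    then show "\<exists>W'. open_in N W' \<and> p \<in> W' \<and> chart_smooth c W' f" using o p c'(3) by blast
  qed
qed

lemma restrict_smooth_near: "smooth_near P p f \<Longrightarrow> p \<in> pts N \<Longrightarrow> smooth_near N p f"
  using restrict_smooth_fun open_restrict unfolding smooth_near_def by blast

section \<open>The differential of the inclusion\<close>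

lemma push_apply: "smooth_near P p f \<Longrightarrow> push P p v f = v f"
  by (simp add: push_def)

lemma push_lincomb: "push P p (\<lambda>f. a * v f + b * w f) = (\<lambda>f. a * push P p v f + b * push P p w f)"
  by (auto simp: push_def)

lemma components_push: "P.adm c' \<Longrightarrow> p \<in> fst c' \<Longrightarrow> components c' (push P p v) = components c' v"
  by (simp add: components_def push_apply P.smooth_near_coordinate)

lemma inclusion_near_coordinate:
  "P.adm c' \<Longrightarrow> p \<in> fst c' \<Longrightarrow> p \<in> pts N \<Longrightarrow> smooth_near N p (\<lambda>q. snd c' q \<bullet> b)"
  using restrict_smooth_near[OF P.smooth_near_coordinate] .

lemma inclusion_has_derivative:
  assumes "N.adm c" "p \<in> fst c" "P.adm c'" "p \<in> fst c'"
  shows "((\<lambda>t. snd c' (chart_inv c t)) has_derivative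
    (\<lambda>u. components c' (coord_vec N c u p))) (at (snd c p))"
proof -
  have p: "p \<in> pts N" using admissible_chartD(6)[OF assms(1)] assms(2) by blast
  have "((\<lambda>t. \<Sum>b\<in>Basis. (snd c' (chart_inv c t) \<bullet> b) *\<^sub>R b) has_derivative
      (\<lambda>u. \<Sum>b\<in>Basis. coord_vec N c u p (\<lambda>q. snd c' q \<bullet> b) *\<^sub>R b)) (at (snd c p))"
    by (intro has_derivative_sum has_derivative_scaleR_left
        N.coord_vec_has_derivative[OF assms(1,2) inclusion_near_coordinate[OF assms(3,4) p]])
  then show ?thesis by (simp add: euclidean_representation components_def)
qed

text \<open>Chain rule through the inclusion: in an ambient chart the pushed vector is the
  coordinate vector with the same components.\<close>

lemma push_tangent:
  assumes "v \<in> tangent_space N p"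
  shows "push P p v \<in> tangent_space P p"
proof -
  obtain c u where c: "c \<in> charts N" "N.adm c" "p \<in> fst c" "v = coord_vec N c u p"
    using N.tangent_obtain[OF assms] by metis
  have p: "p \<in> pts N" using N.tangent_in_pts[OF assms] .
  obtain c' where c': "c' \<in> charts P" "P.adm c'" "p \<in> fst c'"
    using P.obtain_chart pts_sub[OF p] by metis
  have "push P p v f = coord_vec P c' (components c' v) p f" for f
  proof (cases "smooth_near P p f")
    case True
    have inv: "chart_inv c (snd c p) = p" using admissible_chartD(7)[OF c(2,3)] .
    have "((\<lambda>x. f (chart_inv c' x)) has_derivative (\<lambda>u. coord_vec P c' u p f))
        (at (snd c' (chart_inv c (snd c p))))"
      using P.coord_vec_has_derivative[OF c'(2,3) True] inv by simp
    from has_derivative_compose[OF inclusion_has_derivative[OF c(2,3) c'(2,3)] this]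
    have d: "((\<lambda>t. f (chart_inv c' (snd c' (chart_inv c t)))) has_derivative
        (\<lambda>u. coord_vec P c' (components c' (coord_vec N c u p)) p f)) (at (snd c p))" .
    have o: "open_in N (fst c' \<inter> pts N)" using open_restrict admissible_chartD(1)[OF c'(2)] .
    have "((\<lambda>t. f (chart_inv c t)) has_derivative
        (\<lambda>u. coord_vec P c' (components c' (coord_vec N c u p)) p f)) (at (snd c p))"
      by (rule has_derivative_transform_within_open[OF d chart_image_open[OF c(2) o]])
        (use c c' p admissible_chartD(7)[OF c(2)] admissible_chartD(7)[OF c'(2)] in auto)
    from N.coord_vecI[OF c(2,3) restrict_smooth_near[OF True p] this] show ?thesis
      using c(4) by (simp add: push_apply[OF True])
  qed (simp add: push_def P.coord_vec_not_near)
  then have "push P p v = coord_vec P c' (components c' v) p" by blast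
  then show ?thesis using P.coord_vec_in_tangent[OF c'(2,3)] by simp
qed

text \<open>Otherwise \<open>push\<close> would send the coordinate vector of \<open>N\<close> to
  the same functional as the zero vector, against injectivity of the differential.\<close>

lemma inclusion_derivative_nonzero:
  assumes "N.adm c" "p \<in> fst c" "P.adm c'" "p \<in> fst c'"
  shows "components c' (coord_vec N c 1 p) \<noteq> 0"
proof
  assume z: "components c' (coord_vec N c 1 p) = 0"
  have p: "p \<in> pts N" using admissible_chartD(6)[OF assms(1)] assms(2) by blast
  have t: "coord_vec N c 1 p \<in> tangent_space N p" "coord_vec N c 0 p \<in> tangent_space N p"
    using N.coord_vec_in_tangent[OF assms(1,2)] by auto
  have "coord_vec N c 0 p = (\<lambda>f. 0)"
    using linear_0[OF N.coord_vec_linear[OF assms(1,2)]] by blast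
  then have "components c' (coord_vec N c 0 p) = 0" by (simp add: components_def)
  then have "push P p (coord_vec N c 1 p) = push P p (coord_vec N c 0 p)"
    using P.tangent_eqI[OF assms(3,4) push_tangent[OF t(1)] push_tangent[OF t(2)]] z
      components_push[OF assms(3,4)] by simp
  then have "coord_vec N c 1 p = coord_vec N c 0 p"
    using push_inj[OF p] t by (simp add: inj_on_def)
  then show False using N.components_coord_vec[OF assms(1,2)] by (metis zero_neq_one)
qed

text \<open>A coordinate of \<open>P\<close> with nonzero derivative along \<open>N\<close> can be inverted on \<open>N\<close>, which
  gives a local retraction of \<open>P\<close> onto \<open>N\<close>.\<close>

lemma local_retraction:
  assumes A: "open_in N A" and p: "p \<in> A" and c': "c' \<in> charts P" "p \<in> fst c'"
  obtains W r where "open_in P W" "p \<in> W" "W \<subseteq> fst c'" "W \<inter> pts N \<subseteq> A"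
    "\<And>q. q \<in> W \<inter> pts N \<Longrightarrow> r q = q"
    "\<And>f. smooth_fun N A f \<Longrightarrow> smooth_fun P W (\<lambda>q. f (r q))"
proof -
  have c'_adm: "P.adm c'" using P.charts_adm c'(1) .
  have pN: "p \<in> pts N" using N.open_in_pts[OF A p] .
  obtain c where c: "c \<in> charts N" "N.adm c" "p \<in> fst c" using N.obtain_chart[OF pN] by metis
  note inv = admissible_chartD(7)[OF c(2)]
  define B where "B = A \<inter> (fst c' \<inter> pts N)"
  have B: "open_in N B" unfolding B_def
    using A open_restrict[OF admissible_chartD(1)[OF c'_adm]] by blast
  define S where "S = snd c ` (fst c \<inter> B)"
  have S: "open S" unfolding S_def using chart_image_open[OF c(2) B] .
  \<comment> \<open>An ambient coordinate along which \<open>N\<close> moves at \<open>p\<close>,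
    hence a parameter of \<open>N\<close> near \<open>p\<close>.\<close>
  obtain b where b: "b \<in> Basis" "components c' (coord_vec N c 1 p) \<bullet> b \<noteq> 0"
    using inclusion_derivative_nonzero[OF c(2,3) c'_adm c'(2)] euclidean_all_zero_iff by blast
  define f where "f t = snd c' (chart_inv c t) \<bullet> b" for t
  have "chart_smooth c B (snd c')"
    by (rule chart_smooth_subset[OF inclusion_smooth[OF c(1) c'(1)]]) (auto simp: B_def)
  then have f_smooth: "smooth_on S f"
    unfolding f_def S_def chart_smooth_def
    by (rule smooth_on_inner[OF chart_image_open[OF c(2) B] _ smooth_on_const[OF chart_image_open[OF c(2) B]]])
  define f1 where "f1 t = frechet_derivative f (at t) 1" for t
  define t0 where "t0 = snd c p"
  have t0: "t0 \<in> S" unfolding t0_def S_def B_def using p c(3) c'(2) pN by blast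
  have "(f has_derivative (\<lambda>u. components c' (coord_vec N c u p) \<bullet> b)) (at t0)"
    unfolding f_def t0_def
    using inclusion_has_derivative[OF c(2,3) c'_adm c'(2)] by (rule has_derivative_inner_left)
  then have f1_t0: "f1 t0 \<noteq> 0"
    using b(2) frechet_derivative_at unfolding f1_def by metis
  have "continuous_on S f1"
    unfolding f1_def using smooth_on_imp_continuous_on[OF smooth_on_frechet_derivative[OF f_smooth]] .
  then have "open (S \<inter> f1 -` (- {0}))" using S continuous_open_preimage[of S f1 "- {0}"] by blast
  then obtain e where e: "e > 0" "ball t0 e \<subseteq> S \<inter> f1 -` (- {0})"
    using t0 f1_t0 open_contains_ball by (metis ComplI IntI singletonD vimageI)
  define J where "J = ball t0 e"
  have J: "open J" "t0 \<in> J" "J \<subseteq> S" "\<And>t. t \<in> J \<Longrightarrow> f1 t \<noteq> 0"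
    using e by (auto simp: J_def)
  have f_deriv: "(f has_real_derivative f1 t) (at t)" if "t \<in> S" for t
    using smooth_on_has_vector_derivative[OF f_smooth that]
    by (simp add: f1_def has_real_derivative_iff_has_vector_derivative)
  have f_cont: "continuous_on J f"
    using smooth_on_imp_continuous_on[OF f_smooth] continuous_on_subset J(3) by blast
  have "inj_on f J"
  proof (rule linorder_inj_onI)
    fix x y assume xy: "x < y" "x \<in> J" "y \<in> J"
    have sub: "{x..y} \<subseteq> J"
      using xy(2,3) unfolding J_def by (auto simp: ball_def dist_real_def)
    show "f x \<noteq> f y"
    proof
      assume "f x = f y"
      have "\<exists>z. x < z \<and> z < y \<and> (f has_real_derivative 0) (at z)"
      proof (rule Rolle[OF xy(1) \<open>f x = f y\<close> continuous_on_subset[OF f_cont sub]])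
        show "f differentiable (at z)" if "x < z" "z < y" for z
        proof -
          have "z \<in> {x..y}" using that by simp
          then have "z \<in> S" using sub J(3) by blast
          then show ?thesis using f_deriv real_differentiable_def by blast
        qed
      qed
      then obtain z where z: "x < z" "z < y" "(f has_real_derivative 0) (at z)" by blast
      then have "z \<in> {x..y}" by simp
      then have "z \<in> J" using sub by blast
      then have "f1 z = 0" using DERIV_unique[OF f_deriv z(3)] J(3) by blast
      then show False using J(4) \<open>z \<in> J\<close> by blast
    qed
  qed auto
  then obtain k where k: "homeomorphism J (f ` J) f k" and T: "open (f ` J)"
    using invariance_of_domain_homeomorphism[OF J(1) f_cont] invariance_of_domain[OF f_cont J(1)] by auto
  have k_smooth: "smooth_on (f ` J) k"
  proof (rule smooth_on_inverse_function[OF J(1) T smooth_on_subset[OF f_smooth J(3)]])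
    show "frechet_derivative f (at t) 1 \<noteq> 0" if "t \<in> J" for t using J(4)[OF that] by (simp add: f1_def)
  qed (use k in \<open>auto simp: homeomorphism_def\<close>)
  \<comment> \<open>Other parts of \<open>N\<close> may run through the chart \<open>c'\<close>. The
    subspace topology provides an ambient open set that meets \<open>N\<close> exactly in the
    parametrized piece.\<close>
  obtain Q where Q: "open_in P Q" "Q \<inter> pts N = {q \<in> fst c \<inter> B. snd c q \<in> J}"
    using open_extend[OF chart_preimage_open[OF c(2) J(1) B]] .
  have "open {x. x \<bullet> b \<in> f ` J}"
    using open_vimage[OF T continuous_on_inner[OF continuous_on_id continuous_on_const], of b]
    by (simp add: vimage_def)
  then have W: "open_in P {q \<in> fst c' \<inter> Q. snd c' q \<in> {x. x \<bullet> b \<in> f ` J}}" (is "open_in P ?W")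
    using chart_preimage_open[OF c'_adm _ Q(1)] by blast
  \<comment> \<open>Read off the coordinate in direction \<open>b\<close> and return to the point of
    \<open>N\<close> that has it: the fibres lie in level sets of a single ambient
    coordinate.\<close>
  define r where "r q = chart_inv c (k (snd c' q \<bullet> b))" for q
  show ?thesis
  proof (rule that[of ?W r])
    show "open_in P ?W" by (rule W)
    have "f t0 = snd c' p \<bullet> b" by (simp add: f_def t0_def inv[OF c(3)])
    moreover have "p \<in> Q"
      using Q(2) c(3) p c'(2) pN J(2) unfolding B_def t0_def by blast
    ultimately show "p \<in> ?W" using c'(2) J(2) by (metis (mono_tags, lifting) IntI imageI mem_Collect_eq)
    show "?W \<subseteq> fst c'" by blast
    show "?W \<inter> pts N \<subseteq> A" using Q(2) by (auto simp: B_def)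
    show "r q = q" if "q \<in> ?W \<inter> pts N" for q
    proof -
      have q: "q \<in> fst c" "snd c q \<in> J" using Q(2) that by auto
      then have "f (snd c q) = snd c' q \<bullet> b" by (simp add: f_def inv)
      then show ?thesis using k q inv by (auto simp: r_def homeomorphism_def)
    qed
    show "smooth_fun P ?W (\<lambda>q. h (r q))" if h: "smooth_fun N A h" for h
    proof -
      have "chart_smooth c B h"
        by (rule chart_smooth_subset[where W = A]) (use h c(1) in \<open>auto simp: smooth_fun_def' B_def\<close>)
      then have hs: "smooth_on S (\<lambda>t. h (chart_inv c t))" by (simp add: chart_smooth_def S_def)
      have kT: "k ` f ` J \<subseteq> S" using k J(3) by (auto simp: homeomorphism_def)
      have "smooth_on (f ` J) (\<lambda>s. h (chart_inv c (k s)))"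
        by (rule smooth_on_compose[OF T S kT k_smooth hs])
      from P.smooth_fun_compose[OF W P.smooth_fun_coordinate[OF c'_adm W] T _ this, of b]
      show ?thesis unfolding r_def by blast
    qed
  qed
qed

text \<open>The ambient components of a field are continued as constants along the fibres of the
  retraction. \<open>W\<close> comes before the fields and functions, so that several of them can be
  extended on the same set.\<close>

lemma local_extension:
  assumes V: "open_in N V" and p: "p \<in> V"
  obtains W where "open_in P W" "p \<in> W" "W \<inter> pts N \<subseteq> V"
    "\<And>X. X \<in> vfields N V \<Longrightarrow> \<exists>X'. extends_vfield P N W X X'"
    "\<And>f. smooth_fun N V f \<Longrightarrow> \<exists>f'. smooth_fun P W f' \<and> (\<forall>q\<in>W \<inter> pts N. f' q = f q)"
proof -
  have pN: "p \<in> pts N" using N.open_in_pts[OF V p] .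
  obtain c' where c': "c' \<in> charts P" "P.adm c'" "p \<in> fst c'"
    using P.obtain_chart pts_sub[OF pN] by metis
  define A where "A = V \<inter> (fst c' \<inter> pts N)"
  have A: "open_in N A" "A \<subseteq> V"
    unfolding A_def using V open_restrict[OF admissible_chartD(1)[OF c'(2)]] by blast+
  have "p \<in> A" using p c'(3) pN by (simp add: A_def)
  from local_retraction[OF A(1) this c'(1,3)]
  obtain W r where W: "open_in P W" "p \<in> W" "W \<subseteq> fst c'" "W \<inter> pts N \<subseteq> A"
    and r_id: "\<And>q. q \<in> W \<inter> pts N \<Longrightarrow> r q = q"
    and r_smooth: "\<And>f. smooth_fun N A f \<Longrightarrow> smooth_fun P W (\<lambda>q. f (r q))" by metis
  show ?thesis
  proof (rule that[OF W(1,2)])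
    show "W \<inter> pts N \<subseteq> V" using W(4) A(2) by blast
    show "\<exists>f'. smooth_fun P W f' \<and> (\<forall>q\<in>W \<inter> pts N. f' q = f q)" if "smooth_fun N V f" for f
      using r_smooth[OF N.smooth_fun_subset[OF that A(2)]] r_id by (intro exI[of _ "\<lambda>q. f (r q)"]) auto
    show "\<exists>X'. extends_vfield P N W X X'" if X: "X \<in> vfields N V" for X
    proof -
      define X' where "X' q = (if q \<in> W then coord_vec P c' (components c' (X (r q))) q else (\<lambda>f. 0))" for q
      have comp: "components c' (X' q) = components c' (X (r q))" if "q \<in> W" for q
        using P.components_coord_vec[OF c'(2)] W(3) that by (auto simp: X'_def)
      have "X' \<in> vfields P W"
      proof (rule P.vfieldsI_components[OF c'(2) W(1,3)])
        show "X' q \<in> tangent_space P q" if "q \<in> W" for q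
          using P.coord_vec_in_tangent[OF c'(2)] that W(3) by (auto simp: X'_def)
        show "X' q = (\<lambda>_. 0)" if "q \<notin> W" for q using that by (simp add: X'_def)
        fix b :: 'e assume b: "b \<in> Basis"
        have "smooth_fun N A (\<lambda>n. snd c' n \<bullet> b)"
          using restrict_smooth_fun[OF admissible_chartD(1)[OF c'(2)] P.smooth_fun_coordinate[OF c'(2) admissible_chartD(1)[OF c'(2)]]]
          by (rule N.smooth_fun_subset) (auto simp: A_def)
        then have "smooth_fun N A (\<lambda>n. X n (\<lambda>n. snd c' n \<bullet> b))"
          by (rule N.vfieldsD(3)[OF X A])
        then have "smooth_fun P W (\<lambda>q. X (r q) (\<lambda>n. snd c' n \<bullet> b))" by (rule r_smooth)
        then show "smooth_fun P W (\<lambda>q. components c' (X' q) \<bullet> b)"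
          using P.smooth_fun_cong[OF W(1), of "\<lambda>q. components c' (X' q) \<bullet> b" "\<lambda>q. X (r q) (\<lambda>n. snd c' n \<bullet> b)"]
          by (simp add: comp P.components_inner[OF b])
      qed
      moreover have "X' q = push P q (X q)" if q: "q \<in> W \<inter> pts N" for q
      proof -
        have "q \<in> V" "q \<in> fst c'" using W(3,4) A(2) q by auto
        then have "push P q (X q) = coord_vec P c' (components c' (push P q (X q))) q"
          using P.tangent_eq_coord_vec[OF c'(2)] push_tangent N.vfieldsD(1)[OF X] by blast
        then show ?thesis
          using q r_id[OF q] components_push[OF c'(2) \<open>q \<in> fst c'\<close>] by (simp add: X'_def)
      qed
      ultimately show ?thesis unfolding extends_vfield_def by blast
    qed
  qed
qed

text \<open>At points of \<open>N\<close> the field \<open>X'\<close> is tangent to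
  \<open>N\<close>, so it differentiates the components of \<open>Y'\<close> along \<open>N\<close>
  only. The right-hand side contains no extension, hence the ambient derivative does not depend on
  the choice.\<close>

lemma components_extension:
  assumes D: "affine_connection P D" and c': "P.adm c'" and W: "open_in P W"
    and p: "p \<in> W" "p \<in> fst c'" "p \<in> pts N"
    and V: "open_in N V" "W \<inter> pts N \<subseteq> V" and X: "X \<in> vfields N V" and Y: "Y \<in> vfields N V"
    and X': "extends_vfield P N W X X'" and Y': "extends_vfield P N W Y Y'"
  shows "components c' (D W X' Y' p) =
    (\<Sum>b\<in>Basis. X p (\<lambda>q. components c' (Y q) \<bullet> b) *\<^sub>R b) +
    components c' (D (fst c') (coord_vec P c' (components c' (X p))) (coord_vec P c' (components c' (Y p))) p)"
proof -
  have vf: "X' \<in> vfields P W" "Y' \<in> vfields P W"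
    and eq: "\<And>q. q \<in> W \<inter> pts N \<Longrightarrow> X' q = push P q (X q)" "\<And>q. q \<in> W \<inter> pts N \<Longrightarrow> Y' q = push P q (Y q)"
    using X' Y' by (auto simp: extends_vfield_def)
  have comp: "components c' (X' q) = components c' (X q)" "components c' (Y' q) = components c' (Y q)"
    if "q \<in> W \<inter> fst c' \<inter> pts N" for q
    using eq components_push[OF c'] that by auto
  have o: "open_in P (W \<inter> fst c')" using W admissible_chartD(1)[OF c'] by blast
  have "X' p (\<lambda>q. components c' (Y' q) \<bullet> b) = X p (\<lambda>q. components c' (Y q) \<bullet> b)" if b: "b \<in> Basis" for b
  proof -
    have "smooth_near P p (\<lambda>q. components c' (Y' q) \<bullet> b)"
      using P.smooth_nearI[OF o _ P.vfields_components[OF c' vf(2) o _ _ b]] p by blast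
    then have "X' p (\<lambda>q. components c' (Y' q) \<bullet> b) = X p (\<lambda>q. components c' (Y' q) \<bullet> b)"
      using eq(1) p push_apply by simp
    also have "\<dots> = X p (\<lambda>q. components c' (Y q) \<bullet> b)"
      by (rule N.tangent_cong[OF N.vfieldsD(1)[OF X] open_restrict[OF o]]) (use p V comp in auto)
    finally show ?thesis .
  qed
  then show ?thesis
    using P.components_connection[OF D c' W vf p(1,2)] comp[of p] p by simp
qed

end

section \<open>The induced structure\<close>

context submfd
begin

text \<open>Fields are given on \<open>V\<close>, while a test function may be smooth on a smaller
  \<open>V1\<close> only; both are extended on one common ambient set.\<close>

lemma field_extension:
  assumes V: "V1 \<subseteq> V" "open_in N V1" and p: "p \<in> V1"
  obtains W where "open_in P W" "p \<in> W" "W \<inter> pts N \<subseteq> V1"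
    "\<forall>X\<in>vfields N V. \<exists>X'. extends_vfield P N W X X'"
    "\<forall>f. smooth_fun N V1 f \<longrightarrow> (\<exists>f'. smooth_fun P W f' \<and> (\<forall>q\<in>W \<inter> pts N. f' q = f q))"
proof -
  obtain W where W: "open_in P W" "p \<in> W" "W \<inter> pts N \<subseteq> V1"
    and ext: "\<And>X. X \<in> vfields N V1 \<Longrightarrow> \<exists>X'. extends_vfield P N W X X'"
      "\<And>f. smooth_fun N V1 f \<Longrightarrow> \<exists>f'. smooth_fun P W f' \<and> (\<forall>q\<in>W \<inter> pts N. f' q = f q)"
    using local_extension[OF V(2) p] by metis
  have "\<exists>X'. extends_vfield P N W X X'" if X: "X \<in> vfields N V" for X
  proof -
    obtain X' where X': "extends_vfield P N W (restrict_vfield V1 X) X'"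
      using ext(1) N.vfields_restrict[OF X V] by blast
    then have "extends_vfield P N W X X'"
      using W(3) by (auto simp: extends_vfield_def restrict_vfield_def subset_iff)
    then show ?thesis by blast
  qed
  then show ?thesis using ext(2) by (intro that[OF W]) blast+
qed

lemma extends_vfieldD:
  assumes "extends_vfield P N W X X'"
  shows "X' \<in> vfields P W" "q \<in> W \<Longrightarrow> q \<in> pts N \<Longrightarrow> X' q = push P q (X q)"
  using assms by (auto simp: extends_vfield_def)

lemma push_eqD:
  assumes "push P p v = push P p w" "v \<in> tangent_space N p" "w \<in> tangent_space N p"
  shows "v = w"
  using inj_onD[OF push_inj[OF N.tangent_in_pts[OF assms(2)]] assms] .

text \<open>A derivative in a direction tangent to \<open>N\<close> depends only on values along
  \<open>N\<close>.\<close>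

lemma extension_apply:
  assumes X': "extends_vfield P N W X X'" and W: "open_in P W" "W \<inter> pts N \<subseteq> V" and X: "X \<in> vfields N V"
    and p: "p \<in> W" "p \<in> pts N" and f: "smooth_fun P W f'" "\<And>q. q \<in> W \<inter> pts N \<Longrightarrow> f' q = f q"
  shows "X' p f' = X p f"
proof -
  have "X' p f' = X p f'"
    using extends_vfieldD(2)[OF X' p] push_apply[OF P.smooth_nearI[OF W(1) p(1) f(1)]] by simp
  also have "\<dots> = X p f"
    by (rule N.tangent_cong[OF N.vfieldsD(1)[OF X] open_restrict[OF W(1)]]) (use p W f in auto)
  finally show ?thesis .
qed

text \<open>This resolves the definite description: autoparallelity provides a representing vector,
  independence of the extensions fixes the ambient derivative, and injectivity of
  \<open>push\<close> fixes the vector.\<close>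

lemma induced_connection_extension:
  assumes D: "affine_connection P D" and ap: "autoparallel P N D"
    and V: "open_in N V" and X: "X \<in> vfields N V" and Y: "Y \<in> vfields N V"
    and W: "open_in P W" "W \<inter> pts N \<subseteq> V" and p: "p \<in> W" "p \<in> pts N"
    and X': "extends_vfield P N W X X'" and Y': "extends_vfield P N W Y Y'"
  shows "induced_connection P N D V X Y p \<in> tangent_space N p"
    and "push P p (induced_connection P N D V X Y p) = D W X' Y' p"
proof -
  have pV: "p \<in> V" using W p by blast
  obtain c' where c': "P.adm c'" "p \<in> fst c'" using P.obtain_chart pts_sub[OF p(2)] by metis
  let ?Q = "\<lambda>v. v \<in> tangent_space N p \<and> (\<exists>W X' Y'. open_in P W \<and> p \<in> W \<and> W \<inter> pts N \<subseteq> V \<and>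
    extends_vfield P N W X X' \<and> extends_vfield P N W Y Y' \<and> push P p v = D W X' Y' p)"
  have "tangent_to P N W X'" "tangent_to P N W Y'"
    using extends_vfieldD(2)[OF X'] extends_vfieldD(2)[OF Y'] N.vfieldsD(1)[OF X] N.vfieldsD(1)[OF Y] W(2)
    unfolding tangent_to_def by blast+
  then have "tangent_to P N W (D W X' Y')"
    using ap W(1) extends_vfieldD(1)[OF X'] extends_vfieldD(1)[OF Y'] unfolding autoparallel_def by blast
  then obtain v where v: "v \<in> tangent_space N p" "D W X' Y' p = push P p v"
    using p unfolding tangent_to_def by blast
  have eq: "u = v" if u: "?Q u" for u
  proof -
    obtain W2 X2 Y2 where u2: "u \<in> tangent_space N p" "open_in P W2" "p \<in> W2" "W2 \<inter> pts N \<subseteq> V"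
      "extends_vfield P N W2 X X2" "extends_vfield P N W2 Y Y2" "push P p u = D W2 X2 Y2 p"
      using u by blast
    have "components c' (D W2 X2 Y2 p) = components c' (D W X' Y' p)"
      using components_extension[OF D c'(1) u2(2,3) c'(2) p(2) V u2(4) X Y u2(5,6)]
        components_extension[OF D c'(1) W(1) p(1) c'(2) p(2) V W(2) X Y X' Y'] by simp
    then have "push P p u = push P p v"
      using P.tangent_eqI[OF c' push_tangent[OF u2(1)] push_tangent[OF v(1)]] u2(7) v(2) by simp
    then show ?thesis using push_eqD u2(1) v(1) by blast
  qed
  have "?Q v" using v W p X' Y' by metis
  then have "(THE v. ?Q v) = v" using eq by (rule the_equality)
  then have "induced_connection P N D V X Y p = v" using pV by (simp add: induced_connection_def)
  then show "induced_connection P N D V X Y p \<in> tangent_space N p"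
    "push P p (induced_connection P N D V X Y p) = D W X' Y' p"
    using v by auto
qed

text \<open>For coordinate fields of \<open>N\<close> the first term becomes the second derivative
  of the inclusion, which is what the geodesic equation in an ambient chart requires.\<close>

lemma components_induced_connection:
  assumes D: "affine_connection P D" and ap: "autoparallel P N D"
    and V: "open_in N V" and X: "X \<in> vfields N V" and Y: "Y \<in> vfields N V"
    and p: "p \<in> V" and c': "P.adm c'" "p \<in> fst c'"
  shows "components c' (induced_connection P N D V X Y p) =
    (\<Sum>b\<in>Basis. X p (\<lambda>q. components c' (Y q) \<bullet> b) *\<^sub>R b) +
    components c' (D (fst c') (coord_vec P c' (components c' (X p))) (coord_vec P c' (components c' (Y p))) p)"
proof -
  have pN: "p \<in> pts N" using N.open_in_pts[OF V p] .
  obtain W where W: "open_in P W" "p \<in> W" "W \<inter> pts N \<subseteq> V"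
    and ext: "\<forall>X\<in>vfields N V. \<exists>X'. extends_vfield P N W X X'"
    by (rule field_extension[OF order_refl V p])
  obtain X' Y' where e: "extends_vfield P N W X X'" "extends_vfield P N W Y Y'"
    using ext X Y by blast
  show ?thesis
    using induced_connection_extension(2)[OF D ap V X Y W(1,3,2) pN e]
      components_push[OF c', of "induced_connection P N D V X Y p"]
      components_extension[OF D c'(1) W(1,2) c'(2) pN V W(3) X Y e] by simp
qed

text \<open>Each algebraic axiom is checked after \<open>push\<close>, where it is the axiom of
  \<open>D\<close> for local extensions; injectivity of \<open>push\<close> brings it back to
  \<open>N\<close>.\<close>

lemma affine_induced_connection:
  assumes D: "affine_connection P D" and ap: "autoparallel P N D"
  shows "affine_connection N (induced_connection P N D)"
proof -
  let ?I = "induced_connection P N D"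
  note ie = induced_connection_extension[OF D ap]
  have tangent: "?I V X Y p \<in> tangent_space N p"
    if h: "open_in N V" "X \<in> vfields N V" "Y \<in> vfields N V" "p \<in> V" for V X Y p
  proof -
    obtain W where W: "open_in P W" "p \<in> W" "W \<inter> pts N \<subseteq> V"
      and ext: "\<forall>X\<in>vfields N V. \<exists>X'. extends_vfield P N W X X'"
      by (rule field_extension[OF order_refl h(1,4)])
    obtain X' Y' where e: "extends_vfield P N W X X'" "extends_vfield P N W Y Y'"
      using ext h(2,3) by blast
    show ?thesis using ie(1)[OF h(1-3) W(1,3,2) N.open_in_pts[OF h(1,4)] e] .
  qed
  have off: "?I V X Y p = (\<lambda>_. 0)" if "p \<notin> V" for V X Y p
    using that by (simp add: induced_connection_def)
  have closed: "?I V X Y \<in> vfields N V"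
    if V: "open_in N V" and X: "X \<in> vfields N V" and Y: "Y \<in> vfields N V" for V X Y
  proof -
    have "smooth_fun N V1 (\<lambda>p. ?I V X Y p f)"
      if V1: "open_in N V1" "V1 \<subseteq> V" and f: "smooth_fun N V1 f" for V1 f
    proof (rule N.smooth_fun_local)
      fix p assume p: "p \<in> V1"
      obtain W where W: "open_in P W" "p \<in> W" "W \<inter> pts N \<subseteq> V1"
        and ext: "\<forall>X\<in>vfields N V. \<exists>X'. extends_vfield P N W X X'"
          "\<forall>f. smooth_fun N V1 f \<longrightarrow> (\<exists>f'. smooth_fun P W f' \<and> (\<forall>q\<in>W \<inter> pts N. f' q = f q))"
        by (rule field_extension[OF V1(2,1) p])
      have WV: "W \<inter> pts N \<subseteq> V" using W(3) V1(2) by blast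
      obtain X' Y' where e: "extends_vfield P N W X X'" "extends_vfield P N W Y Y'"
        using ext(1) X Y by blast
      obtain f' where f': "smooth_fun P W f'" "\<And>q. q \<in> W \<inter> pts N \<Longrightarrow> f' q = f q"
        using ext(2) f by blast
      have DW: "D W X' Y' \<in> vfields P W"
        using P.affine_connectionD(1)[OF D W(1)] extends_vfieldD(1) e by blast
      \<comment> \<open>Along \<open>N\<close> the induced derivative applied to \<open>f\<close> is
        the ambient one applied to an extension of \<open>f\<close>, and restrictions of smooth
        ambient functions are smooth.\<close>
      have "D W X' Y' q f' = ?I V X Y q f" if q: "q \<in> W \<inter> pts N" for q
      proof -
        have q': "q \<in> W" "q \<in> pts N" "q \<in> V" using q WV by auto
        have "D W X' Y' q f' = ?I V X Y q f'"
          using ie(2)[OF V X Y W(1) WV q'(1,2) e] push_apply[OF P.smooth_nearI[OF W(1) q'(1) f'(1)]]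
          by metis
        also have "\<dots> = ?I V X Y q f"
          by (rule N.tangent_cong[OF tangent[OF V X Y q'(3)] open_restrict[OF W(1)] q f'(2)])
        finally show ?thesis .
      qed
      moreover have "smooth_fun N (W \<inter> pts N) (\<lambda>q. D W X' Y' q f')"
        using restrict_smooth_fun[OF W(1)] P.vfieldsD(3)[OF DW W(1) order_refl f'(1)] by blast
      ultimately have "smooth_fun N (W \<inter> pts N) (\<lambda>q. ?I V X Y q f)"
        using N.smooth_fun_cong[OF open_restrict[OF W(1)], of "\<lambda>q. D W X' Y' q f'" "\<lambda>q. ?I V X Y q f"]
        by blast
      then show "\<exists>W'. open_in N W' \<and> p \<in> W' \<and> smooth_fun N W' (\<lambda>p. ?I V X Y p f)"
        using open_restrict[OF W(1)] W(2) N.open_in_pts[OF V1(1) p] by blast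
    qed
    then show ?thesis using tangent[OF V X Y] off by (simp add: vfields_def)
  qed
  have left: "?I V (\<lambda>p h. f p * X p h + Z p h) Y = (\<lambda>p h. f p * ?I V X Y p h + ?I V Z Y p h)"
    if V: "open_in N V" and X: "X \<in> vfields N V" and Y: "Y \<in> vfields N V" and Z: "Z \<in> vfields N V"
      and f: "smooth_fun N V f" for V X Y Z f
  proof
    fix p
    show "?I V (\<lambda>p h. f p * X p h + Z p h) Y p = (\<lambda>h. f p * ?I V X Y p h + ?I V Z Y p h)"
    proof (cases "p \<in> V")
      case p: True
      have pN: "p \<in> pts N" using N.open_in_pts[OF V p] .
      obtain W where W: "open_in P W" "p \<in> W" "W \<inter> pts N \<subseteq> V"
        and ext: "\<forall>X\<in>vfields N V. \<exists>X'. extends_vfield P N W X X'"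
          "\<forall>f. smooth_fun N V f \<longrightarrow> (\<exists>f'. smooth_fun P W f' \<and> (\<forall>q\<in>W \<inter> pts N. f' q = f q))"
        by (rule field_extension[OF order_refl V p])
      obtain X' Y' Z' where e: "extends_vfield P N W X X'" "extends_vfield P N W Y Y'" "extends_vfield P N W Z Z'"
        using ext(1) X Y Z by blast
      note vf = extends_vfieldD(1)[OF e(1)] extends_vfieldD(1)[OF e(2)] extends_vfieldD(1)[OF e(3)]
      obtain f' where f': "smooth_fun P W f'" "\<And>q. q \<in> W \<inter> pts N \<Longrightarrow> f' q = f q"
        using ext(2) f by blast
      have S: "(\<lambda>p h. f p * X p h + Z p h) \<in> vfields N V"
        by (rule N.vfields_scale_add[OF V X Z f])
      have "(\<lambda>p h. f' p * X' p h + Z' p h) \<in> vfields P W"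
        by (rule P.vfields_scale_add[OF W(1) vf(1,3) f'(1)])
      moreover have "(\<lambda>h. f' q * X' q h + Z' q h) = push P q (\<lambda>h. f q * X q h + Z q h)"
        if "q \<in> W \<inter> pts N" for q
        using push_lincomb[of q "f q" "X q" 1 "Z q"] extends_vfieldD(2)[OF e(1)] extends_vfieldD(2)[OF e(3)]
          f'(2)[OF that] that by simp
      ultimately have eS: "extends_vfield P N W (\<lambda>p h. f p * X p h + Z p h) (\<lambda>p h. f' p * X' p h + Z' p h)"
        by (simp add: extends_vfield_def)
      have "push P p (?I V (\<lambda>p h. f p * X p h + Z p h) Y p) = D W (\<lambda>p h. f' p * X' p h + Z' p h) Y' p"
        by (rule ie(2)[OF V S Y W(1,3,2) pN eS e(2)])
      also have "\<dots> = (\<lambda>h. f p * D W X' Y' p h + D W Z' Y' p h)"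
        using P.affine_connectionD(2)[OF D W(1) vf f'(1)] f'(2) W(2) pN by simp
      also have "\<dots> = push P p (\<lambda>h. f p * ?I V X Y p h + 1 * ?I V Z Y p h)"
        unfolding ie(2)[OF V X Y W(1,3,2) pN e(1,2), symmetric] ie(2)[OF V Z Y W(1,3,2) pN e(3,2), symmetric]
        by (simp add: push_def fun_eq_iff)
      finally have "?I V (\<lambda>p h. f p * X p h + Z p h) Y p = (\<lambda>h. f p * ?I V X Y p h + 1 * ?I V Z Y p h)"
        by (rule push_eqD[OF _ tangent[OF V S Y p]
              N.tangent_lincomb[OF tangent[OF V X Y p] tangent[OF V Z Y p]]])
      then show ?thesis by simp
    qed (simp add: off)
  qed
  have right: "?I V X (\<lambda>p h. f p * Y p h + Z p h)
      = (\<lambda>p h. X p f * Y p h + f p * ?I V X Y p h + ?I V X Z p h)"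
    if V: "open_in N V" and X: "X \<in> vfields N V" and Y: "Y \<in> vfields N V" and Z: "Z \<in> vfields N V"
      and f: "smooth_fun N V f" for V X Y Z f
  proof
    fix p
    show "?I V X (\<lambda>p h. f p * Y p h + Z p h) p
      = (\<lambda>h. X p f * Y p h + f p * ?I V X Y p h + ?I V X Z p h)"
    proof (cases "p \<in> V")
      case p: True
      have pN: "p \<in> pts N" using N.open_in_pts[OF V p] .
      obtain W where W: "open_in P W" "p \<in> W" "W \<inter> pts N \<subseteq> V"
        and ext: "\<forall>X\<in>vfields N V. \<exists>X'. extends_vfield P N W X X'"
          "\<forall>f. smooth_fun N V f \<longrightarrow> (\<exists>f'. smooth_fun P W f' \<and> (\<forall>q\<in>W \<inter> pts N. f' q = f q))"
        by (rule field_extension[OF order_refl V p])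
      obtain X' Y' Z' where e: "extends_vfield P N W X X'" "extends_vfield P N W Y Y'" "extends_vfield P N W Z Z'"
        using ext(1) X Y Z by blast
      note vf = extends_vfieldD(1)[OF e(1)] extends_vfieldD(1)[OF e(2)] extends_vfieldD(1)[OF e(3)]
      obtain f' where f': "smooth_fun P W f'" "\<And>q. q \<in> W \<inter> pts N \<Longrightarrow> f' q = f q"
        using ext(2) f by blast
      have S: "(\<lambda>p h. f p * Y p h + Z p h) \<in> vfields N V"
        by (rule N.vfields_scale_add[OF V Y Z f])
      have "(\<lambda>p h. f' p * Y' p h + Z' p h) \<in> vfields P W"
        by (rule P.vfields_scale_add[OF W(1) vf(2,3) f'(1)])
      moreover have "(\<lambda>h. f' q * Y' q h + Z' q h) = push P q (\<lambda>h. f q * Y q h + Z q h)"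
        if "q \<in> W \<inter> pts N" for q
        using push_lincomb[of q "f q" "Y q" 1 "Z q"] extends_vfieldD(2)[OF e(2)] extends_vfieldD(2)[OF e(3)]
          f'(2)[OF that] that by simp
      ultimately have eS: "extends_vfield P N W (\<lambda>p h. f p * Y p h + Z p h) (\<lambda>p h. f' p * Y' p h + Z' p h)"
        by (simp add: extends_vfield_def)
      have Xf: "X' p f' = X p f" by (rule extension_apply[OF e(1) W(1,3) X W(2) pN f'])
      have "push P p (?I V X (\<lambda>p h. f p * Y p h + Z p h) p) = D W X' (\<lambda>p h. f' p * Y' p h + Z' p h) p"
        by (rule ie(2)[OF V X S W(1,3,2) pN e(1) eS])
      also have "\<dots> = (\<lambda>h. X p f * Y' p h + f p * D W X' Y' p h + D W X' Z' p h)"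
        using P.affine_connectionD(3)[OF D W(1) vf f'(1)] f'(2) W(2) pN Xf by simp
      also have "\<dots> = push P p (\<lambda>h. X p f * Y p h + 1 * (f p * ?I V X Y p h + 1 * ?I V X Z p h))"
        unfolding ie(2)[OF V X Y W(1,3,2) pN e(1,2), symmetric] ie(2)[OF V X Z W(1,3,2) pN e(1,3), symmetric]
          extends_vfieldD(2)[OF e(2) W(2) pN] by (simp add: push_def fun_eq_iff)
      finally have "?I V X (\<lambda>p h. f p * Y p h + Z p h) p
          = (\<lambda>h. X p f * Y p h + 1 * (f p * ?I V X Y p h + 1 * ?I V X Z p h))"
        by (rule push_eqD[OF _ tangent[OF V X S p]
              N.tangent_lincomb[OF N.vfieldsD(1)[OF Y p]
                N.tangent_lincomb[OF tangent[OF V X Y p] tangent[OF V X Z p]]]])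
      then show ?thesis by (simp add: add.assoc)
    qed (simp add: off N.vfieldsD(2)[OF X])
  qed
  have restr: "?I V1 (restrict_vfield V1 X) (restrict_vfield V1 Y) = restrict_vfield V1 (?I V X Y)"
    if V: "open_in N V" and X: "X \<in> vfields N V" and Y: "Y \<in> vfields N V"
      and V1: "open_in N V1" "V1 \<subseteq> V" for V V1 X Y
  proof
    fix p
    show "?I V1 (restrict_vfield V1 X) (restrict_vfield V1 Y) p = restrict_vfield V1 (?I V X Y) p"
    proof (cases "p \<in> V1")
      case p: True
      have pN: "p \<in> pts N" using N.open_in_pts[OF V1(1) p] .
      note r = N.vfields_restrict[OF X V1(2,1)] N.vfields_restrict[OF Y V1(2,1)]
      obtain W where W: "open_in P W" "p \<in> W" "W \<inter> pts N \<subseteq> V1"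
        and ext: "\<forall>X\<in>vfields N V. \<exists>X'. extends_vfield P N W X X'"
        by (rule field_extension[OF V1(2,1) p])
      have WV: "W \<inter> pts N \<subseteq> V" using W(3) V1(2) by blast
      obtain X' Y' where e: "extends_vfield P N W X X'" "extends_vfield P N W Y Y'"
        using ext X Y by blast
      then have e2: "extends_vfield P N W (restrict_vfield V1 X) X'" "extends_vfield P N W (restrict_vfield V1 Y) Y'"
        using W(3) by (auto simp: extends_vfield_def restrict_vfield_def subset_iff)
      have "push P p (?I V1 (restrict_vfield V1 X) (restrict_vfield V1 Y) p) = push P p (?I V X Y p)"
        using ie(2)[OF V1(1) r W(1,3,2) pN e2] ie(2)[OF V X Y W(1) WV W(2) pN e] by simp
      then show ?thesis
        using push_eqD tangent[OF V1(1) r p] tangent[OF V X Y] p V1(2)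
        by (auto simp: restrict_vfield_def)
    qed (simp add: off restrict_vfield_def)
  qed
  show ?thesis
    unfolding affine_connection_def
    by (intro allI ballI impI conjI) (simp_all add: closed left right restr)
qed

section \<open>Induced metric, duality, torsion and the Levi-Civita property\<close>

lemma induced_metric_smooth:
  assumes g: "riemannian_metric P g" and V: "open_in N V" and X: "X \<in> vfields N V" and Y: "Y \<in> vfields N V"
  shows "smooth_fun N V (\<lambda>p. induced_metric P g p (X p) (Y p))"
proof (rule N.smooth_fun_local)
  fix p assume p: "p \<in> V"
  obtain W where W: "open_in P W" "p \<in> W" "W \<inter> pts N \<subseteq> V"
    and ext: "\<forall>X\<in>vfields N V. \<exists>X'. extends_vfield P N W X X'"
    by (rule field_extension[OF order_refl V p])
  obtain X' Y' where e: "extends_vfield P N W X X'" "extends_vfield P N W Y Y'"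
    using ext X Y by blast
  have "smooth_fun P W (\<lambda>q. g q (X' q) (Y' q))"
    using g W(1) extends_vfieldD(1)[OF e(1)] extends_vfieldD(1)[OF e(2)] unfolding riemannian_metric_def by blast
  then have "smooth_fun N (W \<inter> pts N) (\<lambda>q. g q (X' q) (Y' q))" by (rule restrict_smooth_fun[OF W(1)])
  then have "smooth_fun N (W \<inter> pts N) (\<lambda>q. induced_metric P g q (X q) (Y q))"
    using N.smooth_fun_cong[OF open_restrict[OF W(1)], of "\<lambda>q. g q (X' q) (Y' q)"
        "\<lambda>q. induced_metric P g q (X q) (Y q)"] extends_vfieldD(2)[OF e(1)] extends_vfieldD(2)[OF e(2)]
    by (simp add: induced_metric_def)
  then show "\<exists>W'. open_in N W' \<and> p \<in> W' \<and> smooth_fun N W' (\<lambda>p. induced_metric P g p (X p) (Y p))"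
    using open_restrict[OF W(1)] W(2) N.open_in_pts[OF V p] by blast
qed

text \<open>Definiteness survives because injectivity of \<open>push\<close> keeps nonzero vectors
  nonzero.\<close>

lemma riemannian_induced_metric:
  assumes g: "riemannian_metric P g"
  shows "riemannian_metric N (induced_metric P g)"
proof -
  have sym: "g p u v = g p v u"
    and lin: "w \<in> tangent_space P p \<Longrightarrow> g p (\<lambda>f. a * u f + v f) w = a * g p u w + g p v w"
    and pos: "u \<noteq> (\<lambda>_. 0) \<Longrightarrow> g p u u > 0"
    if "p \<in> pts P" "u \<in> tangent_space P p" "v \<in> tangent_space P p" for p u v w a
    using g that unfolding riemannian_metric_def by blast+
  have zero: "push P p (\<lambda>_. 0) = (\<lambda>_. 0)" for p by (simp add: push_def fun_eq_iff)
  have "push P p u \<noteq> (\<lambda>_. 0)" if "u \<in> tangent_space N p" "u \<noteq> (\<lambda>_. 0)" for p u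
  proof
    assume "push P p u = (\<lambda>_. 0)"
    then have "push P p u = push P p (\<lambda>_. 0)" by (simp add: zero)
    then show False
      using push_eqD that N.tangent_zero[OF N.tangent_in_pts[OF that(1)]] by blast
  qed
  moreover have "push P p (\<lambda>f. a * u f + v f) = (\<lambda>f. a * push P p u f + push P p v f)" for p a u v
    using push_lincomb[of p a u 1 v] by simp
  ultimately show ?thesis
    unfolding riemannian_metric_def
    using induced_metric_smooth[OF g]
    by (auto simp: induced_metric_def push_tangent sym[OF pts_sub] lin[OF pts_sub] intro!: pos[OF pts_sub push_tangent push_tangent])
qed

text \<open>Two connections are allowed so that one computation yields duality and, for
  \<open>D' = D\<close>, metric compatibility.\<close>

lemma metric_compatible_induced:
  assumes g: "riemannian_metric P g"
    and D: "affine_connection P D" "autoparallel P N D" and D': "affine_connection P D'" "autoparallel P N D'"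
    and dual: "\<forall>W. open_in P W \<longrightarrow>
      (\<forall>X\<in>vfields P W. \<forall>Y\<in>vfields P W. \<forall>Z\<in>vfields P W. \<forall>p\<in>W.
        X p (\<lambda>q. g q (Y q) (Z q)) = g p (D W X Y p) (Z p) + g p (Y p) (D' W X Z p))"
  shows "\<forall>V. open_in N V \<longrightarrow>
      (\<forall>X\<in>vfields N V. \<forall>Y\<in>vfields N V. \<forall>Z\<in>vfields N V. \<forall>p\<in>V.
        X p (\<lambda>q. induced_metric P g q (Y q) (Z q))
        = induced_metric P g p (induced_connection P N D V X Y p) (Z p)
          + induced_metric P g p (Y p) (induced_connection P N D' V X Z p))"
proof (intro allI impI ballI)
  fix V X Y Z p
  assume V: "open_in N V" and X: "X \<in> vfields N V" and Y: "Y \<in> vfields N V" and Z: "Z \<in> vfields N V"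
    and p: "p \<in> V"
  have pN: "p \<in> pts N" using N.open_in_pts[OF V p] .
  obtain W where W: "open_in P W" "p \<in> W" "W \<inter> pts N \<subseteq> V"
    and ext: "\<forall>X\<in>vfields N V. \<exists>X'. extends_vfield P N W X X'"
    by (rule field_extension[OF order_refl V p])
  obtain X' Y' Z' where e: "extends_vfield P N W X X'" "extends_vfield P N W Y Y'" "extends_vfield P N W Z Z'"
    using ext X Y Z by blast
  note vf = extends_vfieldD(1)[OF e(1)] extends_vfieldD(1)[OF e(2)] extends_vfieldD(1)[OF e(3)]
  have "smooth_fun P W (\<lambda>q. g q (Y' q) (Z' q))"
    using g W(1) vf unfolding riemannian_metric_def by blast
  then have "X' p (\<lambda>q. g q (Y' q) (Z' q)) = X p (\<lambda>q. induced_metric P g q (Y q) (Z q))"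
    by (rule extension_apply[OF e(1) W(1,3) X W(2) pN])
      (use extends_vfieldD(2)[OF e(2)] extends_vfieldD(2)[OF e(3)] in \<open>simp add: induced_metric_def\<close>)
  moreover have "X' p (\<lambda>q. g q (Y' q) (Z' q)) = g p (D W X' Y' p) (Z' p) + g p (Y' p) (D' W X' Z' p)"
    using dual W(1,2) vf by blast
  ultimately show "X p (\<lambda>q. induced_metric P g q (Y q) (Z q))
      = induced_metric P g p (induced_connection P N D V X Y p) (Z p)
        + induced_metric P g p (Y p) (induced_connection P N D' V X Z p)"
    by (simp add: induced_metric_def induced_connection_extension(2)[OF D V X Y W(1,3,2) pN e(1,2)]
        induced_connection_extension(2)[OF D' V X Z W(1,3,2) pN e(1,3)]
        extends_vfieldD(2)[OF e(2) W(2) pN] extends_vfieldD(2)[OF e(3) W(2) pN])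
qed

lemma dual_induced_connections:
  assumes "riemannian_metric P g" "dual_connections P g D D'" "autoparallel P N D" "autoparallel P N D'"
  shows "dual_connections N (induced_metric P g) (induced_connection P N D) (induced_connection P N D')"
proof -
  note d = assms(2)[unfolded dual_connections_def]
  show ?thesis
    unfolding dual_connections_def
    by (intro conjI affine_induced_connection metric_compatible_induced[OF assms(1)] assms(3,4)
        d[THEN conjunct1] d[THEN conjunct2, THEN conjunct1] d[THEN conjunct2, THEN conjunct2])
qed

text \<open>Iterated derivatives along \<open>N\<close> of an extended function depend only on
  values along \<open>N\<close>, so the bracket of extensions acts there as the bracket of the
  fields.\<close>

lemma torsion_free_induced:
  assumes D: "affine_connection P D" "autoparallel P N D" and tf: "torsion_free P D"
  shows "torsion_free N (induced_connection P N D)"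
proof -
  let ?I = "induced_connection P N D"
  have "?I V X Y p h - ?I V Y X p h = lie_bracket N X Y p h"
    if V: "open_in N V" and X: "X \<in> vfields N V" and Y: "Y \<in> vfields N V" for V X Y p h
  proof (cases "p \<in> V \<and> smooth_near N p h")
    \<comment> \<open>Off \<open>V\<close>, or on functions that are not smooth near
      \<open>p\<close>, all terms are 0 by the conventions on fields and vectors.\<close>
    case False
    have vf: "?I V X Y \<in> vfields N V" "?I V Y X \<in> vfields N V"
      using N.affine_connectionD(1)[OF affine_induced_connection[OF D] V] X Y by blast+
    show ?thesis
    proof (cases "p \<in> V")
      case True
      then have "\<not> smooth_near N p h" using False by blast
      then show ?thesis
        using N.tangent_not_near[OF N.vfieldsD(1)[OF vf(1) True]]
          N.tangent_not_near[OF N.vfieldsD(1)[OF vf(2) True]]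
        by (simp add: lie_bracket_def)
    next
      case False
      then show ?thesis
        using N.vfieldsD(2)[OF vf(1) False] N.vfieldsD(2)[OF vf(2) False]
          N.vfieldsD(2)[OF X False] N.vfieldsD(2)[OF Y False] by (simp add: lie_bracket_def)
    qed
  next
    case True
    then obtain V0 where V0: "open_in N V0" "p \<in> V0" "smooth_fun N V0 h" by (auto simp: smooth_near_def)
    define V1 where "V1 = V0 \<inter> V"
    have V1: "open_in N V1" "V1 \<subseteq> V" "p \<in> V1" "smooth_fun N V1 h"
      using V0 V True N.smooth_fun_subset[OF V0(3)] by (auto simp: V1_def)
    have pN: "p \<in> pts N" using N.open_in_pts[OF V1(1,3)] .
    obtain W where W: "open_in P W" "p \<in> W" "W \<inter> pts N \<subseteq> V1"
      and ext: "\<forall>X\<in>vfields N V. \<exists>X'. extends_vfield P N W X X'"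
        "\<forall>f. smooth_fun N V1 f \<longrightarrow> (\<exists>f'. smooth_fun P W f' \<and> (\<forall>q\<in>W \<inter> pts N. f' q = f q))"
      by (rule field_extension[OF V1(2,1,3)])
    have WV: "W \<inter> pts N \<subseteq> V" using W(3) V1(2) by blast
    obtain X' Y' where e: "extends_vfield P N W X X'" "extends_vfield P N W Y Y'"
      using ext(1) X Y by blast
    note vf = extends_vfieldD(1)[OF e(1)] extends_vfieldD(1)[OF e(2)]
    obtain h' where h': "smooth_fun P W h'" "\<And>q. q \<in> W \<inter> pts N \<Longrightarrow> h' q = h q"
      using ext(2) V1(4) by blast
    have near: "smooth_near P p h'" using P.smooth_nearI[OF W(1,2) h'(1)] .
    have I: "?I V A B p h = D W A' B' p h'"
      if A: "A \<in> vfields N V" "B \<in> vfields N V" "extends_vfield P N W A A'" "extends_vfield P N W B B'" for A B A' B'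
    proof -
      note i = induced_connection_extension[OF D V A(1,2) W(1) WV W(2) pN A(3,4)]
      have "?I V A B p h = ?I V A B p h'"
        by (rule N.tangent_cong[OF i(1) open_restrict[OF W(1)]]) (use W(2) pN h'(2) in auto)
      then show ?thesis using i(2) push_apply[OF near] by metis
    qed
    have br: "A' p (\<lambda>q. B' q h') = A p (\<lambda>q. B q h)"
      if A: "A \<in> vfields N V" "B \<in> vfields N V" "extends_vfield P N W A A'" "extends_vfield P N W B B'" for A B A' B'
    proof (rule extension_apply[OF A(3) W(1) WV A(1) W(2) pN])
      show "smooth_fun P W (\<lambda>q. B' q h')"
        by (rule P.vfieldsD(3)[OF extends_vfieldD(1)[OF A(4)] W(1) order_refl h'(1)])
      show "B' q h' = B q h" if "q \<in> W \<inter> pts N" for q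
        using extension_apply[OF A(4) W(1) WV A(2) _ _ h'] that by blast
    qed
    have "D W X' Y' p h' - D W Y' X' p h' = lie_bracket P X' Y' p h'"
      using tf W(1) vf unfolding torsion_free_def by (metis (no_types, lifting))
    then show ?thesis
      using I[OF X Y e] I[OF Y X e(2,1)] br[OF X Y e] br[OF Y X e(2,1)] near True
      by (simp add: lie_bracket_def)
  qed
  then show ?thesis unfolding torsion_free_def by (intro allI impI ballI ext) simp
qed

lemma levi_civita_induced:
  assumes "riemannian_metric P g" "levi_civita P g D" "autoparallel P N D"
  shows "levi_civita N (induced_metric P g) (induced_connection P N D)"
proof -
  note d = assms(2)[unfolded levi_civita_def]
  show ?thesis
    unfolding levi_civita_def
    by (intro conjI affine_induced_connection torsion_free_induced metric_compatible_induced[OF assms(1)]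
        assms(3) d[THEN conjunct1] d[THEN conjunct2, THEN conjunct1] d[THEN conjunct2, THEN conjunct2])
qed

lemma autoparallel_dual:
  assumes "riemannian_metric P g" "dual_connections P g D D'" "torsion_free P D" "torsion_free P D'"
    and "levi_civita P g Dg" "autoparallel P N D" "autoparallel P N Dg"
  shows "autoparallel P N D'"
  unfolding autoparallel_def tangent_to_def
proof (intro allI impI ballI)
  fix W X Y p
  assume W: "open_in P W" and X: "X \<in> vfields P W" and Y: "Y \<in> vfields P W"
    and t: "(\<forall>p\<in>W \<inter> pts N. X p \<in> push P p ` tangent_space N p) \<and> (\<forall>p\<in>W \<inter> pts N. Y p \<in> push P p ` tangent_space N p)"
    and p: "p \<in> W \<inter> pts N"
  have "D0 W X Y p \<in> push P p ` tangent_space N p" if "autoparallel P N D0" for D0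
    using that W X Y t p unfolding autoparallel_def tangent_to_def by blast
  then obtain u v where u: "u \<in> tangent_space N p" "D W X Y p = push P p u"
    and v: "v \<in> tangent_space N p" "Dg W X Y p = push P p v"
    using assms(6,7) by blast
  have "D' W X Y p = (\<lambda>h. 2 * push P p v h + (-1) * push P p u h)"
    using P.dual_connection_eq[OF assms(1-5) W X Y] u v by simp
  also have "\<dots> = push P p (\<lambda>h. 2 * v h + (-1) * u h)" by (rule push_lincomb[symmetric])
  finally show "D' W X Y p \<in> push P p ` tangent_space N p"
    using N.tangent_lincomb[OF v(1) u(1), of 2 "-1"] by blast
qed

end

section \<open>Open submanifolds\<close>

context smooth_mfd
begin

lemma pts_open_submanifold: "pts (open_submanifold M U) = U"
  by (simp add: open_submanifold_def)

lemma charts_open_submanifold: "charts (open_submanifold M U) = (\<lambda>c. (fst c \<inter> U, snd c)) ` charts M"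
  by (simp add: open_submanifold_def split_beta)

lemma open_in_open_submanifold:
  assumes "open_in M U"
  shows "open_in (open_submanifold M U) W \<longleftrightarrow> open_in M W \<and> W \<subseteq> U"
  unfolding pts_open_submanifold
proof
  assume h: "openin (top_of_set U) W"
  show "open_in M W \<and> W \<subseteq> U" using openin_trans[OF h assms] openin_imp_subset[OF h] by simp
next
  assume h: "open_in M W \<and> W \<subseteq> U"
  show "openin (top_of_set U) W"
    by (rule openin_subset_trans[OF conjunct1[OF h] conjunct2[OF h] openin_imp_subset[OF assms]])
qed

text \<open>\<open>inv_into\<close> depends on the domain: shrinking it changes the inverse as a
  function, but not on the image of the smaller domain.\<close>

lemma chart_inv_restrict:
  assumes "adm c" "x \<in> snd c ` (fst c \<inter> U)"
  shows "inv_into (fst c \<inter> U) (snd c) x = chart_inv c x"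
proof -
  obtain p where p: "p \<in> fst c \<inter> U" "x = snd c p" using assms(2) by blast
  have "inj_on (snd c) (fst c \<inter> U)" using admissible_chartD(3)[OF assms(1)] inj_on_subset by blast
  then show ?thesis using p inv_into_f_f admissible_chartD(7)[OF assms(1)] by force
qed

lemma chart_smooth_restrict:
  assumes "adm c" "open_in M U" "open_in M W"
  shows "chart_smooth (fst c \<inter> U, snd c) W F \<longleftrightarrow> chart_smooth c (W \<inter> U) F"
proof -
  have o: "open (snd c ` (fst c \<inter> (W \<inter> U)))" using chart_image_open[OF assms(1)] assms(2,3) by blast
  have "smooth_on (snd c ` (fst c \<inter> (W \<inter> U))) (\<lambda>x. F (inv_into (fst c \<inter> U) (snd c) x))
      \<longleftrightarrow> smooth_on (snd c ` (fst c \<inter> (W \<inter> U))) (\<lambda>x. F (chart_inv c x))"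
    by (rule smooth_on_cong[OF o], subst chart_inv_restrict[OF assms(1)]) auto
  then show ?thesis unfolding chart_smooth_def by (simp add: Int_ac)
qed

lemma admissible_restrict:
  assumes "adm c" "open_in M U"
  shows "admissible_chart (open_submanifold M U) (fst c \<inter> U, snd c)"
proof -
  let ?c = "(fst c \<inter> U, snd c)"
  have o: "open_in M (fst c \<inter> U)" using assms admissible_chartD(1) by blast
  have inv: "chart_inv ?c (snd c p) = p" if "p \<in> fst c \<inter> U" for p
    using chart_inv_restrict[OF assms(1), of "snd c p" U] admissible_chartD(7)[OF assms(1)] that by auto
  have "continuous_on (snd c ` (fst c \<inter> U)) (chart_inv c)"
    using admissible_chartD(5)[OF assms(1)] by (rule continuous_on_subset) blast
  then have "continuous_on (snd c ` (fst c \<inter> U)) (chart_inv ?c)"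
    by (rule continuous_on_eq) (use chart_inv_restrict[OF assms(1)] in auto)
  moreover have "continuous_on (fst c \<inter> U) (snd c)"
    using admissible_chartD(4)[OF assms(1)] by (rule continuous_on_subset) blast
  ultimately have "homeomorphism (fst ?c) (snd ?c ` fst ?c) (snd ?c) (chart_inv ?c)"
    using inv by (auto simp: homeomorphism_def image_iff)
  moreover have "transition_smooth ?c c' \<and> transition_smooth c' ?c"
    if c': "c' \<in> charts (open_submanifold M U)" for c'
  proof -
    obtain c0 where c0: "c0 \<in> charts M" "c' = (fst c0 \<inter> U, snd c0)"
      using c' by (auto simp: charts_open_submanifold)
    have a: "adm c0" using charts_adm[OF c0(1)] .
    have o0: "open_in M (fst c0 \<inter> U)" using a assms admissible_chartD(1) by blast
    have "chart_smooth c (fst c0 \<inter> U \<inter> U) (snd c0)"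
      by (rule chart_smooth_subset[OF chart_transition[OF assms(1) a]]) blast
    moreover have "chart_smooth c0 (fst c \<inter> U \<inter> U) (snd c)"
      by (rule chart_smooth_subset[OF chart_transition[OF a assms(1)]]) blast
    ultimately show ?thesis
      by (simp add: transition_smooth_iff c0(2) chart_smooth_restrict[OF assms o0]
          chart_smooth_restrict[OF a assms(2) o])
  qed
  ultimately show ?thesis
    using chart_image_open[OF assms] o assms(2)
    by (auto simp: admissible_chart_def open_in_open_submanifold)
qed

lemma smooth_open_submanifold:
  assumes "open_in M U"
  shows "smooth_manifold (open_submanifold M U)"
proof -
  have "(\<Union>c\<in>charts M. fst c) = pts M" using smooth by (simp add: smooth_manifold_def)
  then have "(\<Union>c\<in>charts (open_submanifold M U). fst c) = U"
    using openin_imp_subset[OF assms] by (auto simp: charts_open_submanifold)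
  then show ?thesis
    using admissible_restrict[OF charts_adm assms]
    by (auto simp: smooth_manifold_def charts_open_submanifold pts_open_submanifold)
qed

lemma smooth_near_open_submanifold:
  assumes "open_in M U" "p \<in> U"
  shows "smooth_near (open_submanifold M U) p f \<longleftrightarrow> smooth_near M p f"
proof -
  have eq: "smooth_fun (open_submanifold M U) W f \<longleftrightarrow> smooth_fun M W f" if "open_in M W" "W \<subseteq> U" for W
  proof -
    have "chart_smooth (fst c \<inter> U, snd c) W f \<longleftrightarrow> chart_smooth c W f" if "c \<in> charts M" for c
      using chart_smooth_restrict[OF charts_adm[OF that] assms(1) \<open>open_in M W\<close>] \<open>W \<subseteq> U\<close>
      by (simp add: Int_absorb2)
    then show ?thesis by (simp add: smooth_fun_def' charts_open_submanifold)
  qed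
  show ?thesis
  proof
    assume "smooth_near (open_submanifold M U) p f"
    then show "smooth_near M p f"
      using eq unfolding smooth_near_def open_in_open_submanifold[OF assms(1)] by blast
  next
    assume "smooth_near M p f"
    then obtain W where W: "open_in M W" "p \<in> W" "smooth_fun M W f" by (auto simp: smooth_near_def)
    then have "open_in M (W \<inter> U)" "smooth_fun M (W \<inter> U) f"
      using assms smooth_fun_subset[OF W(3)] by auto
    then show "smooth_near (open_submanifold M U) p f"
      using eq[of "W \<inter> U"] W(2) assms unfolding smooth_near_def open_in_open_submanifold[OF assms(1)] by blast
  qed
qed

lemma coord_vec_open_submanifold:
  assumes "adm c" "open_in M U" "p \<in> U"
  shows "coord_vec (open_submanifold M U) (fst c \<inter> U, snd c) u p = coord_vec M c u p"
proof
  fix f :: "'a \<Rightarrow> real"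
  have "frechet_derivative (\<lambda>x. f (inv_into (fst c \<inter> U) (snd c) x)) (at (snd c p))
      = frechet_derivative (\<lambda>x. f (chart_inv c x)) (at (snd c p))" if "p \<in> fst c"
    by (rule frechet_derivative_cong_open[OF chart_image_open[OF assms(1,2)]])
      (use assms that chart_inv_restrict[OF assms(1)] in auto)
  then show "coord_vec (open_submanifold M U) (fst c \<inter> U, snd c) u p f = coord_vec M c u p f"
    using smooth_near_open_submanifold[OF assms(2,3)] assms(3) by (simp add: coord_vec_apply)
qed

text \<open>Smoothness near a point is local, so the cut-offs agree and the tangent vectors of
  \<open>U\<close> are literally those of the larger manifold.\<close>

lemma tangent_space_open_submanifold:
  assumes "open_in M U" "p \<in> U"
  shows "tangent_space (open_submanifold M U) p = tangent_space M p"
proof -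
  have "p \<in> pts M" using open_in_pts assms by blast
  then obtain c where c: "c \<in> charts M" "adm c" "p \<in> fst c" using obtain_chart by metis
  interpret S: smooth_mfd "open_submanifold M U"
    using smooth_open_submanifold[OF assms(1)] by unfold_locales
  show ?thesis
    using S.tangent_space_eq[OF admissible_restrict[OF c(2) assms(1)], of p] tangent_space_eq[OF c(2,3)]
      coord_vec_open_submanifold[OF c(2) assms] c(3) assms(2) by simp
qed

end

lemma (in submfd) submfd_open_submanifold:
  assumes "open_in N U"
  shows "submfd P (open_submanifold N U)"
proof -
  have "transition_smooth (fst c \<inter> U, snd c) c'" if "c \<in> charts N" "c' \<in> charts P" for c c'
  proof -
    have o: "open_in N (fst c' \<inter> pts N)"
      using open_restrict[OF admissible_chartD(1)[OF P.charts_adm[OF that(2)]]] .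
    have "chart_smooth c (fst c' \<inter> pts N \<inter> U) (snd c')"
      by (rule chart_smooth_subset[OF inclusion_smooth[OF that]]) blast
    then have "chart_smooth (fst c \<inter> U, snd c) (fst c' \<inter> pts N) (snd c')"
      using N.chart_smooth_restrict[OF N.charts_adm[OF that(1)] assms o] by blast
    moreover have "fst c \<inter> U \<inter> (fst c' \<inter> pts N) = fst c \<inter> U \<inter> fst c'"
      using openin_imp_subset[OF assms] by blast
    ultimately show ?thesis by (simp add: transition_smooth_iff chart_smooth_def)
  qed
  moreover have "inj_on (push P p) (tangent_space (open_submanifold N U) p)" if "p \<in> U" for p
    using push_inj N.open_in_pts[OF assms that] N.tangent_space_open_submanifold[OF assms that] by simp
  ultimately have "embedded_submanifold P (open_submanifold N U)"
    unfolding embedded_submanifold_def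
    using N.smooth_open_submanifold[OF assms] pts_sub N.open_in_pts[OF assms]
    by (auto simp: N.pts_open_submanifold N.charts_open_submanifold)
  then show ?thesis
    using N.smooth_open_submanifold[OF assms] P.smooth
    by (simp add: submfd_def submfd_axioms_def smooth_mfd_def)
qed

text \<open>Fields tangent to \<open>N\<close> along \<open>U\<close> may fail to be so along the
  rest of \<open>N\<close>. Restricting them to an ambient open set that meets \<open>N\<close>
  inside \<open>U\<close> only removes the rest, and locality of \<open>D\<close> allows it.\<close>

lemma (in submfd) autoparallel_open_submanifold:
  assumes D: "affine_connection P D" and ap: "autoparallel P N D" and U: "open_in N U"
  shows "autoparallel P (open_submanifold N U) D"
  unfolding autoparallel_def tangent_to_def N.pts_open_submanifold
proof (intro allI impI ballI)
  fix W X Y p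
  assume W: "open_in P W" and X: "X \<in> vfields P W" and Y: "Y \<in> vfields P W"
    and t: "(\<forall>p\<in>W \<inter> U. X p \<in> push P p ` tangent_space (open_submanifold N U) p) \<and>
      (\<forall>p\<in>W \<inter> U. Y p \<in> push P p ` tangent_space (open_submanifold N U) p)"
    and p: "p \<in> W \<inter> U"
  obtain Q where Q: "open_in P Q" "Q \<inter> pts N = U" using open_extend[OF U] .
  define V where "V = W \<inter> Q"
  have V: "open_in P V" "V \<subseteq> W" "V \<inter> pts N = W \<inter> U" "p \<in> V"
    using W Q p by (auto simp: V_def)
  note r = P.vfields_restrict[OF X V(2,1)] P.vfields_restrict[OF Y V(2,1)]
  have "tangent_to P N V (restrict_vfield V X)" "tangent_to P N V (restrict_vfield V Y)"
    using t V N.tangent_space_open_submanifold[OF U]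
    by (auto simp: tangent_to_def restrict_vfield_def)
  then have "tangent_to P N V (D V (restrict_vfield V X) (restrict_vfield V Y))"
    using ap V(1) r unfolding autoparallel_def by blast
  then have "D V (restrict_vfield V X) (restrict_vfield V Y) p \<in> push P p ` tangent_space N p"
    using p V(3) unfolding tangent_to_def by blast
  then show "D W X Y p \<in> push P p ` tangent_space (open_submanifold N U) p"
    using P.connection_restrict_at[OF D W X Y V(1,2,4)] N.tangent_space_open_submanifold[OF U] p by simp
qed


section \<open>Geodesics\<close>

text \<open>Chain rule for the geodesic equation. It serves a change of chart within
  \<open>N\<close> as well as the inclusion into \<open>P\<close>: \<open>G\<close> stands for the
  Christoffel quadratic form in the target chart, and the last assumption is its transformation
  law.\<close>

lemma geodesic_transfer:
  fixes N :: "('a::{t2_space, second_countable_topology}, real) manifold"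
    and c :: "('a, 'e::euclidean_space) chart"
  assumes N: "smooth_mfd N" and E: "affine_connection N E" and geo: "geodesic N E \<gamma>"
    and o: "open_in N (fst c \<inter> pts N)"
    and sm: "\<And>k. k \<in> charts N \<Longrightarrow> chart_smooth k (fst c \<inter> pts N) (snd c)"
    and G: "\<And>k q a. k \<in> charts N \<Longrightarrow> q \<in> fst k \<Longrightarrow> q \<in> fst c \<Longrightarrow>
      components c (E (fst k) (coord_vec N k a) (coord_vec N k a) q)
      = (\<Sum>b\<in>Basis. coord_vec N k a q (\<lambda>q'. components c (coord_vec N k a q') \<bullet> b) *\<^sub>R b)
        + G q (components c (coord_vec N k a q))"
  shows "\<exists>c'. \<forall>t\<in>{0..1}. \<gamma> t \<in> fst c \<longrightarrow>
      ((snd c \<circ> \<gamma>) has_vector_derivative c' t) (at t within {0..1}) \<and>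
      (c' has_vector_derivative - G (\<gamma> t) (c' t)) (at t within {0..1})"
proof (intro exI ballI impI)
  interpret N: smooth_mfd N by (rule N)
  \<comment> \<open>One velocity function is demanded for the whole time interval, while the chart
    \<open>k\<close> used for its computation changes with the time; the vector derivative does not
    refer to \<open>k\<close>.\<close>
  define c' where "c' t = vector_derivative (snd c \<circ> \<gamma>) (at t within {0..1})" for t
  fix t0 :: real assume t0: "t0 \<in> {0..1}" "\<gamma> t0 \<in> fst c"
  have \<gamma>: "continuous_on {0..1} \<gamma>" "\<gamma> t0 \<in> pts N"
    using geo t0(1) by (auto simp: geodesic_def)
  obtain k where k: "k \<in> charts N" "N.adm k" "\<gamma> t0 \<in> fst k" using N.obtain_chart[OF \<gamma>(2)] by metis
  note inv = admissible_chartD(7)[OF k(2)]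
  have "\<exists>u'. \<forall>t\<in>{0..1}. \<gamma> t \<in> fst k \<longrightarrow>
      ((snd k \<circ> \<gamma>) has_vector_derivative u' t) (at t within {0..1}) \<and>
      (u' has_vector_derivative
        - components k (E (fst k) (coord_vec N k (u' t)) (coord_vec N k (u' t)) (\<gamma> t))) (at t within {0..1})"
    using geo k(1) unfolding geodesic_def by (cases k) fastforce
  then obtain u' where u': "\<And>t. t \<in> {0..1} \<Longrightarrow> \<gamma> t \<in> fst k \<Longrightarrow>
      ((snd k \<circ> \<gamma>) has_vector_derivative u' t) (at t within {0..1})"
    and u'': "\<And>t. t \<in> {0..1} \<Longrightarrow> \<gamma> t \<in> fst k \<Longrightarrow> (u' has_vector_derivative
        - components k (E (fst k) (coord_vec N k (u' t)) (coord_vec N k (u' t)) (\<gamma> t))) (at t within {0..1})"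
    by blast
  define V where "V = fst k \<inter> (fst c \<inter> pts N)"
  have V: "open_in N V" "V \<subseteq> fst k" "\<gamma> t0 \<in> V"
    using o admissible_chartD(1)[OF k(2)] k(3) t0(2) \<gamma>(2) by (auto simp: V_def)
  define S where "S = snd k ` V"
  have S_eq: "S = snd k ` (fst k \<inter> V)" using V(2) by (auto simp: S_def)
  have S: "open S" unfolding S_eq using chart_image_open[OF k(2) V(1)] .
  define F where "F x = snd c (chart_inv k x)" for x
  define F1 where "F1 x = frechet_derivative F (at x) 1" for x
  define F2 where "F2 x = frechet_derivative F1 (at x) 1" for x
  have Fs: "smooth_on S F"
    using chart_smooth_subset[OF sm[OF k(1)], of V] V_def
    unfolding F_def S_eq chart_smooth_def by blast
  then have F1s: "smooth_on S F1" unfolding F1_def by (rule smooth_on_frechet_derivative)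
  have F1: "(F has_vector_derivative F1 x) (at x)" if "x \<in> S" for x
    unfolding F1_def by (rule smooth_on_has_vector_derivative[OF Fs that])
  have F2: "(F1 has_vector_derivative F2 x) (at x)" if "x \<in> S" for x
    unfolding F2_def by (rule smooth_on_has_vector_derivative[OF F1s that])
  have "openin (top_of_set {0..1}) ({0..1} \<inter> \<gamma> -` V)"
  proof (rule continuous_openin_preimage[OF \<gamma>(1) _ V(1)])
    show "\<gamma> \<in> {0..1} \<rightarrow> pts N" using geo by (auto simp: geodesic_def)
  qed
  then obtain e where e: "e > 0" "\<And>t. t \<in> {0..1} \<Longrightarrow> dist t t0 < e \<Longrightarrow> \<gamma> t \<in> V"
    using t0(1) V(3) unfolding openin_euclidean_subtopology_iff by (metis IntE IntI vimageE vimageI)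
  have open_nbhd: "\<exists>e>0. \<forall>s\<in>{0..1}. dist s t < e \<longrightarrow> \<gamma> s \<in> V" if "dist t t0 < e" for t
  proof (intro exI conjI ballI impI)
    show "e - dist t t0 > 0" using that by simp
    show "\<gamma> s \<in> V" if "s \<in> {0..1}" "dist s t < e - dist t t0" for s
      using e(2)[OF that(1)] that(2) dist_triangle[of s t0 t] by simp
  qed
  have d1: "((snd c \<circ> \<gamma>) has_vector_derivative u' t *\<^sub>R F1 (snd k (\<gamma> t))) (at t within {0..1})"
    and c'_eq: "c' t = u' t *\<^sub>R F1 (snd k (\<gamma> t))"
    if t: "t \<in> {0..1}" "dist t t0 < e" for t
  proof -
    have tV: "\<gamma> t \<in> V" using e(2) t by blast
    then have S_t: "snd k (\<gamma> t) \<in> S" by (simp add: S_def)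
    have "(F has_vector_derivative F1 ((snd k \<circ> \<gamma>) t)) (at ((snd k \<circ> \<gamma>) t) within (snd k \<circ> \<gamma>) ` {0..1})"
      unfolding comp_def by (rule has_vector_derivative_at_within[OF F1[OF S_t]])
    with u'[OF t(1)] tV V(2) have "(F \<circ> (snd k \<circ> \<gamma>) has_vector_derivative u' t *\<^sub>R F1 ((snd k \<circ> \<gamma>) t)) (at t within {0..1})"
      by (intro vector_diff_chain_within) auto
    moreover obtain e' where e': "e' > 0" "\<And>s. s \<in> {0..1} \<Longrightarrow> dist s t < e' \<Longrightarrow> \<gamma> s \<in> V"
      using open_nbhd[OF t(2)] by blast
    moreover have "(F \<circ> (snd k \<circ> \<gamma>)) s = (snd c \<circ> \<gamma>) s" if "s \<in> {0..1}" "dist s t < e'" for s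
      using e'(2)[OF that] V(2) inv by (auto simp: F_def)
    ultimately show d: "((snd c \<circ> \<gamma>) has_vector_derivative u' t *\<^sub>R F1 (snd k (\<gamma> t))) (at t within {0..1})"
      using has_vector_derivative_transform_within[of "F \<circ> (snd k \<circ> \<gamma>)" _ t "{0..1}" e' "snd c \<circ> \<gamma>"] t(1)
      by auto
    show "c' t = u' t *\<^sub>R F1 (snd k (\<gamma> t))"
      unfolding c'_def using vector_derivative_within_closed_interval[OF _ t(1) d] by simp
  qed
  let ?a = "u' t0" and ?q = "\<gamma> t0" and ?x = "snd k (\<gamma> t0)"
  let ?X = "coord_vec N k ?a"
  let ?E = "E (fst k) ?X ?X ?q"
  have xS: "?x \<in> S" using V(3) by (simp add: S_def)
  have snd_inv: "snd k (chart_inv k x) = x" if "x \<in> S" for x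
    using that inv V(2) by (auto simp: S_def subset_iff)
  have near: "smooth_near N q (\<lambda>q. snd c q \<bullet> b)" if "q \<in> V" for q b
  proof (rule N.smooth_nearI[OF V(1) that N.smooth_fun_of_chart_smooth[OF k(2) V(1,2)]])
    show "chart_smooth k V (\<lambda>q. snd c q \<bullet> b)"
      using smooth_on_inner[OF S Fs smooth_on_const[OF S]] by (simp add: chart_smooth_def S_eq F_def)
  qed
  have comp: "components c (coord_vec N k s q) = s *\<^sub>R F1 (snd k q)" if q: "q \<in> V" for q s
  proof -
    have "coord_vec N k s q (\<lambda>q. snd c q \<bullet> b) = (s *\<^sub>R F1 (snd k q)) \<bullet> b" for b
    proof (rule N.coord_vecI[OF k(2) _ near[OF q]])
      show "q \<in> fst k" using q V(2) by blast
      have "snd k q \<in> S" using q by (simp add: S_def)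
      from has_derivative_inner_left[OF F1[OF this, unfolded has_vector_derivative_def]]
      show "((\<lambda>x. snd c (chart_inv k x) \<bullet> b) has_derivative (\<lambda>s. (s *\<^sub>R F1 (snd k q)) \<bullet> b)) (at (snd k q))"
        by (simp add: F_def)
    qed
    then show ?thesis by (simp only: components_def euclidean_representation)
  qed
  have second: "?X ?q (\<lambda>q'. components c (?X q') \<bullet> b) = (?a * ?a) *\<^sub>R F2 ?x \<bullet> b" for b
  proof -
    have "?X ?q (\<lambda>q'. components c (?X q') \<bullet> b) = ?X ?q (\<lambda>q'. (?a *\<^sub>R F1 (snd k q')) \<bullet> b)"
      by (rule N.coord_vec_cong[OF k(2) V(1,3)]) (simp add: comp)
    also have "\<dots> = (?a *\<^sub>R (?a *\<^sub>R F2 ?x)) \<bullet> b"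
    proof (rule N.coord_vecI[OF k(2,3), where L = "\<lambda>s. (?a *\<^sub>R (s *\<^sub>R F2 ?x)) \<bullet> b"])
      have Fb: "smooth_on S (\<lambda>x. (?a *\<^sub>R F1 x) \<bullet> b)"
        by (intro smooth_on_inner smooth_on_scaleR smooth_on_const S F1s)
      have "smooth_on S (\<lambda>x. (?a *\<^sub>R F1 (snd k (chart_inv k x))) \<bullet> b)"
        by (subst smooth_on_cong[OF S, where g = "\<lambda>x. (?a *\<^sub>R F1 x) \<bullet> b"])
          (simp_all only: snd_inv Fb)
      then have "chart_smooth k V (\<lambda>q'. (?a *\<^sub>R F1 (snd k q')) \<bullet> b)"
        by (simp add: chart_smooth_def S_eq)
      then show "smooth_near N ?q (\<lambda>q'. (?a *\<^sub>R F1 (snd k q')) \<bullet> b)"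
        by (intro N.smooth_nearI[OF V(1,3)] N.smooth_fun_of_chart_smooth[OF k(2) V(1,2)])
      have "((\<lambda>x. (?a *\<^sub>R F1 x) \<bullet> b) has_derivative (\<lambda>s. (?a *\<^sub>R (s *\<^sub>R F2 ?x)) \<bullet> b)) (at ?x)"
        by (intro has_derivative_inner_left has_derivative_scaleR_right F2[OF xS, unfolded has_vector_derivative_def])
      then show "((\<lambda>x. (?a *\<^sub>R F1 (snd k (chart_inv k x))) \<bullet> b) has_derivative
          (\<lambda>s. (?a *\<^sub>R (s *\<^sub>R F2 ?x)) \<bullet> b)) (at ?x)"
        by (rule has_derivative_transform_within_open[OF _ S xS]) (use inv V(2) in \<open>auto simp: S_def subset_iff\<close>)
    qed
    finally show ?thesis by simp
  qed
  have "?E \<in> tangent_space N ?q"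
    by (rule N.vfieldsD(1)[OF N.affine_connectionD(1)[OF E admissible_chartD(1)[OF k(2)]
          N.coord_vec_vfield[OF k(2)] N.coord_vec_vfield[OF k(2)]] k(3)])
  then have "components c ?E = components k ?E *\<^sub>R F1 ?x"
    using N.tangent_eq_coord_vec[OF k(2,3)] comp[OF V(3)] by metis
  moreover have "(\<Sum>b\<in>Basis. ?X ?q (\<lambda>q'. components c (?X q') \<bullet> b) *\<^sub>R b) = (?a * ?a) *\<^sub>R F2 ?x"
    unfolding second by (rule euclidean_representation)
  \<comment> \<open>The transformation law at time \<open>t0\<close>: with velocity a and coordinate
    change F, the components of \<open>?E\<close> times F' equal a^2 F'' plus the target form at a
    F'.\<close>
  ultimately have key: "components k ?E *\<^sub>R F1 ?x = (?a * ?a) *\<^sub>R F2 ?x + G ?q (?a *\<^sub>R F1 ?x)"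
    using G[OF k(1,3) t0(2), of ?a] comp[OF V(3)] by simp
  show "((snd c \<circ> \<gamma>) has_vector_derivative c' t0) (at t0 within {0..1}) \<and>
      (c' has_vector_derivative - G (\<gamma> t0) (c' t0)) (at t0 within {0..1})"
  proof
    have z: "dist t0 t0 < e" using e(1) by simp
    show "((snd c \<circ> \<gamma>) has_vector_derivative c' t0) (at t0 within {0..1})"
      using d1[OF t0(1) z] c'_eq[OF t0(1) z] by simp
    have "(F1 has_vector_derivative F2 ((snd k \<circ> \<gamma>) t0)) (at ((snd k \<circ> \<gamma>) t0) within (snd k \<circ> \<gamma>) ` {0..1})"
      unfolding comp_def by (rule has_vector_derivative_at_within[OF F2[OF xS]])
    from vector_diff_chain_within[OF u'[OF t0(1) k(3)] this]
    have "((\<lambda>t. F1 (snd k (\<gamma> t))) has_vector_derivative ?a *\<^sub>R F2 ?x) (at t0 within {0..1})"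
      by (simp add: comp_def)
    moreover have "(u' has_field_derivative - components k ?E) (at t0 within {0..1})"
      using u''[OF t0(1) k(3)] by (simp add: has_real_derivative_iff_has_vector_derivative)
    ultimately have "((\<lambda>t. u' t *\<^sub>R F1 (snd k (\<gamma> t))) has_vector_derivative
        ?a *\<^sub>R (?a *\<^sub>R F2 ?x) + (- components k ?E) *\<^sub>R F1 ?x) (at t0 within {0..1})"
      by (intro has_vector_derivative_scaleR)
    \<comment> \<open>In the product rule for a F' the term a^2 F'' cancels by the transformation
      law, which leaves the equation in the target chart.\<close>
    also have "?a *\<^sub>R (?a *\<^sub>R F2 ?x) + (- components k ?E) *\<^sub>R F1 ?x = - G ?q (?a *\<^sub>R F1 ?x)"
      using key by (simp add: algebra_simps)
    also have "?a *\<^sub>R F1 ?x = c' t0" using c'_eq[OF t0(1) z] by simp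
    finally show "(c' has_vector_derivative - G (\<gamma> t0) (c' t0)) (at t0 within {0..1})"
      by (rule has_vector_derivative_transform_within[OF _ e(1) t0(1)]) (simp add: c'_eq)
  qed
qed

lemma (in smooth_mfd) geodesic_imp_pts: "geodesic M D \<gamma> \<Longrightarrow> t \<in> {0..1} \<Longrightarrow> \<gamma> t \<in> pts M"
  by (auto simp: geodesic_def)

text \<open>The definition tests the atlas only, whereas a global affine coordinate is merely an
  admissible chart.\<close>

lemma geodesic_in_admissible_chart:
  fixes N :: "('a::{t2_space, second_countable_topology}, real) manifold"
  assumes N: "smooth_mfd N" and E: "affine_connection N E" and geo: "geodesic N E \<gamma>"
    and c: "admissible_chart N c"
  shows "\<exists>c'. \<forall>t\<in>{0..1}. \<gamma> t \<in> fst c \<longrightarrow>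
      ((snd c \<circ> \<gamma>) has_vector_derivative c' t) (at t within {0..1}) \<and>
      (c' has_vector_derivative
        - components c (E (fst c) (coord_vec N c (c' t)) (coord_vec N c (c' t)) (\<gamma> t))) (at t within {0..1})"
proof (rule geodesic_transfer[OF N E geo, where G = "\<lambda>q u. components c (E (fst c) (coord_vec N c u) (coord_vec N c u) q)"])
  interpret N: smooth_mfd N by (rule N)
  have eq: "fst c \<inter> pts N = fst c" using admissible_chartD(6)[OF c] by blast
  show "open_in N (fst c \<inter> pts N)" unfolding eq by (rule admissible_chartD(1)[OF c])
  show "chart_smooth k (fst c \<inter> pts N) (snd c)" if "k \<in> charts N" for k
    unfolding eq by (rule N.chart_transition[OF N.charts_adm[OF that] c])
  fix k q a
  assume k: "k \<in> charts N" and q: "q \<in> fst k" "q \<in> fst c"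
  note ka = N.charts_adm[OF k]
  show "components c (E (fst k) (coord_vec N k a) (coord_vec N k a) q)
      = (\<Sum>b\<in>Basis. coord_vec N k a q (\<lambda>q'. components c (coord_vec N k a q') \<bullet> b) *\<^sub>R b)
        + components c (E (fst c) (coord_vec N c (components c (coord_vec N k a q)))
            (coord_vec N c (components c (coord_vec N k a q))) q)"
    by (rule N.components_connection[OF E c admissible_chartD(1)[OF ka]
        N.coord_vec_vfield[OF ka] N.coord_vec_vfield[OF ka] q])
qed

context submfd
begin

text \<open>The induced derivative represents the full ambient derivative, with no normal part
  discarded, so the intrinsic equation is the ambient one.\<close>

lemma geodesic_induced_imp_geodesic:
  assumes D: "affine_connection P D" and ap: "autoparallel P N D"
    and geo: "geodesic N (induced_connection P N D) \<gamma>"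
  shows "geodesic P D \<gamma>"
proof -
  have "\<exists>c'. \<forall>t\<in>{0..1}. \<gamma> t \<in> fst c \<longrightarrow>
      ((snd c \<circ> \<gamma>) has_vector_derivative c' t) (at t within {0..1}) \<and>
      (c' has_vector_derivative
        - components c (D (fst c) (coord_vec P c (c' t)) (coord_vec P c (c' t)) (\<gamma> t))) (at t within {0..1})"
    if c: "c \<in> charts P" for c
  proof (rule geodesic_transfer[OF N.smooth_mfd_axioms affine_induced_connection[OF D ap] geo,
        where G = "\<lambda>q u. components c (D (fst c) (coord_vec P c u) (coord_vec P c u) q)"])
    show "open_in N (fst c \<inter> pts N)"
      by (rule open_restrict[OF admissible_chartD(1)[OF P.charts_adm[OF c]]])
    show "chart_smooth k (fst c \<inter> pts N) (snd c)" if "k \<in> charts N" for k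
      by (rule chart_smooth_subset[OF inclusion_smooth[OF that c]]) blast
    fix k q a
    assume k: "k \<in> charts N" and q: "q \<in> fst k" "q \<in> fst c"
    note ka = N.charts_adm[OF k]
    show "components c (induced_connection P N D (fst k) (coord_vec N k a) (coord_vec N k a) q)
        = (\<Sum>b\<in>Basis. coord_vec N k a q (\<lambda>q'. components c (coord_vec N k a q') \<bullet> b) *\<^sub>R b)
          + components c (D (fst c) (coord_vec P c (components c (coord_vec N k a q)))
              (coord_vec P c (components c (coord_vec N k a q))) q)"
      by (rule components_induced_connection[OF D ap admissible_chartD(1)[OF ka]
          N.coord_vec_vfield[OF ka] N.coord_vec_vfield[OF ka] q(1) P.charts_adm[OF c] q(2)])
  qed
  then show ?thesis
    using geo pts_sub unfolding geodesic_def by (auto simp: split_beta)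
qed

end

section \<open>Midpoint means under restriction\<close>

lemma midpoint_mean_eq:
  assumes "unique_geodesic M D p q" "geodesic_from_to M D p q \<gamma>"
  shows "midpoint_mean M D p q = \<gamma> (1/2)"
proof -
  obtain \<epsilon> where \<epsilon>: "\<forall>\<delta>. geodesic_from_to M D p q \<delta> \<longrightarrow> (\<forall>t\<in>{0..1}. \<delta> t = \<epsilon> t)"
    using assms(1) unfolding unique_geodesic_def by blast
  have h: "(1/2 :: real) \<in> {0..1}" by simp
  have "m = \<gamma> (1/2)" if "\<exists>\<delta>. geodesic_from_to M D p q \<delta> \<and> \<delta> (1/2) = m" for m
    using that \<epsilon>[rule_format, OF _ h] assms(2) by metis
  then show ?thesis unfolding midpoint_mean_def using assms(2) by (intro the1_equality ex1I[of _ "\<gamma> (1/2)"]) blast+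
qed

lemma (in submfd) midpoint_mean_induced:
  assumes D: "affine_connection P D" and ap: "autoparallel P N D"
    and conv: "geodesically_convex N (induced_connection P N D)" and p: "p \<in> pts N" and q: "q \<in> pts N"
    and u: "unique_geodesic P D p q"
  shows "midpoint_mean P D p q = midpoint_mean N (induced_connection P N D) p q"
    and "midpoint_mean P D p q \<in> pts N"
proof -
  have un: "unique_geodesic N (induced_connection P N D) p q"
    using conv p q unfolding geodesically_convex_def by blast
  then obtain \<gamma> where \<gamma>: "geodesic_from_to N (induced_connection P N D) p q \<gamma>"
    unfolding unique_geodesic_def by blast
  have P: "geodesic_from_to P D p q \<gamma>"
    using \<gamma> geodesic_induced_imp_geodesic[OF D ap] unfolding geodesic_from_to_def by blast
  show "midpoint_mean P D p q = midpoint_mean N (induced_connection P N D) p q"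
    using midpoint_mean_eq[OF u P] midpoint_mean_eq[OF un \<gamma>] by simp
  show "midpoint_mean P D p q \<in> pts N"
    using midpoint_mean_eq[OF u P] \<gamma> by (auto simp: geodesic_from_to_def geodesic_def)
qed

section \<open>The functional equation\<close>

lemma antiderivative_on_open_interval:
  fixes f :: "real \<Rightarrow> real"
  assumes S: "open S" "is_interval S" and f: "continuous_on S f"
  obtains F where "\<And>x. x \<in> S \<Longrightarrow> (F has_real_derivative f x) (at x)"
proof (cases "S = {}")
  case False
  then obtain a where a: "a \<in> S" by blast
  \<comment> \<open>An integral over an empty interval is 0, so one formula covers both sides of the
    base point \<open>a\<close>.\<close>
  define F where "F x = integral {a..x} f - integral {x..a} f" for x
  have "(F has_real_derivative f x) (at x)" if x: "x \<in> S" for x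
  proof -
    have "min a x \<in> S" "max a x \<in> S" using a x by (auto simp: min_def max_def)
    then obtain d e where d: "d > 0" "ball (min a x) d \<subseteq> S" and e: "e > 0" "ball (max a x) e \<subseteq> S"
      using S(1) open_contains_ball by metis
    \<comment> \<open>The ends of a compact interval within \<open>S\<close> that has both
      \<open>a\<close> and \<open>x\<close> in its interior.\<close>
    define l where "l = min a x - d/2"
    define u where "u = max a x + e/2"
    have l: "l \<in> S" "l < a" "l < x" using d by (auto simp: l_def ball_def dist_real_def subset_iff)
    have u: "u \<in> S" "a < u" "x < u" using e by (auto simp: u_def ball_def dist_real_def subset_iff)
    have sub: "{l..u} \<subseteq> S" using S(2) l(1) u(1) by (meson atLeastAtMost_iff is_interval_1 subsetI)
    have cont: "continuous_on {l..u} f" using f sub by (rule continuous_on_subset)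
    have int: "f integrable_on {r..r'}" if "l \<le> r" "r' \<le> u" for r r'
      using that by (intro integrable_continuous_real continuous_on_subset[OF cont]) auto
    have eq: "F y = integral {l..y} f - integral {l..a} f" if y: "y \<in> {l..u}" for y
    proof (cases "a \<le> y")
      case True
      have "integral {l..a} f + integral {a..y} f = integral {l..y} f"
        by (rule Henstock_Kurzweil_Integration.integral_combine) (use l u y True int in auto)
      moreover have "integral {y..a} f = 0" using True by (cases "y = a") auto
      ultimately show ?thesis by (simp add: F_def)
    next
      case False
      have "integral {l..y} f + integral {y..a} f = integral {l..a} f"
        by (rule Henstock_Kurzweil_Integration.integral_combine) (use l u y False int in auto)
      then show ?thesis using False by (simp add: F_def)
    qed
    have "((\<lambda>y. integral {l..y} f) has_real_derivative f x) (at x within {l..u})"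
      using integral_has_real_derivative[OF cont, of x] l u by simp
    then have "((\<lambda>y. integral {l..y} f - integral {l..a} f) has_real_derivative f x) (at x within {l..u})"
      by (auto intro!: derivative_eq_intros)
    then have "((\<lambda>y. integral {l..y} f - integral {l..a} f) has_real_derivative f x) (at x)"
      using l u by (simp add: at_within_Icc_at)
    then show ?thesis
      by (rule has_field_derivative_transform_within_open[where S = "{l<..<u}"]) (use l u eq in auto)
  qed
  then show ?thesis using that by blast
qed (use that in blast)

lemma strict_mono_on_interval_deriv_pos:
  fixes f :: "real \<Rightarrow> real"
  assumes "is_interval S" "\<And>x. x \<in> S \<Longrightarrow> (f has_real_derivative f' x) (at x)" "\<And>x. x \<in> S \<Longrightarrow> f' x > 0"
  shows "strict_mono_on S f"
proof (rule strict_mono_onI)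
  fix x y assume xy: "x \<in> S" "y \<in> S" "x < y"
  have "z \<in> S" if "x \<le> z" "z \<le> y" for z using assms(1) xy that by (metis is_interval_1)
  then show "f x < f y" using DERIV_pos_imp_increasing[OF xy(3)] assms(2,3) by metis
qed

text \<open>Leading Taylor coefficient by repeated use of l'Hopital's rule; \<open>d i\<close> plays
  the role of the i-th derivative.\<close>

lemma quotient_power_tendsto:
  fixes d :: "nat \<Rightarrow> real \<Rightarrow> real"
  assumes "\<And>i. i < n \<Longrightarrow> d i 0 = 0"
    and "\<And>i. i < n \<Longrightarrow> \<forall>\<^sub>F t in nhds 0. (d i has_real_derivative d (Suc i) t) (at t)"
    and "isCont (d n) 0"
  shows "((\<lambda>h. d 0 h / h ^ n) \<longlongrightarrow> d n 0 / fact n) (at 0)"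
  using assms
proof (induction n arbitrary: d)
  case 0
  then show ?case by (simp add: isCont_def)
next
  case (Suc n)
  have d0: "\<forall>\<^sub>F t in nhds 0. (d 0 has_real_derivative d 1 t) (at t)" using Suc.prems(2)[of 0] by simp
  have IH: "((\<lambda>h. d 1 h / h ^ n) \<longlongrightarrow> d (Suc n) 0 / fact n) (at 0)"
    using Suc.IH[of "\<lambda>i. d (Suc i)"] Suc.prems by simp
  show ?case
  proof (rule lhopital[where f' = "d 1" and g' = "\<lambda>h. real (Suc n) * h ^ n"])
    have "isCont (d 0) 0" using eventually_nhds_x_imp_x[OF d0] DERIV_isCont by blast
    then show "(d 0 \<longlongrightarrow> 0) (at 0)" using Suc.prems(1)[of 0] by (simp add: isCont_def)
    show "((\<lambda>h. h ^ Suc n) \<longlongrightarrow> 0) (at (0::real))"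
      by (rule tendsto_eq_intros refl | simp)+
    show "\<forall>\<^sub>F h in at 0. h ^ Suc n \<noteq> (0::real)" by (simp add: eventually_at_filter)
    show "\<forall>\<^sub>F h in at 0. real (Suc n) * h ^ n \<noteq> 0"
      unfolding eventually_at_filter by (intro always_eventually) auto
    show "\<forall>\<^sub>F h in at 0. (d 0 has_real_derivative d 1 h) (at h)"
      using d0 by (auto simp: eventually_at_filter elim: eventually_mono)
    show "\<forall>\<^sub>F h in at 0. ((\<lambda>h. h ^ Suc n) has_real_derivative real (Suc n) * h ^ n) (at h)"
      using DERIV_pow[of "Suc n"] by (intro always_eventually allI) simp
    have "((\<lambda>h. (d 1 h / h ^ n) * inverse (real (Suc n))) \<longlongrightarrow> d (Suc n) 0 / fact n * inverse (real (Suc n))) (at 0)"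
      by (intro tendsto_mult IH tendsto_const)
    then show "((\<lambda>h. d 1 h / (real (Suc n) * h ^ n)) \<longlongrightarrow> d (Suc n) 0 / fact (Suc n)) (at 0)"
      by (simp add: field_simps)
  qed
qed

text \<open>Fourth-order expansion of the invariance equation around the midpoint \<open>m\<close>. Here \<open>\<sigma> = \<surd>w\<close>,
  \<open>s' = \<sigma>\<close>, \<open>y' = \<sigma>\<^sup>2\<close> and \<open>M t\<close> is the \<open>y\<close>-midpoint of \<open>m - t\<close> and \<open>m + t\<close>. The even
  combination of the two defining equations that kills the second-order term is compared at
  order \<open>t\<^sup>4\<close>.\<close>

lemma invariance_fourth_order:
  fixes y s \<sigma> \<sigma>1 \<sigma>2 \<sigma>3 :: "real \<Rightarrow> real"
  assumes S: "open S" "is_interval S" "m \<in> S"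
    and pos: "\<And>t. t \<in> S \<Longrightarrow> \<sigma> t > 0"
    and y: "\<And>t. t \<in> S \<Longrightarrow> (y has_real_derivative (\<sigma> t)\<^sup>2) (at t)"
    and s: "\<And>t. t \<in> S \<Longrightarrow> (s has_real_derivative \<sigma> t) (at t)"
    and d1: "\<And>t. t \<in> S \<Longrightarrow> (\<sigma> has_real_derivative \<sigma>1 t) (at t)"
    and d2: "\<And>t. t \<in> S \<Longrightarrow> (\<sigma>1 has_real_derivative \<sigma>2 t) (at t)"
    and d3: "\<And>t. t \<in> S \<Longrightarrow> (\<sigma>2 has_real_derivative \<sigma>3 t) (at t)"
    and cont: "continuous_on S \<sigma>3"
    and inv: "\<And>p q. p \<in> S \<Longrightarrow> q \<in> S \<Longrightarrow>
      \<exists>r\<in>S. y r = (y p + y q) / 2 \<and> s ((p + q) / 2) + s r = s p + s q"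
  shows "\<sigma>1 m * (2 * (\<sigma>1 m)\<^sup>2 - \<sigma> m * \<sigma>2 m) = 0"
proof (cases "\<sigma>1 m = 0")
  \<comment> \<open>With a nonzero first derivative the \<open>y\<close>-midpoint leaves
    \<open>m\<close> at order t^2 exactly, so that quotients by its displacement make sense.\<close>
  case False
  obtain e where e: "e > 0" "ball m e \<subseteq> S" using S open_contains_ball by blast
  have in_S: "m + t \<in> S" "m - t \<in> S" if "\<bar>t\<bar> < e" for t
    using e(2) that by (auto simp: ball_def dist_real_def subset_iff)
  have ev: "\<forall>\<^sub>F t in nhds 0. \<bar>t\<bar> < e"
    using e(1) unfolding eventually_nhds_metric by (auto simp: dist_real_def)
  have ev_at: "\<forall>\<^sub>F t in at 0. \<bar>t\<bar> < e" using ev by (auto simp: eventually_at_filter elim: eventually_mono)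
  have plus: "((\<lambda>t. f (m + t)) has_real_derivative f' (m + t)) (at t)"
    if "(f has_real_derivative f' (m + t)) (at (m + t))" for f f' t
  proof -
    have "((\<lambda>t. m + t) has_real_derivative 1) (at t)" by (auto intro!: derivative_eq_intros)
    from DERIV_chain2[where f = f and g = "\<lambda>t. m + t" and x = t, OF that this] show ?thesis by simp
  qed
  have minus: "((\<lambda>t. f (m - t)) has_real_derivative - f' (m - t)) (at t)"
    if "(f has_real_derivative f' (m - t)) (at (m - t))" for f f' t
  proof -
    have "((\<lambda>t. m - t) has_real_derivative -1) (at t)" by (auto intro!: derivative_eq_intros)
    from DERIV_chain2[where f = f and g = "\<lambda>t. m - t" and x = t, OF that this] show ?thesis by simp
  qed
  have even: "((\<lambda>t. f (m + t) + f (m - t)) has_real_derivative f' (m + t) - f' (m - t)) (at t)"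
    and odd: "((\<lambda>t. f (m + t) - f (m - t)) has_real_derivative f' (m + t) + f' (m - t)) (at t)"
    if "\<And>x. x \<in> S \<Longrightarrow> (f has_real_derivative f' x) (at x)" "\<bar>t\<bar> < e" for f f' t
    using DERIV_add[OF plus[where f = f and f' = f', OF that(1)[OF in_S(1)[OF that(2)]]]
        minus[where f = f and f' = f', OF that(1)[OF in_S(2)[OF that(2)]]]]
      DERIV_diff[OF plus[where f = f and f' = f', OF that(1)[OF in_S(1)[OF that(2)]]]
        minus[where f = f and f' = f', OF that(1)[OF in_S(2)[OF that(2)]]]] by simp_all
  have at_plus: "isCont (\<lambda>t. f (m + t)) 0" and at_minus: "isCont (\<lambda>t. f (m - t)) 0" if "isCont f m" for f :: "real \<Rightarrow> real"
    using that by (auto intro!: continuous_intros isCont_o2[of 0 "\<lambda>t. m + t" f] isCont_o2[of 0 "\<lambda>t. m - t" f])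
  have cont_at: "isCont \<sigma> m" "isCont \<sigma>1 m" "isCont \<sigma>2 m" "isCont \<sigma>3 m"
    using d1 d2 d3 S DERIV_isCont cont continuous_on_eq_continuous_at by blast+
  have mono: "strict_mono_on S s"
    using strict_mono_on_interval_deriv_pos[OF S(2) s pos] .

  \<comment> \<open>By the invariance equation this is the displacement, measured in
    \<open>s\<close>, of the \<open>y\<close>-midpoint from \<open>m\<close>.\<close>
  define T where "T t = s (m + t) + s (m - t) - 2 * s m" for t
  have T_lim: "((\<lambda>t. T t / t ^ 2) \<longlongrightarrow> \<sigma>1 m) (at 0)"
  proof -
    \<comment> \<open>A list of successive derivatives, read by index, is the sequence that the
      quotient lemma expects.\<close>
    define d where "d = (!) [T, \<lambda>t. \<sigma> (m + t) - \<sigma> (m - t), \<lambda>t. \<sigma>1 (m + t) + \<sigma>1 (m - t)]"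
    have "((\<lambda>h. d 0 h / h ^ 2) \<longlongrightarrow> d 2 0 / fact 2) (at 0)"
    proof (rule quotient_power_tendsto)
      show "d i 0 = 0" if i: "i < 2" for i
        using i by (auto simp: d_def T_def less_Suc_eq numeral_2_eq_2)
      show "\<forall>\<^sub>F t in nhds 0. (d i has_real_derivative d (Suc i) t) (at t)" if i: "i < 2" for i
        using ev
      proof eventually_elim
        case (elim t)
        consider "i = 0" | "i = 1" using i by linarith
        then show ?case
        proof cases
          case 1
          have "(T has_real_derivative \<sigma> (m + t) - \<sigma> (m - t) - 0) (at t)"
            unfolding T_def by (rule DERIV_diff[OF even[where f = s and f' = \<sigma>, OF s elim] DERIV_const])
          then show ?thesis using 1 by (simp add: d_def)
        next
          case 2
          then show ?thesis using odd[where f = \<sigma> and f' = \<sigma>1, OF d1 elim] by (simp add: d_def)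
        qed
      qed
      show "isCont (d 2) 0"
        using at_plus[OF cont_at(2)] at_minus[OF cont_at(2)] by (auto simp: d_def intro: continuous_intros)
    qed
    then show ?thesis by (simp add: d_def)
  qed

  \<comment> \<open>The weights 1/2 and \<sigma>(m) are those for which the second derivative
    \<open>k2\<close> vanishes at \<open>m\<close>; the even combination \<open>K\<close> then
    starts at order t^4.\<close>
  define k where "k x = y x / 2 - \<sigma> m * s x" for x
  define k1 where "k1 x = (\<sigma> x)\<^sup>2 / 2 - \<sigma> m * \<sigma> x" for x
  define k2 where "k2 x = \<sigma> x * \<sigma>1 x - \<sigma> m * \<sigma>1 x" for x
  define k3 where "k3 x = \<sigma>1 x * \<sigma>1 x + \<sigma> x * \<sigma>2 x - \<sigma> m * \<sigma>2 x" for x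
  define k4 where "k4 x = 3 * \<sigma>1 x * \<sigma>2 x + \<sigma> x * \<sigma>3 x - \<sigma> m * \<sigma>3 x" for x
  have dk: "(k has_real_derivative k1 x) (at x)" "(k1 has_real_derivative k2 x) (at x)"
    "(k2 has_real_derivative k3 x) (at x)" "(k3 has_real_derivative k4 x) (at x)" if "x \<in> S" for x
    unfolding k_def k1_def k2_def k3_def k4_def
    using that by (auto intro!: derivative_eq_intros y s d1 d2 d3 simp: algebra_simps power2_eq_square)
  define K where "K t = k (m + t) + k (m - t) - 2 * k m" for t
  have K_lim: "((\<lambda>t. K t / t ^ 4) \<longlongrightarrow> \<sigma>1 m * \<sigma>2 m / 4) (at 0)"
  proof -
    define d where "d = (!) [K, \<lambda>t. k1 (m + t) - k1 (m - t), \<lambda>t. k2 (m + t) + k2 (m - t),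
      \<lambda>t. k3 (m + t) - k3 (m - t), \<lambda>t. k4 (m + t) + k4 (m - t)]"
    have "((\<lambda>h. d 0 h / h ^ 4) \<longlongrightarrow> d 4 0 / fact 4) (at 0)"
    proof (rule quotient_power_tendsto)
      show "d i 0 = 0" if i: "i < 4" for i
      proof -
        consider "i = 0" | "i = 1" | "i = 2" | "i = 3" using i by linarith
        then show ?thesis by cases (auto simp: d_def K_def k2_def eval_nat_numeral)
      qed
      show "\<forall>\<^sub>F t in nhds 0. (d i has_real_derivative d (Suc i) t) (at t)" if i: "i < 4" for i
        using ev
      proof eventually_elim
        case (elim t)
        consider "i = 0" | "i = 1" | "i = 2" | "i = 3" using i by linarith
        then show ?case
        proof cases
          case 1
          have "(K has_real_derivative k1 (m + t) - k1 (m - t) - 0) (at t)"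
            unfolding K_def by (rule DERIV_diff[OF even[where f = k and f' = k1, OF dk(1) elim] DERIV_const])
          then show ?thesis using 1 by (simp add: d_def)
        next
          case 2
          then show ?thesis using odd[where f = k1 and f' = k2, OF dk(2) elim] by (simp add: d_def)
        next
          case 3
          then show ?thesis using even[where f = k2 and f' = k3, OF dk(3) elim] by (simp add: d_def eval_nat_numeral)
        next
          case 4
          then show ?thesis using odd[where f = k3 and f' = k4, OF dk(4) elim] by (simp add: d_def eval_nat_numeral)
        qed
      qed
      have "isCont k4 m" unfolding k4_def using cont_at by (intro continuous_intros)
      then show "isCont (d 4) 0"
        using at_plus[of k4] at_minus[of k4] by (auto simp: d_def eval_nat_numeral intro: continuous_intros)
    qed
    then show ?thesis by (simp add: d_def k4_def eval_nat_numeral fact_numeral)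
  qed

  \<comment> \<open>The corresponding combination as a function of the displacement u of the
    midpoint. It has no linear term, so it is of order u^2, that is, again t^4.\<close>
  define j where "j u = y (m + u) - y m - \<sigma> m * (s (m + u) - s m)" for u
  have j_lim: "((\<lambda>u. j u / u ^ 2) \<longlongrightarrow> \<sigma> m * \<sigma>1 m / 2) (at 0)"
  proof -
    define d where "d = (!) [j, \<lambda>u. (\<sigma> (m + u))\<^sup>2 - \<sigma> m * \<sigma> (m + u),
      \<lambda>u. 2 * \<sigma> (m + u) * \<sigma>1 (m + u) - \<sigma> m * \<sigma>1 (m + u)]"
    have "((\<lambda>h. d 0 h / h ^ 2) \<longlongrightarrow> d 2 0 / fact 2) (at 0)"
    proof (rule quotient_power_tendsto)
      show "d i 0 = 0" if i: "i < 2" for i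
      proof -
        consider "i = 0" | "i = 1" using i by linarith
        then show ?thesis by cases (auto simp: d_def j_def power2_eq_square)
      qed
      show "\<forall>\<^sub>F t in nhds 0. (d i has_real_derivative d (Suc i) t) (at t)" if i: "i < 2" for i
        using ev
      proof eventually_elim
        case (elim t)
        note S_t = in_S[OF elim]
        have ds: "((\<lambda>t. \<sigma> (m + t)) has_real_derivative \<sigma>1 (m + t)) (at t)"
          "((\<lambda>t. y (m + t)) has_real_derivative (\<sigma> (m + t))\<^sup>2) (at t)"
          "((\<lambda>t. s (m + t)) has_real_derivative \<sigma> (m + t)) (at t)"
          using plus[where f = \<sigma> and f' = \<sigma>1, OF d1[OF S_t(1)]]
            plus[where f = y and f' = "\<lambda>x. (\<sigma> x)\<^sup>2", OF y[OF S_t(1)]]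
            plus[where f = s and f' = \<sigma>, OF s[OF S_t(1)]] by simp_all
        consider "i = 0" | "i = 1" using i by linarith
        then show ?case
        proof cases
          case 1
          have "(j has_real_derivative (\<sigma> (m + t))\<^sup>2 - \<sigma> m * \<sigma> (m + t)) (at t)"
            unfolding j_def by (auto intro!: derivative_eq_intros ds)
          then show ?thesis using 1 by (simp add: d_def)
        next
          case 2
          have "((\<lambda>u. (\<sigma> (m + u))\<^sup>2 - \<sigma> m * \<sigma> (m + u)) has_real_derivative
              2 * \<sigma> (m + t) * \<sigma>1 (m + t) - \<sigma> m * \<sigma>1 (m + t)) (at t)"
            by (rule derivative_eq_intros ds refl)+ simp
          then show ?thesis using 2 by (simp add: d_def)
        qed
      qed
      show "isCont (d 2) 0"
        using at_plus[OF cont_at(1)] at_plus[OF cont_at(2)] by (auto simp: d_def intro!: continuous_intros)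
    qed
    then show ?thesis by (simp add: d_def)
  qed

  have "\<exists>r. \<forall>t. \<bar>t\<bar> < e \<longrightarrow> r t \<in> S \<and> y (r t) = (y (m + t) + y (m - t)) / 2 \<and> s m + s (r t) = s (m + t) + s (m - t)"
    using inv[OF in_S] by (intro choice) fastforce
  then obtain r where r: "\<And>t. \<bar>t\<bar> < e \<Longrightarrow> r t \<in> S"
      "\<And>t. \<bar>t\<bar> < e \<Longrightarrow> y (r t) = (y (m + t) + y (m - t)) / 2"
      "\<And>t. \<bar>t\<bar> < e \<Longrightarrow> s m + s (r t) = s (m + t) + s (m - t)" by blast
  define \<mu> where "\<mu> t = r t - m" for t
  have s_\<mu>: "s (m + \<mu> t) - s m = T t" if "\<bar>t\<bar> < e" for t
    using r(3)[OF that] by (simp add: \<mu>_def T_def)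
  \<comment> \<open>The averaging equation for \<open>y\<close> and the equation for
    \<open>s\<close> combine to one identity between two quantities that are expanded
    independently.\<close>
  have j_\<mu>: "j (\<mu> t) = K t" if "\<bar>t\<bar> < e" for t
  proof -
    have "j (\<mu> t) = y (r t) - y m - \<sigma> m * T t"
      unfolding j_def s_\<mu>[OF that] by (simp add: \<mu>_def)
    moreover have "K t = (y (m + t) + y (m - t)) / 2 - y m - \<sigma> m * T t"
      by (simp add: K_def k_def T_def algebra_simps add_divide_distrib)
    ultimately show ?thesis using r(2)[OF that] by simp
  qed
  have T0: "(T \<longlongrightarrow> 0) (at 0)"
  proof -
    have "isCont s m" using s[OF S(3)] DERIV_isCont by blast
    then have "isCont T 0" unfolding T_def using at_plus at_minus by (intro continuous_intros) auto
    then show ?thesis by (simp add: isCont_def T_def)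
  qed
  \<comment> \<open>Strict monotonicity of \<open>s\<close> turns convergence of
    \<open>s (r t)\<close> to \<open>s m\<close> into convergence of \<open>r t\<close> to
    \<open>m\<close>.\<close>
  have \<mu>0: "(\<mu> \<longlongrightarrow> 0) (at 0)"
  proof (rule tendstoI)
    fix \<delta> :: real assume "\<delta> > 0"
    define \<delta>' where "\<delta>' = min \<delta> e / 2"
    have \<delta>': "\<delta>' > 0" "\<delta>' < \<delta>" "\<bar>\<delta>'\<bar> < e" using \<open>\<delta> > 0\<close> e(1) by (auto simp: \<delta>'_def)
    define \<epsilon> where "\<epsilon> = min (s (m + \<delta>') - s m) (s m - s (m - \<delta>'))"
    have "\<epsilon> > 0"
      using strict_mono_onD[OF mono S(3) in_S(1)[OF \<delta>'(3)]] strict_mono_onD[OF mono in_S(2)[OF \<delta>'(3)] S(3)] \<delta>'(1)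
      by (auto simp: \<epsilon>_def)
    have "\<forall>\<^sub>F t in at 0. dist (T t) 0 < \<epsilon>" using tendstoD[OF T0 \<open>\<epsilon> > 0\<close>] .
    with ev_at show "\<forall>\<^sub>F t in at 0. dist (\<mu> t) 0 < \<delta>"
    proof eventually_elim
      case (elim t)
      have b: "s (m - \<delta>') < s (r t)" "s (r t) < s (m + \<delta>')"
        using s_\<mu>[OF elim(1)] elim(2) by (auto simp: \<mu>_def \<epsilon>_def dist_real_def)
      have "m - \<delta>' < r t" "r t < m + \<delta>'"
        using b strict_mono_on_less[OF mono] in_S[OF \<delta>'(3)] r(1)[OF elim(1)] by blast+
      then show ?case using \<delta>'(2) by (auto simp: \<mu>_def dist_real_def)
    qed
  qed
  \<comment> \<open>Here the assumption of a nonzero first derivative enters: T/t^2 has a nonzero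
    limit.\<close>
  have T_nz: "\<forall>\<^sub>F t in at 0. T t \<noteq> 0"
  proof -
    have "\<forall>\<^sub>F t in at 0. T t / t ^ 2 \<noteq> 0" using tendsto_imp_eventually_ne[OF T_lim False] .
    then show ?thesis by eventually_elim auto
  qed
  have \<mu>_nz: "\<forall>\<^sub>F t in at 0. \<mu> t \<noteq> 0"
    using T_nz ev_at by eventually_elim (use s_\<mu> in fastforce)
  have \<mu>_at: "filterlim \<mu> (at 0) (at 0)" using \<mu>0 \<mu>_nz by (simp add: filterlim_at)
  have "((\<lambda>u. (s (m + u) - s m) / u) \<longlongrightarrow> \<sigma> m) (at 0)"
    using s[OF S(3)] by (simp add: DERIV_def)
  from filterlim_compose[OF this \<mu>_at]
  have "((\<lambda>t. (s (m + \<mu> t) - s m) / \<mu> t) \<longlongrightarrow> \<sigma> m) (at 0)" .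
  then have "((\<lambda>t. T t / t ^ 2 / ((s (m + \<mu> t) - s m) / \<mu> t)) \<longlongrightarrow> \<sigma>1 m / \<sigma> m) (at 0)"
    using pos[OF S(3)] by (intro tendsto_divide T_lim) auto
  then have \<mu>_lim: "((\<lambda>t. \<mu> t / t ^ 2) \<longlongrightarrow> \<sigma>1 m / \<sigma> m) (at 0)"
  proof (rule Lim_transform_eventually)
    show "\<forall>\<^sub>F t in at 0. T t / t ^ 2 / ((s (m + \<mu> t) - s m) / \<mu> t) = \<mu> t / t ^ 2"
      using T_nz \<mu>_nz ev_at by eventually_elim (simp add: s_\<mu>)
  qed
  \<comment> \<open>Splitting j(\<mu>)/t^4 into j(\<mu>)/\<mu>^2 times the square of \<mu>/t^2 gives
    a second value for the limit of K/t^4.\<close>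
  have "((\<lambda>t. j (\<mu> t) / \<mu> t ^ 2 * (\<mu> t / t ^ 2) ^ 2) \<longlongrightarrow> \<sigma> m * \<sigma>1 m / 2 * (\<sigma>1 m / \<sigma> m) ^ 2) (at 0)"
    by (intro tendsto_mult tendsto_power \<mu>_lim filterlim_compose[OF j_lim \<mu>_at])
  then have "((\<lambda>t. K t / t ^ 4) \<longlongrightarrow> \<sigma> m * \<sigma>1 m / 2 * (\<sigma>1 m / \<sigma> m) ^ 2) (at 0)"
  proof (rule Lim_transform_eventually)
    show "\<forall>\<^sub>F t in at 0. j (\<mu> t) / \<mu> t ^ 2 * (\<mu> t / t ^ 2) ^ 2 = K t / t ^ 4"
      using \<mu>_nz ev_at by eventually_elim (simp add: j_\<mu> power_divide)
  qed
  then have "\<sigma> m * \<sigma>1 m / 2 * (\<sigma>1 m / \<sigma> m) ^ 2 = \<sigma>1 m * \<sigma>2 m / 4"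
    using K_lim tendsto_unique[OF trivial_limit_at] by blast
  then have "2 * (\<sigma>1 m)\<^sup>2 = \<sigma> m * \<sigma>2 m"
    using False pos[OF S(3)] by (simp add: field_simps power2_eq_square)
  then show ?thesis by simp
qed simp

lemma weight_of_invariance:
  fixes w y s :: "real \<Rightarrow> real"
  assumes S: "open S" "is_interval S" "S \<noteq> {}"
    and w: "smooth_on S w" "\<And>t. t \<in> S \<Longrightarrow> w t > 0"
    and y: "\<And>t. t \<in> S \<Longrightarrow> (y has_real_derivative w t) (at t)"
    and s: "\<And>t. t \<in> S \<Longrightarrow> (s has_real_derivative sqrt (w t)) (at t)"
    and inv: "\<And>p q. p \<in> S \<Longrightarrow> q \<in> S \<Longrightarrow>
      \<exists>r\<in>S. y r = (y p + y q) / 2 \<and> s ((p + q) / 2) + s r = s p + s q"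
  shows "(\<exists>c. \<forall>t\<in>S. w t = c) \<or> (\<exists>c>0. \<exists>x0. x0 \<notin> S \<and> (\<forall>t\<in>S. w t = c / (t - x0)\<^sup>2))"
proof -
  define \<sigma> where "\<sigma> t = sqrt (w t)" for t
  define \<sigma>1 where "\<sigma>1 t = frechet_derivative \<sigma> (at t) 1" for t
  define \<sigma>2 where "\<sigma>2 t = frechet_derivative \<sigma>1 (at t) 1" for t
  define \<sigma>3 where "\<sigma>3 t = frechet_derivative \<sigma>2 (at t) 1" for t
  have "w ` S \<subseteq> {0<..}" using w(2) by auto
  from smooth_on_compose[OF S(1) _ this w(1) smooth_on_sqrt] have \<sigma>s: "smooth_on S \<sigma>"
    by (simp add: \<sigma>_def[abs_def])
  have \<sigma>1s: "smooth_on S \<sigma>1" unfolding \<sigma>1_def by (rule smooth_on_frechet_derivative[OF \<sigma>s])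
  have \<sigma>2s: "smooth_on S \<sigma>2" unfolding \<sigma>2_def by (rule smooth_on_frechet_derivative[OF \<sigma>1s])
  have \<sigma>3s: "smooth_on S \<sigma>3" unfolding \<sigma>3_def by (rule smooth_on_frechet_derivative[OF \<sigma>2s])
  have d: "(\<sigma> has_real_derivative \<sigma>1 t) (at t)" "(\<sigma>1 has_real_derivative \<sigma>2 t) (at t)"
    "(\<sigma>2 has_real_derivative \<sigma>3 t) (at t)" if "t \<in> S" for t
    unfolding has_real_derivative_iff_has_vector_derivative \<sigma>1_def \<sigma>2_def \<sigma>3_def
    using smooth_on_has_vector_derivative[OF \<sigma>s that] smooth_on_has_vector_derivative[OF \<sigma>1s that]
      smooth_on_has_vector_derivative[OF \<sigma>2s that] by (simp_all add: \<sigma>1_def[abs_def] \<sigma>2_def[abs_def])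
  have pos: "\<sigma> t > 0" and w_eq: "w t = (\<sigma> t)\<^sup>2" if "t \<in> S" for t
    using w(2)[OF that] by (auto simp: \<sigma>_def)
  have key: "\<sigma>1 m * (2 * (\<sigma>1 m)\<^sup>2 - \<sigma> m * \<sigma>2 m) = 0" if m: "m \<in> S" for m
  proof (rule invariance_fourth_order[OF S(1,2) m pos _ _ d smooth_on_imp_continuous_on[OF \<sigma>3s] inv])
    show "(y has_real_derivative (\<sigma> t)\<^sup>2) (at t)" if "t \<in> S" for t using y[OF that] w_eq[OF that] by simp
    show "(s has_real_derivative \<sigma> t) (at t)" if "t \<in> S" for t using s[OF that] by (simp add: \<sigma>_def)
  qed
  define \<rho> where "\<rho> t = inverse (\<sigma> t)" for t
  define \<rho>1 where "\<rho>1 t = - (\<sigma>1 t / (\<sigma> t)\<^sup>2)" for t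
  \<comment> \<open>The second derivative of 1/\<sigma>: its numerator is the factor produced by the
    fourth-order expansion.\<close>
  define \<rho>2 where "\<rho>2 t = (2 * (\<sigma>1 t)\<^sup>2 - \<sigma> t * \<sigma>2 t) / (\<sigma> t)^3" for t
  have d\<rho>: "(\<rho> has_real_derivative \<rho>1 t) (at t)" "(\<rho>1 has_real_derivative \<rho>2 t) (at t)" if "t \<in> S" for t
    unfolding \<rho>_def \<rho>1_def \<rho>2_def using pos[OF that] d[OF that]
    by (auto intro!: derivative_eq_intros simp: field_simps power2_eq_square power3_eq_cube)
  have \<rho>_prod: "\<rho>1 t * \<rho>2 t = 0" if "t \<in> S" for t
    using key[OF that] by (auto simp: \<rho>1_def \<rho>2_def)
  have "continuous_on S \<rho>2"
    unfolding \<rho>2_def using pos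
    by (intro continuous_intros smooth_on_imp_continuous_on \<sigma>s \<sigma>1s \<sigma>2s) force
  \<comment> \<open>A pointwise vanishing product does not select one factor globally. But where the
    second derivative is nonzero, it is so on an open set; there the first derivative vanishes
    identically, and with it the second.\<close>
  have \<rho>2_0: "\<rho>2 a = 0" if a: "a \<in> S" for a
  proof (rule ccontr)
    assume nz: "\<rho>2 a \<noteq> 0"
    define T where "T = S \<inter> \<rho>2 -` (- {0})"
    have T: "open T" "a \<in> T" "T \<subseteq> S"
      using continuous_open_preimage[OF \<open>continuous_on S \<rho>2\<close> S(1), of "- {0}"] a nz by (auto simp: T_def)
    have "\<rho>1 t = 0" if "t \<in> T" for t using \<rho>_prod[of t] that by (auto simp: T_def)
    then have "((\<lambda>_. 0) has_real_derivative \<rho>2 a) (at a)"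
      using has_field_derivative_transform_within_open[OF d\<rho>(2)[OF a] T(1,2), of "\<lambda>_. 0"] by simp
    then show False using nz DERIV_unique[OF _ DERIV_const] by blast
  qed
  have conv: "convex S" using S(2) is_interval_convex by blast
  have "(\<rho>1 has_field_derivative 0) (at t within S)" if "t \<in> S" for t
    using has_field_derivative_at_within[OF d\<rho>(2)[OF that]] \<rho>2_0[OF that] by simp
  then obtain \<alpha> where \<alpha>: "\<And>t. t \<in> S \<Longrightarrow> \<rho>1 t = \<alpha>"
    using has_field_derivative_zero_constant[OF conv] by metis
  have "((\<lambda>t. \<rho> t - \<alpha> * t) has_field_derivative 0) (at t within S)" if "t \<in> S" for t
  proof -
    have "((\<lambda>t. \<rho> t - \<alpha> * t) has_field_derivative \<rho>1 t - \<alpha>) (at t)"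
      by (auto intro!: derivative_eq_intros d\<rho>(1)[OF that])
    then show ?thesis using \<alpha>[OF that] has_field_derivative_at_within by fastforce
  qed
  then obtain \<beta> where "\<And>t. t \<in> S \<Longrightarrow> \<rho> t - \<alpha> * t = \<beta>"
    using has_field_derivative_zero_constant[OF conv] by metis
  then have \<beta>: "\<rho> t = \<alpha> * t + \<beta>" if "t \<in> S" for t using that by force
  have w\<rho>: "w t = 1 / (\<rho> t)\<^sup>2" and \<rho>_nz: "\<rho> t \<noteq> 0" if "t \<in> S" for t
    using w_eq[OF that] pos[OF that] by (auto simp: \<rho>_def power_inverse divide_inverse)
  show ?thesis
  proof (cases "\<alpha> = 0")
    case True
    then show ?thesis using w\<rho> \<beta> by auto
  next
    case False
    \<comment> \<open>The zero of the affine function \<rho>. It lies outside \<open>S\<close>,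
      since \<rho> is a reciprocal there, and \<alpha> supplies the constant 1/\<alpha>^2.\<close>
    define x0 where "x0 = - \<beta> / \<alpha>"
    have \<rho>x: "\<rho> t = \<alpha> * (t - x0)" if "t \<in> S" for t
      using \<beta>[OF that] False by (simp add: x0_def field_simps)
    have "x0 \<notin> S" using \<rho>_nz[of x0] \<rho>x[of x0] by auto
    moreover have "w t = (1 / \<alpha>\<^sup>2) / (t - x0)\<^sup>2" if "t \<in> S" for t
      using w\<rho>[OF that] \<rho>x[OF that] by (simp add: power_mult_distrib)
    moreover have "1 / \<alpha>\<^sup>2 > 0" using False by simp
    ultimately show ?thesis by blast
  qed
qed

section \<open>Global coordinates on arcs\<close>

text \<open>Gluing increments instead of values avoids adjusting the constants of the local
  functions: increments over compact subintervals are additive, and those from a base point define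
  the global function.\<close>

lemma glue_increments:
  fixes s :: "real \<Rightarrow> real \<Rightarrow> real" and J :: "real \<Rightarrow> real set" and A :: "real set"
  assumes A: "is_interval A"
    and J: "\<And>t. t \<in> A \<Longrightarrow> open (J t)" "\<And>t. t \<in> A \<Longrightarrow> is_interval (J t)" "\<And>t. t \<in> A \<Longrightarrow> t \<in> J t"
    and compat: "\<And>i j x y. i \<in> A \<Longrightarrow> j \<in> A \<Longrightarrow> x \<in> J i \<inter> J j \<Longrightarrow> y \<in> J i \<inter> J j
      \<Longrightarrow> s i x - s i y = s j x - s j y"
  obtains F where "\<And>i x y. i \<in> A \<Longrightarrow> x \<in> A \<inter> J i \<Longrightarrow> y \<in> A \<inter> J i \<Longrightarrow> F x - F y = s i x - s i y"
proof (cases "A = {}")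
  case False
  then obtain m where m: "m \<in> A" by blast
  have between: "z \<in> A" if "x \<in> A" "y \<in> A" "x \<le> z" "z \<le> y" for x y z
    using A that by (metis is_interval_1)
  have betweenJ: "z \<in> J i" if "i \<in> A" "x \<in> J i" "y \<in> J i" "x \<le> z" "z \<le> y" for i x y z
    using J(2)[OF that(1)] that by (metis is_interval_1)
  have nbhd: "\<exists>d>0. \<forall>u v. u \<le> t \<and> t \<le> v \<and> v - u < d \<longrightarrow> {u..v} \<subseteq> J t" if t: "t \<in> A" for t
  proof -
    obtain d where d: "d > 0" "ball t d \<subseteq> J t" using J(1,3)[OF t] open_contains_ball by blast
    have "{u..v} \<subseteq> J t" if "u \<le> t \<and> t \<le> v \<and> v - u < d" for u v
    proof
      fix z assume "z \<in> {u..v}"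
      then have "dist t z < d" using that by (auto simp: dist_real_def)
      then show "z \<in> J t" using d(2) by auto
    qed
    then show ?thesis using d(1) by blast
  qed
  define cp where "cp F S \<longleftrightarrow> (\<forall>i\<in>A. \<forall>x\<in>J i \<inter> S. \<forall>y\<in>J i \<inter> S. F x - F y = s i x - s i y)"
    for F :: "real \<Rightarrow> real" and S
  have cp_sub: "cp F S \<Longrightarrow> T \<subseteq> S \<Longrightarrow> cp F T" for F S T unfolding cp_def by blast
  \<comment> \<open>Bisection: the claim passes to adjoining intervals, and every sufficiently short
    interval lies in a single \<open>J t\<close>, where both functions have the increments of the
    same local one.\<close>
  have unique: "F b - F a = G b - G a"
    if ab: "a \<in> A" "b \<in> A" "a \<le> b" and FG: "cp F {a..b}" "cp G {a..b}" for a b F G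
  proof -
    have "a \<le> a \<longrightarrow> b \<le> b \<longrightarrow> F b - F a = G b - G a"
      using ab(3)
    proof (induction rule: Bolzano[where P = "\<lambda>u v. a \<le> u \<longrightarrow> v \<le> b \<longrightarrow> F v - F u = G v - G u"])
      case (trans u v z)
      then show ?case by force
    next
      case (local t)
      have t: "t \<in> A" using between[OF ab(1,2)] local by blast
      obtain d where d: "d > 0" "\<And>u v. u \<le> t \<and> t \<le> v \<and> v - u < d \<Longrightarrow> {u..v} \<subseteq> J t"
        using nbhd[OF t] by blast
      have "F v - F u = G v - G u" if "u \<le> t \<and> t \<le> v \<and> v - u < d" "a \<le> u" "v \<le> b" for u v
      proof -
        have "u \<in> J t \<inter> {a..b}" "v \<in> J t \<inter> {a..b}" using d(2)[OF that(1)] that by auto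
        then show ?thesis using FG t unfolding cp_def by metis
      qed
      then show ?case using d(1) by blast
    qed
    then show ?thesis by simp
  qed
  have ex: "\<exists>F. cp F {a..b}" if ab: "a \<in> A" "b \<in> A" "a \<le> b" for a b
  proof -
    have "a \<le> a \<longrightarrow> b \<le> b \<longrightarrow> (\<exists>F. cp F {a..b})"
      using ab(3)
    proof (induction rule: Bolzano[where P = "\<lambda>u v. a \<le> u \<longrightarrow> v \<le> b \<longrightarrow> (\<exists>F. cp F {u..v})"])
      case (trans u v z)
      show ?case
      proof (intro impI)
        assume uz: "a \<le> u" "z \<le> b"
        then obtain F G where F: "cp F {u..v}" and G: "cp G {v..z}" using trans by force
        \<comment> \<open>The right piece is shifted by a constant so that both pieces agree at the
          cut \<open>v\<close>.\<close>
        define H where "H x = (if x \<le> v then F x else G x + F v - G v)" for x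
        have H: "H x - H y = s i x - s i y"
          if i: "i \<in> A" and x: "x \<in> J i \<inter> {u..z}" and y: "y \<in> J i \<inter> {u..z}" and xy: "y \<le> x" for i x y
        proof -
          consider "x \<le> v" | "y > v" | "y \<le> v" "v < x" by linarith
          then show ?thesis
          proof cases
            case 1
            then have "F x - F y = s i x - s i y" using F i x y xy unfolding cp_def by auto
            then show ?thesis using 1 xy by (simp add: H_def)
          next
            case 2
            then have "G x - G y = s i x - s i y" using G i x y xy unfolding cp_def by auto
            then show ?thesis using 2 xy by (simp add: H_def)
          next
            \<comment> \<open>An interval \<open>J i\<close> that reaches both sides of
              \<open>v\<close> contains \<open>v\<close>, so the increment can be split
              there.\<close>
            case 3
            then have v: "v \<in> J i" using betweenJ[OF i, of y x v] x y by simp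
            have "F v - F y = s i v - s i y" using F i v y 3 unfolding cp_def by auto
            moreover have "G x - G v = s i x - s i v" using G i v x 3 unfolding cp_def by auto
            ultimately show ?thesis using 3 by (simp add: H_def)
          qed
        qed
        have "cp H {u..z}"
          unfolding cp_def
        proof (intro ballI)
          fix i x y assume "i \<in> A" "x \<in> J i \<inter> {u..z}" "y \<in> J i \<inter> {u..z}"
          then show "H x - H y = s i x - s i y" using H[of i x y] H[of i y x] by linarith
        qed
        then show "\<exists>F. cp F {u..z}" by blast
      qed
    next
      case (local t)
      have t: "t \<in> A" using between[OF ab(1,2)] local by blast
      obtain d where d: "d > 0" "\<And>u v. u \<le> t \<and> t \<le> v \<and> v - u < d \<Longrightarrow> {u..v} \<subseteq> J t"
        using nbhd[OF t] by blast
      have "cp (s t) {u..v}" if "u \<le> t \<and> t \<le> v \<and> v - u < d" for u v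
        using d(2)[OF that] compat[OF t] unfolding cp_def by blast
      then show ?case using d(1) by blast
    qed
    then show ?thesis by simp
  qed
  \<comment> \<open>The chosen function is determined up to a constant, so its increment does not
    depend on the choice.\<close>
  define \<Delta> where "\<Delta> a b = (SOME F. cp F {a..b}) b - (SOME F. cp F {a..b}) a" for a b
  have \<Delta>_eq: "\<Delta> a b = F b - F a" if "a \<in> A" "b \<in> A" "a \<le> b" "cp F {a..b}" for a b F
    unfolding \<Delta>_def by (rule unique[OF that(1-3) someI_ex[OF ex[OF that(1-3)]] that(4)])
  have \<Delta>_add: "\<Delta> a c = \<Delta> a b + \<Delta> b c" if abc: "a \<in> A" "c \<in> A" "a \<le> b" "b \<le> c" for a b c
  proof -
    have b: "b \<in> A" using between abc by blast
    obtain F where F: "cp F {a..c}" using ex[OF abc(1,2)] abc by force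
    have "cp F {a..b}" "cp F {b..c}" using cp_sub[OF F] abc by auto
    then show ?thesis using \<Delta>_eq[of a c F] \<Delta>_eq[of a b F] \<Delta>_eq[of b c F] F abc b by simp
  qed
  define F where "F x = (if m \<le> x then \<Delta> m x else - \<Delta> x m)" for x
  have step: "F x - F y = s i x - s i y" if i: "i \<in> A" and xy: "x \<in> A \<inter> J i" "y \<in> A \<inter> J i" "y \<le> x" for i x y
  proof -
    obtain G where G: "cp G {y..x}" using ex xy by blast
    have "F x - F y = \<Delta> y x"
      using \<Delta>_add[of m x y] \<Delta>_add[of y x m] \<Delta>_add[of y m x] m xy by (auto simp: F_def)
    also have "\<dots> = G x - G y" using \<Delta>_eq[OF _ _ _ G] xy by blast
    also have "\<dots> = s i x - s i y" using G i xy unfolding cp_def by auto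
    finally show ?thesis .
  qed
  have "F x - F y = s i x - s i y" if "i \<in> A" "x \<in> A \<inter> J i" "y \<in> A \<inter> J i" for i x y
    using step[of i x y] step[of i y x] that by linarith
  then show ?thesis using that by blast
qed (use that in blast)

lemma less_of_locally_strict_mono:
  fixes F :: "real \<Rightarrow> real"
  assumes "a < b"
    and "\<And>t. a \<le> t \<Longrightarrow> t \<le> b \<Longrightarrow> \<exists>d>0. \<forall>u v. u < v \<and> a \<le> u \<and> v \<le> b \<and> u \<le> t \<and> t \<le> v \<and> v - u < d \<longrightarrow> F u < F v"
  shows "F a < F b"
proof -
  have "a \<le> a \<longrightarrow> b \<le> b \<longrightarrow> a < b \<longrightarrow> F a < F b"
    using less_imp_le[OF assms(1)]
  proof (induction rule: Bolzano[where P = "\<lambda>u v. a \<le> u \<longrightarrow> v \<le> b \<longrightarrow> u < v \<longrightarrow> F u < F v"])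
    case (trans u v z)
    then show ?case by (cases "u = v"; cases "v = z") force+
  next
    case (local t)
    then show ?case using assms(2) by blast
  qed
  then show ?thesis using assms(1) by simp
qed

lemma components_real: "components c v = v (snd c)" for c :: "('a, real) chart"
  by (simp add: components_def)

section \<open>One-dimensional manifolds and their global charts\<close>

locale curve = smooth_mfd N
  for N :: "('a::{t2_space, second_countable_topology}, real) manifold"
begin

lemma coord_vec_scale:
  assumes "adm c" "p \<in> fst c"
  shows "coord_vec N c a p f = a * coord_vec N c 1 p f"
  using linear_cmul[OF coord_vec_linear[OF assms], of a 1] by simp

lemma tangent_real:
  assumes "adm c" "p \<in> fst c" "v \<in> tangent_space N p"
  shows "v = (\<lambda>f. v (snd c) * coord_vec N c 1 p f)"
proof
  fix f
  have "v f = coord_vec N c (components c v) p f"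
    using arg_cong[OF tangent_eq_coord_vec[OF assms], of "\<lambda>v. v f"] .
  then show "v f = v (snd c) * coord_vec N c 1 p f"
    unfolding coord_vec_scale[OF assms(1,2), of "components c v"] unfolding components_real .
qed

lemma coord_vec_real_derivative:
  assumes "adm c" "p \<in> fst c" "smooth_near N p f"
  shows "((\<lambda>x. f (chart_inv c x)) has_real_derivative coord_vec N c 1 p f) (at (snd c p))"
proof -
  have "(\<lambda>u. coord_vec N c u p f) = (*) (coord_vec N c 1 p f)"
    by (rule ext) (metis coord_vec_scale[OF assms(1,2)] mult.commute)
  then show ?thesis
    using coord_vec_has_derivative[OF assms] by (simp add: has_field_derivative_def)
qed

lemma coord_vec_realI:
  assumes "adm c" "p \<in> fst c" "smooth_near N p f"
    and "((\<lambda>x. f (chart_inv c x)) has_real_derivative d) (at (snd c p))"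
  shows "coord_vec N c 1 p f = d"
  using DERIV_unique[OF coord_vec_real_derivative[OF assms(1-3)] assms(4)] .

lemma coord_vec_chart: "adm c \<Longrightarrow> p \<in> fst c \<Longrightarrow> coord_vec N c u p (snd c) = u"
  using components_coord_vec[of c p u] by (simp add: components_real)

lemma smooth_near_chart: "adm c \<Longrightarrow> p \<in> fst c \<Longrightarrow> smooth_near N p (snd c)"
  using smooth_near_coordinate[of c p 1] by simp

text \<open>\<open>h\<close> is smooth on \<open>T\<close> only, so continuity of \<open>z\<close>
  in a chart must first provide a neighbourhood of \<open>p\<close> that \<open>z\<close> maps into
  \<open>T\<close>.\<close>

lemma tangent_chain:
  fixes h :: "real \<Rightarrow> real"
  assumes v: "v \<in> tangent_space N p" and z: "smooth_near N p z"
    and T: "open T" "smooth_on T h" "z p \<in> T" and h: "(h has_real_derivative d) (at (z p))"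
  shows "smooth_near N p (\<lambda>q. h (z q))" and "v (\<lambda>q. h (z q)) = d * v z"
proof -
  obtain c u where c: "c \<in> charts N" "adm c" "p \<in> fst c" "v = coord_vec N c u p"
    using tangent_obtain[OF v] by metis
  obtain W where W: "open_in N W" "p \<in> W" "smooth_fun N W z" using z by (auto simp: smooth_near_def)
  have "smooth_on (snd c ` (fst c \<inter> W)) (\<lambda>x. z (chart_inv c x))"
    using chart_smooth_of_smooth_fun[OF c(2) W(1,3)] by (simp add: chart_smooth_def)
  then have cont: "continuous_on (snd c ` (fst c \<inter> W)) (\<lambda>x. z (chart_inv c x))"
    by (rule smooth_on_imp_continuous_on)
  define O' where "O' = snd c ` (fst c \<inter> W) \<inter> (\<lambda>x. z (chart_inv c x)) -` T"
  have O': "open O'"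
    unfolding O'_def by (rule continuous_open_preimage[OF cont chart_image_open[OF c(2) W(1)] T(1)])
  define V where "V = {q \<in> fst c \<inter> W. snd c q \<in> O'}"
  have V: "open_in N V" unfolding V_def by (rule chart_preimage_open[OF c(2) O' W(1)])
  have inv: "chart_inv c (snd c q) = q" if "q \<in> fst c" for q using admissible_chartD(7)[OF c(2) that] .
  have pV: "p \<in> V" using c(3) W(2) T(3) inv[OF c(3)] by (auto simp: V_def O'_def)
  have zV: "z ` V \<subseteq> T"
  proof (rule image_subsetI)
    fix q assume "q \<in> V"
    then have "snd c q \<in> O'" "q \<in> fst c" by (auto simp: V_def)
    then show "z q \<in> T" using inv unfolding O'_def by (metis IntD2 vimageD)
  qed
  have "smooth_fun N V (\<lambda>q. h (z q))"
    by (rule smooth_fun_compose[OF V smooth_fun_subset[OF W(3)] T(1) zV T(2)]) (auto simp: V_def)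
  then show near: "smooth_near N p (\<lambda>q. h (z q))" using smooth_nearI[OF V pV] by blast
  have "((\<lambda>x. h (z (chart_inv c x))) has_real_derivative d * coord_vec N c 1 p z) (at (snd c p))"
    by (rule DERIV_chain2[where f = h and g = "\<lambda>x. z (chart_inv c x)", OF _ coord_vec_real_derivative[OF c(2,3) z]])
      (simp add: inv[OF c(3)] h)
  from coord_vec_realI[OF c(2,3) near this] show "v (\<lambda>q. h (z q)) = d * v z"
    unfolding c(4) coord_vec_scale[OF c(2,3), of u] by simp
qed

text \<open>Invariance of domain, applied to \<open>z\<close> in the arc parameter, makes the image
  open and the inverse continuous. The nonzero derivative is what makes the transitions from
  \<open>z\<close> back to the atlas smooth.\<close>

lemma admissible_global_chart:
  assumes arc: "homeomorphism (pts N) {0<..<1::real} h hi"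
    and z: "smooth_fun N (pts N) z" "inj_on z (pts N)"
    and nz: "\<And>c p. c \<in> charts N \<Longrightarrow> p \<in> fst c \<Longrightarrow> coord_vec N c 1 p z \<noteq> 0"
  shows "adm (pts N, z)"
proof -
  let ?U = "pts N"
  have near: "smooth_near N p z" if "p \<in> ?U" for p using smooth_nearI[OF open_pts that z(1)] .
  have cont: "continuous_on ?U z"
    unfolding continuous_openin_preimage_eq
  proof (intro allI impI)
    fix T :: "real set" assume T: "open T"
    show "open_in N (?U \<inter> z -` T)"
    proof (rule openin_local)
      fix p assume p: "p \<in> ?U \<inter> z -` T"
      then obtain c where c: "c \<in> charts N" "adm c" "p \<in> fst c" using obtain_chart by blast
      note inv = admissible_chartD(7)[OF c(2)]
      have "chart_smooth c (fst c) z"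
        using chart_smooth_subset[of c ?U z] z(1) c(1) admissible_chartD(6)[OF c(2)] by (simp add: smooth_fun_def')
      then have "continuous_on (snd c ` fst c) (\<lambda>x. z (chart_inv c x))"
        by (simp add: chart_smooth_def smooth_on_imp_continuous_on)
      then have o: "open (snd c ` fst c \<inter> (\<lambda>x. z (chart_inv c x)) -` T)" (is "open ?O")
        using admissible_chartD(2)[OF c(2)] T by (rule continuous_open_preimage)
      have "open_in N {q \<in> fst c \<inter> ?U. snd c q \<in> ?O}" by (rule chart_preimage_open[OF c(2) o open_pts])
      moreover have "p \<in> {q \<in> fst c \<inter> ?U. snd c q \<in> ?O}" using p c(3) inv by auto
      moreover have "{q \<in> fst c \<inter> ?U. snd c q \<in> ?O} \<subseteq> ?U \<inter> z -` T"
      proof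
        fix q assume "q \<in> {q \<in> fst c \<inter> ?U. snd c q \<in> ?O}"
        then have "q \<in> fst c" "q \<in> ?U" "snd c q \<in> ?O" by blast+
        then show "q \<in> ?U \<inter> z -` T" using inv by (metis IntD2 IntI vimageD vimageI)
      qed
      ultimately show "\<exists>V. open_in N V \<and> p \<in> V \<and> V \<subseteq> ?U \<inter> z -` T" by blast
    qed
  qed
  have hi: "hi ` {0<..<1} = ?U" "continuous_on {0<..<1} hi" "\<And>t. t \<in> {0<..<1} \<Longrightarrow> h (hi t) = t"
    using arc by (auto simp: homeomorphism_def)
  let ?f = "\<lambda>t. z (hi t)"
  have f: "continuous_on {0<..<1} ?f" "inj_on ?f {0<..<1}" "?f ` {0<..<1} = z ` ?U"
  proof -
    show "continuous_on {0<..<1} ?f" by (rule continuous_on_compose2[OF cont hi(2)]) (use hi(1) in auto)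
    show "inj_on ?f {0<..<1}"
      using hi(1,3) z(2) by (intro inj_onI) (metis (full_types) imageI inj_onD)
    show "?f ` {0<..<1} = z ` ?U" using hi(1) by (metis image_image)
  qed
  obtain k where k: "homeomorphism {0<..<1} (z ` ?U) ?f k"
    using invariance_of_domain_homeomorphism[OF open_greaterThanLessThan f(1) _ f(2)] f(3) by auto
  have open_z: "open (z ` ?U)" using invariance_of_domain[OF f(1) open_greaterThanLessThan f(2)] f(3) by simp
  have zi: "inv_into ?U z (z p) = p" if "p \<in> ?U" for p using inv_into_f_f[OF z(2) that] .
  have "continuous_on (z ` ?U) (\<lambda>x. hi (k x))"
    by (rule continuous_on_compose2[OF hi(2)]) (use k in \<open>auto simp: homeomorphism_def\<close>)
  moreover have "hi (k x) = inv_into ?U z x" if x: "x \<in> z ` ?U" for x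
  proof -
    have "k x \<in> {0<..<1}" "z (hi (k x)) = x" using k x by (auto simp: homeomorphism_def)
    moreover from this(1) have "hi (k x) \<in> ?U" using hi(1) by blast
    ultimately show ?thesis using zi[of "hi (k x)"] by simp
  qed
  ultimately have cont_inv: "continuous_on (z ` ?U) (inv_into ?U z)"
    by (rule continuous_on_eq)
  have hom: "homeomorphism ?U (z ` ?U) z (inv_into ?U z)"
    using cont cont_inv zi by (auto simp: homeomorphism_def image_iff)
  have "transition_smooth (?U, z) c \<and> transition_smooth c (?U, z)" if c: "c \<in> charts N" for c
  proof
    have ca: "adm c" using charts_adm[OF c] .
    note inv = admissible_chartD(7)[OF ca]
    have sub: "fst c \<subseteq> ?U" using admissible_chartD(6)[OF ca] .
    show "transition_smooth c (?U, z)"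
      using z(1) c by (simp add: transition_smooth_iff smooth_fun_def')
    have "openin (top_of_set (z ` ?U)) (z ` fst c)"
      by (rule homeomorphism_imp_open_map[OF hom admissible_chartD(1)[OF ca]])
    then have T: "open (z ` fst c)" using open_z openin_open_eq by blast
    have "chart_smooth c (fst c) z"
      using chart_smooth_subset[of c ?U z] z(1) c sub by (simp add: smooth_fun_def')
    then have fs: "smooth_on (snd c ` fst c) (\<lambda>x. z (chart_inv c x))" by (simp add: chart_smooth_def)
    have "smooth_on (z ` fst c) (\<lambda>x. snd c (inv_into ?U z x))"
    proof (rule smooth_on_inverse_function[OF admissible_chartD(2)[OF ca] T fs])
      show "frechet_derivative (\<lambda>x. z (chart_inv c x)) (at x) 1 \<noteq> 0" if x: "x \<in> snd c ` fst c" for x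
      proof -
        obtain p where p: "p \<in> fst c" "x = snd c p" using x by blast
        then show ?thesis using nz[OF c p(1)] near[of p] sub by (auto simp: coord_vec_apply)
      qed
      have c1: "continuous_on (z ` fst c) (inv_into ?U z)" using cont_inv sub by (rule continuous_on_subset[OF _ image_mono])
      show "continuous_on (z ` fst c) (\<lambda>x. snd c (inv_into ?U z x))"
        by (rule continuous_on_compose2[OF admissible_chartD(4)[OF ca] c1]) (use zi sub in auto)
      show "(\<lambda>x. snd c (inv_into ?U z x)) ` z ` fst c \<subseteq> snd c ` fst c" using zi sub by auto
      show "z (chart_inv c (snd c (inv_into ?U z y))) = y" if "y \<in> z ` fst c" for y
        using that zi sub inv by auto
    qed
    moreover have "?U \<inter> fst c = fst c" using sub by blast
    ultimately show "transition_smooth (?U, z) c" by (simp add: transition_smooth_iff chart_smooth_def)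
  qed
  then show ?thesis using hom open_z by (simp add: admissible_chart_def)
qed

end

section \<open>Arc length as a global coordinate\<close>

locale riemannian_arc = curve N
  for N :: "('a::{t2_space, second_countable_topology}, real) manifold" +
  fixes g :: "'a metric" and h :: "'a \<Rightarrow> real" and hi :: "real \<Rightarrow> 'a"
  assumes metric: "riemannian_metric N g"
    and arc: "homeomorphism (pts N) {0<..<1} h hi"
begin

text \<open>The linearity axiom couples scaling with addition; adding the zero vector separates
  them, once that vector is seen to pair to 0.\<close>

lemma metric_scale:
  assumes "u \<in> tangent_space N p" "v \<in> tangent_space N p"
  shows "g p (\<lambda>f. a * u f) v = a * g p u v"
proof -
  have p: "p \<in> pts N" using tangent_in_pts[OF assms(1)] .
  have lin: "g p (\<lambda>f. a * u f + v f) w = a * g p u w + g p v w"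
    if "u \<in> tangent_space N p" "v \<in> tangent_space N p" "w \<in> tangent_space N p" for u v w a
    using metric p that unfolding riemannian_metric_def by blast
  note z = tangent_zero[OF p]
  have "g p (\<lambda>f. 0) v = 0" using lin[OF z z assms(2), of 1] by simp
  then show ?thesis using lin[OF assms(1) z assms(2), of a] by simp
qed

lemma metric_sym:
  assumes "u \<in> tangent_space N p" "v \<in> tangent_space N p"
  shows "g p u v = g p v u"
  using metric tangent_in_pts[OF assms(1)] assms unfolding riemannian_metric_def by blast

text \<open>The coefficient w in g = w dx^2, as a function of the point.\<close>

definition weight :: "('a, real) chart \<Rightarrow> 'a \<Rightarrow> real" where
  "weight c p = g p (coord_vec N c 1 p) (coord_vec N c 1 p)"

lemma weight_pos:
  assumes "adm c" "p \<in> fst c"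
  shows "weight c p > 0"
proof -
  have "coord_vec N c 1 p \<noteq> (\<lambda>_. 0)" using coord_vec_chart[OF assms, of 1] by auto
  moreover have "p \<in> pts N" using assms admissible_chartD(6) by blast
  ultimately show ?thesis
    unfolding weight_def
    using metric[unfolded riemannian_metric_def, THEN conjunct1] coord_vec_in_tangent[OF assms, of 1] by blast
qed

lemma weight_smooth:
  assumes "adm c"
  shows "smooth_fun N (fst c) (weight c)"
  using metric[unfolded riemannian_metric_def, THEN conjunct2, THEN spec, THEN mp,
      OF admissible_chartD(1)[OF assms], THEN bspec, OF coord_vec_vfield[OF assms],
      THEN bspec, OF coord_vec_vfield[OF assms], of 1 1]
  by (simp add: weight_def[abs_def])

lemma metric_eq_weight:
  assumes "adm c" "p \<in> fst c" "v \<in> tangent_space N p"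
  shows "g p v v = (v (snd c))\<^sup>2 * weight c p"
proof -
  define u where "u = coord_vec N c 1 p"
  have u: "u \<in> tangent_space N p" unfolding u_def using coord_vec_in_tangent[OF assms(1,2)] .
  have v: "v = (\<lambda>f. v (snd c) * u f)" unfolding u_def by (rule tangent_real[OF assms])
  have "g p v v = v (snd c) * g p u v" by (subst v) (rule metric_scale[OF u assms(3)])
  also have "g p u v = g p v u" by (rule metric_sym[OF u assms(3)])
  also have "\<dots> = v (snd c) * g p u u" by (subst v) (rule metric_scale[OF u u])
  finally show ?thesis by (simp add: weight_def u_def power2_eq_square)
qed

lemma hi: "hi ` {0<..<1} = pts N" "continuous_on {0<..<1} hi" "\<And>t. t \<in> {0<..<1} \<Longrightarrow> h (hi t) = t"
  "\<And>p. p \<in> pts N \<Longrightarrow> hi (h p) = p" "\<And>p. p \<in> pts N \<Longrightarrow> h p \<in> {0<..<1}"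
  using arc by (auto simp: homeomorphism_def)

lemma open_arc_image:
  assumes "open J" "J \<subseteq> {0<..<1}"
  shows "open_in N (hi ` J)"
  by (rule homeomorphism_imp_open_map[OF homeomorphism_symD[OF arc]])
    (use assms in \<open>simp add: openin_open_eq\<close>)

text \<open>Increasing functions on subarcs whose derivative along unit vectors is \<open>\<plusminus>1\<close>. Any two of them
  differ by a constant, so the local ones glue to a global coordinate.\<close>

definition unit_function :: "real set \<Rightarrow> ('a \<Rightarrow> real) \<Rightarrow> bool" where
  "unit_function J \<sigma> \<longleftrightarrow> open J \<and> is_interval J \<and> J \<subseteq> {0<..<1} \<and>
     strict_mono_on J (\<lambda>t. \<sigma> (hi t)) \<and> smooth_fun N (hi ` J) \<sigma> \<and>
     (\<forall>q\<in>hi ` J. \<forall>v\<in>tangent_space N q. (v \<sigma>)\<^sup>2 = g q v v)"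

lemma unit_function_near:
  assumes "unit_function J \<sigma>" "q \<in> hi ` J"
  shows "smooth_near N q \<sigma>"
  using assms smooth_nearI[OF open_arc_image, of J q \<sigma>] unfolding unit_function_def by blast

text \<open>In a chart an antiderivative of the square root of the weight has unit speed. The sign
  makes it increase with the arc parameter, whichever way the chart runs.\<close>

lemma unit_function_exists:
  assumes t0: "t0 \<in> {0<..<1}"
  shows "\<exists>J \<sigma>. t0 \<in> J \<and> unit_function J \<sigma>"
proof -
  obtain c where c: "c \<in> charts N" "adm c" "hi t0 \<in> fst c"
    using obtain_chart hi(1) t0 by (metis imageI)
  note inv = admissible_chartD(7)[OF c(2)]
  have "openin (top_of_set {0<..<1}) (h ` fst c)"
    by (rule homeomorphism_imp_open_map[OF arc admissible_chartD(1)[OF c(2)]])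
  then have "open (h ` fst c)" using openin_open_eq[OF open_greaterThanLessThan] by blast
  moreover have "t0 \<in> h ` fst c" using c(3) hi(3)[OF t0] by (metis imageI)
  ultimately obtain e where e: "e > 0" "ball t0 e \<subseteq> h ` fst c" using open_contains_ball by blast
  define J where "J = ball t0 e"
  have J: "open J" "is_interval J" "t0 \<in> J" "J \<subseteq> {0<..<1}" "hi ` J \<subseteq> fst c"
  proof -
    show "open J" "t0 \<in> J" using e(1) by (auto simp: J_def)
    show "is_interval J" unfolding J_def by (rule is_interval_ball_real)
    have "h ` fst c \<subseteq> {0<..<1}" using hi(5) admissible_chartD(6)[OF c(2)] by blast
    then show "J \<subseteq> {0<..<1}" using e(2) unfolding J_def by blast
    show "hi ` J \<subseteq> fst c"
    proof
      fix q assume "q \<in> hi ` J"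
      then obtain p where "p \<in> fst c" "q = hi (h p)" using e(2) by (auto simp: J_def)
      then show "q \<in> fst c" using hi(4) admissible_chartD(6)[OF c(2)] by auto
    qed
  qed
  have O: "open_in N (hi ` J)" using open_arc_image[OF J(1,4)] .
  define f where "f t = snd c (hi t)" for t
  have f_cont: "continuous_on J f"
    unfolding f_def
    by (rule continuous_on_compose2[OF admissible_chartD(4)[OF c(2)] continuous_on_subset[OF hi(2) J(4)] J(5)])
  have f_inj: "inj_on f J"
  proof (rule inj_onI)
    fix x y assume "x \<in> J" "y \<in> J" "f x = f y"
    then have "hi x = hi y" using inv J(5) unfolding f_def by (metis image_subset_iff)
    then show "x = y" using hi(3) J(4) \<open>x \<in> J\<close> \<open>y \<in> J\<close> by (metis subsetD)
  qed
  define S where "S = snd c ` (fst c \<inter> hi ` J)"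
  have S_eq: "S = f ` J" using J(5) unfolding S_def f_def by (auto simp: image_image Int_absorb1)
  have S: "open S" "is_interval S"
    unfolding S_def using chart_image_open[OF c(2) O] 
    by (simp, use S_eq[unfolded S_def] connected_continuous_image[OF f_cont] J(2) is_interval_connected_1 in metis)
  have "smooth_on (snd c ` fst c) (\<lambda>x. weight c (chart_inv c x))"
    using chart_smooth_of_smooth_fun[OF c(2) admissible_chartD(1)[OF c(2)] weight_smooth[OF c(2)]]
    by (simp add: chart_smooth_def)
  then have ws: "smooth_on S (\<lambda>x. weight c (chart_inv c x))"
    by (rule smooth_on_subset) (auto simp: S_def)
  have wpos: "weight c (chart_inv c x) > 0" if "x \<in> S" for x
    using that weight_pos[OF c(2)] inv by (auto simp: S_def)
  define r where "r x = sqrt (weight c (chart_inv c x))" for x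
  have "(\<lambda>x. weight c (chart_inv c x)) ` S \<subseteq> {0<..}" using wpos by auto
  from smooth_on_compose[OF S(1) _ this ws smooth_on_sqrt]
  have rs: "smooth_on S r" by (simp add: r_def[abs_def])
  obtain A where A: "\<And>x. x \<in> S \<Longrightarrow> (A has_real_derivative r x) (at x)"
    using antiderivative_on_open_interval[OF S smooth_on_imp_continuous_on[OF rs]] by blast
  have A_mono: "strict_mono_on S A"
    using strict_mono_on_interval_deriv_pos[OF S(2) A] wpos by (simp add: r_def)
  have As: "smooth_on S A"
    by (rule smooth_on_antiderivative[OF S(1) _ rs]) (simp add: A has_real_derivative_iff_has_vector_derivative[symmetric])
  obtain \<epsilon> :: real where \<epsilon>: "\<epsilon> = 1 \<or> \<epsilon> = -1" "strict_mono_on J (\<lambda>t. \<epsilon> * A (f t))"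
  proof -
    have fS: "f t \<in> S" if "t \<in> J" for t using that S_eq by blast
    consider "strict_mono_on J f" | "strict_antimono_on J f"
      using injective_eq_monotone_map[OF J(2) f_cont] f_inj by blast
    then show ?thesis
    proof cases
      case 1
      have "strict_mono_on J (\<lambda>t. 1 * A (f t))"
        using strict_mono_onD[OF A_mono fS fS] strict_mono_onD[OF 1] by (intro strict_mono_onI) auto
      then show ?thesis using that by blast
    next
      case 2
      then have "f y < f x" if "x \<in> J" "y \<in> J" "x < y" for x y
        using that by (auto simp: monotone_on_def)
      then have "strict_mono_on J (\<lambda>t. (-1) * A (f t))"
        using strict_mono_onD[OF A_mono fS fS] by (intro strict_mono_onI) auto
      then show ?thesis using that by blast
    qed
  qed
  define \<sigma> where "\<sigma> q = \<epsilon> * A (snd c q)" for q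
  have "chart_smooth c (hi ` J) (\<lambda>q. A (snd c q))"
    by (rule chart_smooth_post[OF c(2) O chart_smooth_self[OF c(2) O] S(1) _ As]) (use J(5) in \<open>auto simp: S_def\<close>)
  then have "chart_smooth c (hi ` J) \<sigma>"
    unfolding \<sigma>_def using chart_smooth_mult[OF c(2) O chart_smooth_const[OF c(2) O]] by blast
  then have \<sigma>_smooth: "smooth_fun N (hi ` J) \<sigma>"
    by (rule smooth_fun_of_chart_smooth[OF c(2) O J(5)])
  have "(v \<sigma>)\<^sup>2 = g q v v" if q: "q \<in> hi ` J" and v: "v \<in> tangent_space N q" for q v
  proof -
    have qc: "q \<in> fst c" using q J(5) by blast
    have xS: "snd c q \<in> S" using q qc by (auto simp: S_def)
    have "((\<lambda>x. \<epsilon> * A x) has_real_derivative \<epsilon> * r (snd c q)) (at (snd c q))"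
      by (rule DERIV_cmult[OF A[OF xS]])
    from tangent_chain(2)[OF v smooth_near_chart[OF c(2) qc] S(1) smooth_on_mult[OF S(1) smooth_on_const[OF S(1)] As] xS this]
    have "v \<sigma> = \<epsilon> * r (snd c q) * v (snd c)" by (simp add: \<sigma>_def[abs_def])
    then have "(v \<sigma>)\<^sup>2 = (v (snd c))\<^sup>2 * weight c q"
      using \<epsilon>(1) weight_pos[OF c(2) qc] inv[OF qc] by (auto simp: r_def power_mult_distrib)
    then show ?thesis using metric_eq_weight[OF c(2) qc v] by simp
  qed
  moreover have "strict_mono_on J (\<lambda>t. \<sigma> (hi t))" using \<epsilon>(2) by (simp add: \<sigma>_def f_def)
  ultimately have "unit_function J \<sigma>" unfolding unit_function_def using J \<sigma>_smooth by blast
  then show ?thesis using J(3) by blast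
qed

text \<open>A short step to the right in the chart would raise \<sigma>1 and lower \<sigma>2,
  although both increase with the arc parameter.\<close>

lemma unit_function_same_sign:
  assumes u1: "unit_function J1 \<sigma>1" and u2: "unit_function J2 \<sigma>2" and q: "q \<in> hi ` (J1 \<inter> J2)"
    and c: "adm c" "q \<in> fst c" and pos: "coord_vec N c 1 q \<sigma>1 > 0" and neg: "coord_vec N c 1 q \<sigma>2 < 0"
  shows False
proof -
  have J: "J1 \<inter> J2 \<subseteq> {0<..<1}" "open (J1 \<inter> J2)" using u1 u2 by (auto simp: unit_function_def)
  have O: "open_in N (hi ` (J1 \<inter> J2))" using open_arc_image[OF J(2,1)] .
  define S where "S = snd c ` (fst c \<inter> hi ` (J1 \<inter> J2))"
  have S: "open S" unfolding S_def using chart_image_open[OF c(1) O] .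
  let ?x = "snd c q"
  note inv = admissible_chartD(7)[OF c(1)]
  have "?x \<in> S" using q c(2) by (auto simp: S_def)
  then obtain e where e: "e > 0" "ball ?x e \<subseteq> S" using S open_contains_ball by blast
  have near: "smooth_near N q \<sigma>1" "smooth_near N q \<sigma>2"
    using unit_function_near u1 u2 q by blast+
  obtain d1 where d1: "d1 > 0" "\<And>k. k > 0 \<Longrightarrow> k < d1 \<Longrightarrow> \<sigma>1 (chart_inv c ?x) < \<sigma>1 (chart_inv c (?x + k))"
    using DERIV_pos_inc_right[OF coord_vec_real_derivative[OF c near(1)] pos] by blast
  obtain d2 where d2: "d2 > 0" "\<And>k. k > 0 \<Longrightarrow> k < d2 \<Longrightarrow> \<sigma>2 (chart_inv c ?x) > \<sigma>2 (chart_inv c (?x + k))"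
    using DERIV_neg_dec_right[OF coord_vec_real_derivative[OF c near(2)] neg] by blast
  define k where "k = min e (min d1 d2) / 2"
  have k: "k > 0" "k < e" "k < d1" "k < d2" using e d1 d2 by (auto simp: k_def)
  have "?x + k \<in> S" using e(2) k by (auto simp: ball_def dist_real_def subset_iff)
  then obtain t' where t': "t' \<in> J1 \<inter> J2" "chart_inv c (?x + k) = hi t'"
    unfolding S_def using inv by auto
  obtain t where t: "t \<in> J1 \<inter> J2" "q = hi t" using q by blast
  have "\<sigma>1 (hi t) < \<sigma>1 (hi t')" "\<sigma>2 (hi t') < \<sigma>2 (hi t)"
    using d1(2)[OF k(1,3)] d2(2)[OF k(1,4)] t(2) t'(2) inv[OF c(2)] by auto
  moreover have "strict_mono_on J1 (\<lambda>t. \<sigma>1 (hi t))" "strict_mono_on J2 (\<lambda>t. \<sigma>2 (hi t))"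
    using u1 u2 by (auto simp: unit_function_def)
  ultimately have "t < t'" "t' < t"
    using strict_mono_on_less[of J1 "\<lambda>t. \<sigma>1 (hi t)" t t'] strict_mono_on_less[of J2 "\<lambda>t. \<sigma>2 (hi t)" t' t] t(1) t'(1)
    by auto
  then show False by simp
qed

text \<open>Along a coordinate vector both derivatives square to the weight, so they agree up to
  sign, and the orientation rules out opposite signs. The difference is then locally constant on the
  connected overlap.\<close>

lemma unit_function_difference:
  assumes u1: "unit_function J1 \<sigma>1" and u2: "unit_function J2 \<sigma>2"
    and x: "x \<in> J1 \<inter> J2" and y: "y \<in> J1 \<inter> J2"
  shows "\<sigma>1 (hi x) - \<sigma>1 (hi y) = \<sigma>2 (hi x) - \<sigma>2 (hi y)"
proof -
  let ?K = "J1 \<inter> J2"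
  let ?A = "hi ` ?K"
  have J: "?K \<subseteq> {0<..<1}" "open ?K" "is_interval ?K"
    using u1 u2 by (auto simp: unit_function_def intro: is_interval_Int)
  have O: "open_in N ?A" using open_arc_image[OF J(2,1)] .
  have conn: "connected ?A"
    using connected_continuous_image[OF continuous_on_subset[OF hi(2) J(1)]] J(3) is_interval_connected_1 by blast
  have same: "coord_vec N c 1 q \<sigma>1 = coord_vec N c 1 q \<sigma>2" if c: "adm c" "q \<in> fst c" and q: "q \<in> ?A" for c q
  proof -
    define a where "a = coord_vec N c 1 q \<sigma>1"
    define b where "b = coord_vec N c 1 q \<sigma>2"
    have t: "coord_vec N c 1 q \<in> tangent_space N q" using coord_vec_in_tangent[OF c] .
    have sq: "a\<^sup>2 = weight c q" "b\<^sup>2 = weight c q"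
      using u1 u2 q t unfolding unit_function_def weight_def a_def b_def by blast+
    have "\<not> (a > 0 \<and> b < 0)"
      unfolding a_def b_def using unit_function_same_sign[OF u1 u2 q c] by blast
    moreover have "\<not> (b > 0 \<and> a < 0)"
      unfolding a_def b_def using unit_function_same_sign[OF u2 u1 _ c] q by (auto simp: Int_commute)
    moreover have "a = b \<or> a = - b" using sq by (metis power2_eq_iff)
    moreover have "a \<noteq> 0" using sq(1) weight_pos[OF c] by auto
    ultimately have "a = b" by linarith
    then show ?thesis by (simp add: a_def b_def)
  qed
  let ?D = "\<lambda>q. \<sigma>1 q - \<sigma>2 q"
  have "?D (hi x) = ?D (hi y)"
  proof (rule connected_local_const[OF conn])
    show "hi x \<in> ?A" "hi y \<in> ?A" using x y by blast+
    show "\<forall>q\<in>?A. \<forall>\<^sub>F b in at q within ?A. ?D q = ?D b"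
    proof
      fix q assume q: "q \<in> ?A"
      obtain c where c: "c \<in> charts N" "adm c" "q \<in> fst c" using obtain_chart[OF open_in_pts[OF O q]] by metis
      note inv = admissible_chartD(7)[OF c(2)]
      define S where "S = snd c ` (fst c \<inter> ?A)"
      have S: "open S" unfolding S_def using chart_image_open[OF c(2) O] .
      have "snd c q \<in> S" using q c(3) by (auto simp: S_def)
      then obtain e where e: "e > 0" "ball (snd c q) e \<subseteq> S" using S open_contains_ball by blast
      have d: "((\<lambda>x. \<sigma>1 (chart_inv c x) - \<sigma>2 (chart_inv c x)) has_field_derivative 0) (at x within ball (snd c q) e)"
        if x: "x \<in> ball (snd c q) e" for x
      proof -
        have "x \<in> S" using x e(2) by blast
        then obtain p where p: "p \<in> fst c" "p \<in> ?A" "x = snd c p" unfolding S_def by blast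
        have near: "smooth_near N p \<sigma>1" "smooth_near N p \<sigma>2" using unit_function_near u1 u2 p(2) by blast+
        show ?thesis
          using DERIV_diff[OF coord_vec_real_derivative[OF c(2) p(1) near(1)]
              coord_vec_real_derivative[OF c(2) p(1) near(2)]] same[OF c(2) p(1,2)] p(3)
          by (simp add: has_field_derivative_at_within)
      qed
      obtain C where C: "\<And>x. x \<in> ball (snd c q) e \<Longrightarrow> \<sigma>1 (chart_inv c x) - \<sigma>2 (chart_inv c x) = C"
        using has_field_derivative_zero_constant[OF convex_ball d] by blast
      define V where "V = {p \<in> fst c \<inter> ?A. snd c p \<in> ball (snd c q) e}"
      have V: "open_in N V" unfolding V_def by (rule chart_preimage_open[OF c(2) open_ball O])
      have DV: "?D p = C" if "p \<in> V" for p using C[of "snd c p"] that inv by (auto simp: V_def)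
      have qV: "q \<in> V" using q c(3) e(1) by (auto simp: V_def)
      obtain T where T: "open T" "V = pts N \<inter> T" using V by (auto simp: openin_open)
      show "\<forall>\<^sub>F b in at q within ?A. ?D q = ?D b"
        unfolding eventually_at_topological
      proof (intro exI[of _ T] conjI ballI impI)
        show "open T" "q \<in> T" using T qV by auto
        fix b assume "b \<in> T" "b \<in> ?A"
        then have "b \<in> V" using T(2) open_in_pts[OF O] by blast
        then show "?D q = ?D b" using DV qV by metis
      qed
    qed
  qed
  then show ?thesis by simp
qed

text \<open>The glued function differs from each local one by a constant and inherits its
  derivatives; local strict increase propagates along the parameter interval and gives
  injectivity.\<close>

lemma unit_coordinate_exists:
  obtains z where "smooth_fun N (pts N) z" "inj_on z (pts N)"
    "\<And>p v. v \<in> tangent_space N p \<Longrightarrow> (v z)\<^sup>2 = g p v v"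
proof -
  obtain J \<sigma> where J: "\<And>t. t \<in> {0<..<1} \<Longrightarrow> t \<in> J t" and u: "\<And>t. t \<in> {0<..<1} \<Longrightarrow> unit_function (J t) (\<sigma> t)"
    using unit_function_exists by metis
  have Jp: "open (J t)" "is_interval (J t)" "J t \<subseteq> {0<..<1}" "strict_mono_on (J t) (\<lambda>x. \<sigma> t (hi x))"
    "smooth_fun N (hi ` J t) (\<sigma> t)"
    "\<And>q v. q \<in> hi ` J t \<Longrightarrow> v \<in> tangent_space N q \<Longrightarrow> (v (\<sigma> t))\<^sup>2 = g q v v" if "t \<in> {0<..<1}" for t
    using u[OF that] unfolding unit_function_def by blast+
  obtain F where F0: "\<And>i x y. i \<in> {0<..<1} \<Longrightarrow> x \<in> {0<..<1} \<inter> J i \<Longrightarrow> y \<in> {0<..<1} \<inter> J i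
      \<Longrightarrow> F x - F y = \<sigma> i (hi x) - \<sigma> i (hi y)"
  proof (rule glue_increments[where A = "{0<..<1::real}" and J = J and s = "\<lambda>t x. \<sigma> t (hi x)"])
    show "is_interval {0<..<1::real}" by (simp add: is_interval_convex_1)
    show "\<sigma> i (hi x) - \<sigma> i (hi y) = \<sigma> j (hi x) - \<sigma> j (hi y)"
      if "i \<in> {0<..<1}" "j \<in> {0<..<1}" "x \<in> J i \<inter> J j" "y \<in> J i \<inter> J j" for i j x y
      by (rule unit_function_difference[OF u[OF that(1)] u[OF that(2)] that(3,4)])
  qed (use Jp J that in auto)
  have F: "F x - F y = \<sigma> i (hi x) - \<sigma> i (hi y)" if "i \<in> {0<..<1}" "x \<in> J i" "y \<in> J i" for i x y
    using F0[OF that(1)] Jp(3)[OF that(1)] that by blast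
  have F_mono: "F a < F b" if ab: "a \<in> {0<..<1}" "b \<in> {0<..<1}" "a < b" for a b
  proof (rule less_of_locally_strict_mono[OF ab(3)])
    fix t assume "a \<le> t" "t \<le> b"
    then have t: "t \<in> {0<..<1}" using ab by auto
    obtain d where d: "d > 0" "ball t d \<subseteq> J t" using Jp(1)[OF t] J[OF t] open_contains_ball by blast
    have "F x < F y" if "x < y \<and> a \<le> x \<and> y \<le> b \<and> x \<le> t \<and> t \<le> y \<and> y - x < d" for x y
    proof -
      have xy: "x \<in> J t" "y \<in> J t" using that d(2) by (auto simp: ball_def dist_real_def subset_iff)
      have "\<sigma> t (hi x) < \<sigma> t (hi y)" using strict_mono_onD[OF Jp(4)[OF t] xy] that by blast
      then show ?thesis using F[OF t xy] by simp
    qed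
    then show "\<exists>d>0. \<forall>u v. u < v \<and> a \<le> u \<and> v \<le> b \<and> u \<le> t \<and> t \<le> v \<and> v - u < d \<longrightarrow> F u < F v"
      using d(1) by blast
  qed
  define z where "z p = F (h p)" for p
  have loc: "\<exists>V t C. t \<in> {0<..<1} \<and> V = hi ` J t \<and> open_in N V \<and> p \<in> V \<and> (\<forall>q\<in>V. z q = \<sigma> t q + C)"
    if p: "p \<in> pts N" for p
  proof -
    define t where "t = h p"
    have t: "t \<in> {0<..<1}" "hi t = p" using hi p by (auto simp: t_def)
    have "z q = \<sigma> t q + (F t - \<sigma> t (hi t))" if q: "q \<in> hi ` J t" for q
    proof -
      obtain x where x: "x \<in> J t" "q = hi x" using q by blast
      then have "z q = F x" using hi(3) Jp(3)[OF t(1)] by (auto simp: z_def)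
      then show ?thesis using F[OF t(1) x(1) J[OF t(1)]] x(2) by simp
    qed
    then show ?thesis
      using t J[OF t(1)] open_arc_image[OF Jp(1,3)[OF t(1)]] by blast
  qed
  show ?thesis
  proof (rule that[of z])
    show "smooth_fun N (pts N) z"
    proof (rule smooth_fun_local)
      fix p assume "p \<in> pts N"
      then obtain t C where V: "t \<in> {0<..<1}" "open_in N (hi ` J t)" "p \<in> hi ` J t"
        "\<And>q. q \<in> hi ` J t \<Longrightarrow> z q = \<sigma> t q + C" using loc by metis
      have "smooth_fun N (hi ` J t) (\<lambda>q. \<sigma> t q + C)"
        by (rule smooth_fun_add[OF V(2) Jp(5)[OF V(1)] smooth_fun_const[OF V(2)]])
      then have "smooth_fun N (hi ` J t) z"
        using smooth_fun_cong[OF V(2), of z "\<lambda>q. \<sigma> t q + C"] V(4) by blast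
      then show "\<exists>W'. open_in N W' \<and> p \<in> W' \<and> smooth_fun N W' z" using V by blast
    qed
    show "inj_on z (pts N)"
    proof (rule inj_onI)
      fix p q assume pq: "p \<in> pts N" "q \<in> pts N" "z p = z q"
      have "h p = h q"
        using F_mono[OF hi(5)[OF pq(1)] hi(5)[OF pq(2)]] F_mono[OF hi(5)[OF pq(2)] hi(5)[OF pq(1)]] pq(3)
        unfolding z_def by linarith
      then show "p = q" using hi(4) pq by metis
    qed
    show "(v z)\<^sup>2 = g p v v" if v: "v \<in> tangent_space N p" for p v
    proof -
      obtain t C where V: "t \<in> {0<..<1}" "open_in N (hi ` J t)" "p \<in> hi ` J t"
        "\<And>q. q \<in> hi ` J t \<Longrightarrow> z q = \<sigma> t q + C" using loc[OF tangent_in_pts[OF v]] by metis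
      have "v z = v (\<lambda>q. \<sigma> t q + C)" by (rule tangent_cong[OF v V(2,3,4)])
      also have "\<dots> = v (\<sigma> t)"
        using tangent_add[OF v unit_function_near[OF u[OF V(1)] V(3)] smooth_near_const[OF tangent_in_pts[OF v]]]
          tangent_const[OF v] by simp
      finally show ?thesis using Jp(6)[OF V(1,3) v] by simp
    qed
  qed
qed

lemma global_chart_exists:
  obtains z where "adm (pts N, z)"
proof -
  obtain z where z: "smooth_fun N (pts N) z" "inj_on z (pts N)"
    "\<And>p v. v \<in> tangent_space N p \<Longrightarrow> (v z)\<^sup>2 = g p v v"
    using unit_coordinate_exists by blast
  have "coord_vec N c 1 p z \<noteq> 0" if "c \<in> charts N" "p \<in> fst c" for c p
  proof -
    have c: "adm c" using charts_adm[OF that(1)] .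
    have "(coord_vec N c 1 p z)\<^sup>2 = weight c p"
      using z(3)[OF coord_vec_in_tangent[OF c that(2)]] by (simp add: weight_def)
    then show ?thesis using weight_pos[OF c that(2)] by auto
  qed
  then show ?thesis using that admissible_global_chart[OF arc z(1,2)] by blast
qed

end

section \<open>Affine coordinates and quasi-arithmetic means\<close>

context curve
begin

definition christoffel :: "('a, real) chart \<Rightarrow> 'a connection \<Rightarrow> 'a \<Rightarrow> real" where
  "christoffel c E p = components c (E (fst c) (coord_vec N c 1) (coord_vec N c 1) p)"

lemma christoffel_scale:
  assumes E: "affine_connection N E" and c: "adm c"
  shows "components c (E (fst c) (coord_vec N c a) (coord_vec N c a) p) = a * a * christoffel c E p"
proof -
  note o = admissible_chartD(1)[OF c] and v = coord_vec_vfield[OF c]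
  \<comment> \<open>A constant multiple is written as a sum over one index so that the linearity
    rules for finite sums apply.\<close>
  have eq: "coord_vec N c a = (\<lambda>p h. \<Sum>b\<in>{1}. a * coord_vec N c b p h)"
  proof (intro ext)
    fix p h
    show "coord_vec N c a p h = (\<Sum>b\<in>{1}. a * coord_vec N c b p h)"
      using coord_vec_scale[OF c, of p a h] by (cases "p \<in> fst c") (simp_all add: coord_vec_apply)
  qed
  have l: "E (fst c) (coord_vec N c a) (coord_vec N c a)
      = (\<lambda>p h. \<Sum>b\<in>{1}. a * E (fst c) (coord_vec N c b) (coord_vec N c a) p h)"
    by (subst (1) eq, rule connection_sum_left[OF E o v]) (use v smooth_fun_const[OF o] in auto)
  have r: "E (fst c) (coord_vec N c 1) (coord_vec N c a)
      = (\<lambda>p h. \<Sum>b\<in>{1}. coord_vec N c 1 p (\<lambda>_. a) * coord_vec N c b p h + a * E (fst c) (coord_vec N c 1) (coord_vec N c b) p h)"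
    by (subst eq, rule connection_sum_right[OF E o v]) (use v smooth_fun_const[OF o] in auto)
  have "E (fst c) (coord_vec N c a) (coord_vec N c a) p = (\<lambda>h. a * (a * E (fst c) (coord_vec N c 1) (coord_vec N c 1) p h))"
    unfolding l by (simp add: r coord_vec_const)
  then show ?thesis by (simp add: christoffel_def components_real)
qed

text \<open>A geodesic satisfies u'' = - Gamma u'^2, so f(u) u' has derivative (f' - Gamma f)(u)
  u'^2 = 0. Hence \<phi>, having derivative f, is affine in time, and the midpoint in time averages
  its values.\<close>

lemma geodesic_quasi_arithmetic_mean:
  assumes E: "affine_connection N E" and c: "adm c" "fst c = pts N"
    and \<phi>: "\<And>t. t \<in> snd c ` pts N \<Longrightarrow> (\<phi> has_real_derivative f t) (at t)"
    and f: "\<And>t. t \<in> snd c ` pts N \<Longrightarrow> (f has_real_derivative f1 t) (at t)"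
    and rel: "\<And>p. p \<in> pts N \<Longrightarrow> f1 (snd c p) = christoffel c E p * f (snd c p)"
    and un: "unique_geodesic N E p q"
  shows "\<phi> (snd c (midpoint_mean N E p q)) = (\<phi> (snd c p) + \<phi> (snd c q)) / 2"
    and "midpoint_mean N E p q \<in> pts N"
proof -
  obtain \<gamma> where \<gamma>: "geodesic_from_to N E p q \<gamma>" using un unfolding unique_geodesic_def by blast
  then have geo: "geodesic N E \<gamma>" and ends: "\<gamma> 0 = p" "\<gamma> 1 = q" by (auto simp: geodesic_from_to_def)
  have \<gamma>_in: "\<gamma> t \<in> pts N" if "t \<in> {0..1}" for t using geodesic_imp_pts[OF geo that] .
  define u where "u t = snd c (\<gamma> t)" for t
  from geodesic_in_admissible_chart[OF smooth_mfd_axioms E geo c(1)]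
  obtain u' where d: "\<forall>t\<in>{0..1}. \<gamma> t \<in> fst c \<longrightarrow>
      ((snd c \<circ> \<gamma>) has_vector_derivative u' t) (at t within {0..1}) \<and>
      (u' has_vector_derivative
        - components c (E (fst c) (coord_vec N c (u' t)) (coord_vec N c (u' t)) (\<gamma> t))) (at t within {0..1})"
    by (rule exE)
  have u': "(u has_real_derivative u' t) (at t within {0..1})"
    and u'': "(u' has_real_derivative - (u' t * u' t * christoffel c E (\<gamma> t))) (at t within {0..1})"
    if t: "t \<in> {0..1}" for t
  proof -
    have "\<gamma> t \<in> fst c" using \<gamma>_in[OF t] c(2) by simp
    note dt = d[THEN bspec, OF t, THEN mp, OF this]
    show "(u has_real_derivative u' t) (at t within {0..1})"
      using dt[THEN conjunct1]
      by (simp only: has_real_derivative_iff_has_vector_derivative u_def[abs_def] comp_def)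
    show "(u' has_real_derivative - (u' t * u' t * christoffel c E (\<gamma> t))) (at t within {0..1})"
      using dt[THEN conjunct2]
      by (simp only: has_real_derivative_iff_has_vector_derivative christoffel_scale[OF E c(1)])
  qed
  have uS: "u t \<in> snd c ` pts N" if "t \<in> {0..1}" for t using \<gamma>_in[OF that] by (simp add: u_def)
  have "((\<lambda>t. f (u t) * u' t) has_field_derivative 0) (at t within {0..1})" if t: "t \<in> {0..1}" for t
  proof -
    have "((\<lambda>t. f (u t)) has_real_derivative f1 (u t) * u' t) (at t within {0..1})"
      by (rule DERIV_chain2[where f = f and g = u, OF f[OF uS[OF t]] u'[OF t]])
    from DERIV_mult[OF this u''[OF t]] show ?thesis
      using rel[OF \<gamma>_in[OF t]] by (simp add: u_def algebra_simps)
  qed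
  from has_field_derivative_zero_constant[OF convex_real_interval(5) this]
  obtain K where "\<forall>t\<in>{0..1}. f (u t) * u' t = K" by (rule exE)
  note K = this[THEN bspec]
  have "((\<lambda>t. \<phi> (u t) - K * t) has_field_derivative 0) (at t within {0..1})" if t: "t \<in> {0..1}" for t
  proof -
    have "((\<lambda>t. \<phi> (u t)) has_real_derivative f (u t) * u' t) (at t within {0..1})"
      by (rule DERIV_chain2[where f = \<phi> and g = u, OF \<phi>[OF uS[OF t]] u'[OF t]])
    then have "((\<lambda>t. \<phi> (u t) - K * t) has_real_derivative f (u t) * u' t - K) (at t within {0..1})"
      by (auto intro!: derivative_eq_intros)
    then show ?thesis using K[OF t] by simp
  qed
  from has_field_derivative_zero_constant[OF convex_real_interval(5) this]
  obtain C where "\<forall>t\<in>{0..1}. \<phi> (u t) - K * t = C" by (rule exE)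
  note C = this[THEN bspec]
  have "\<phi> (u (1/2)) = (\<phi> (u 0) + \<phi> (u 1)) / 2" using C[of 0] C[of 1] C[of "1/2"] by simp
  then show "\<phi> (snd c (midpoint_mean N E p q)) = (\<phi> (snd c p) + \<phi> (snd c q)) / 2"
    using midpoint_mean_eq[OF un \<gamma>] ends by (simp add: u_def)
  show "midpoint_mean N E p q \<in> pts N" using midpoint_mean_eq[OF un \<gamma>] \<gamma>_in[of "1/2"] by simp
qed

lemma christoffel_smooth:
  assumes "affine_connection N E" "adm c"
  shows "smooth_fun N (fst c) (christoffel c E)"
proof -
  note o = admissible_chartD(1)[OF assms(2)] and v = coord_vec_vfield[OF assms(2), of 1]
  show ?thesis
    using vfields_components[OF assms(2) affine_connectionD(1)[OF assms(1) o v v] o order_refl order_refl, of 1]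
    by (simp add: christoffel_def[abs_def])
qed

end

section \<open>Affine coordinates of the arc and the shape of its weight\<close>

context riemannian_arc
begin

text \<open>In a chart with symbol Gamma the equation X'' = Gamma X' is solved by two
  antiderivatives, of Gamma and then of its exponential; the exponential keeps X' positive, so X is
  a coordinate.\<close>

lemma affine_coordinate_exists:
  assumes E: "affine_connection N E"
  obtains x where "affine_coordinate N E x"
proof -
  obtain z where z: "adm (pts N, z)" using global_chart_exists .
  let ?c = "(pts N, z)"
  let ?S = "z ` pts N"
  note zi = admissible_chartD(7)[OF z, simplified]
  have S: "open ?S" using admissible_chartD(2)[OF z] by simp
  have conn: "connected (pts N)"
    using connected_continuous_image[OF hi(2)] hi(1) by (metis connected_Ioo)
  have S2: "is_interval ?S"
    using connected_continuous_image[OF _ conn, of z] admissible_chartD(4)[OF z] is_interval_connected_1 by simp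
  define \<Gamma> where "\<Gamma> t = christoffel ?c E (chart_inv ?c t)" for t
  have "smooth_on ?S \<Gamma>"
    using chart_smooth_of_smooth_fun[OF z open_pts] christoffel_smooth[OF E z]
    by (simp add: chart_smooth_def \<Gamma>_def[abs_def])
  then obtain G where G: "\<And>t. t \<in> ?S \<Longrightarrow> (G has_real_derivative \<Gamma> t) (at t)"
    using antiderivative_on_open_interval[OF S S2] smooth_on_imp_continuous_on by blast
  have Gs: "smooth_on ?S G"
    by (rule smooth_on_antiderivative[OF S _ \<open>smooth_on ?S \<Gamma>\<close>])
      (simp add: G has_real_derivative_iff_has_vector_derivative[symmetric])
  have es: "smooth_on ?S (\<lambda>t. exp (G t))"
    by (rule smooth_on_compose[OF S open_UNIV subset_UNIV Gs smooth_on_exp])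
  obtain X where X: "\<And>t. t \<in> ?S \<Longrightarrow> (X has_real_derivative exp (G t)) (at t)"
    using antiderivative_on_open_interval[OF S S2 smooth_on_imp_continuous_on[OF es]] by blast
  have Xs: "smooth_on ?S X"
    by (rule smooth_on_antiderivative[OF S _ es]) (simp add: X has_real_derivative_iff_has_vector_derivative[symmetric])
  have X_mono: "strict_mono_on ?S X" by (rule strict_mono_on_interval_deriv_pos[OF S2 X]) auto
  define x where "x p = X (z p)" for p
  have near_z: "smooth_near N p z" if "p \<in> pts N" for p using smooth_near_chart[OF z] that by simp
  have zp: "z p \<in> ?S" if "p \<in> pts N" for p using that by simp
  have vx: "v x = exp (G (z p)) * v z" if v: "v \<in> tangent_space N p" for p v
    using tangent_chain(2)[OF v near_z[OF tangent_in_pts[OF v]] S Xs zp[OF tangent_in_pts[OF v]]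
        X[OF zp[OF tangent_in_pts[OF v]]]] by (simp add: x_def[abs_def])
  have "smooth_fun N (pts N) z" using smooth_fun_coordinate[OF z open_pts, of 1] by simp
  from smooth_fun_compose[OF open_pts this S order_refl Xs] have x_smooth: "smooth_fun N (pts N) x"
    by (simp add: x_def[abs_def])
  have x_inj: "inj_on x (pts N)"
  proof (rule inj_onI)
    fix p q assume pq: "p \<in> pts N" "q \<in> pts N" "x p = x q"
    have "z p = z q"
      using strict_mono_on_eqD[OF X_mono _ zp[OF pq(1)] zp[OF pq(2)]] pq(3) by (simp add: x_def)
    then show "p = q" using zi pq by metis
  qed
  have "coord_vec N c 1 p x \<noteq> 0" if "c \<in> charts N" "p \<in> fst c" for c p
  proof -
    have c: "adm c" using charts_adm[OF that(1)] .
    have p: "p \<in> pts N" using admissible_chartD(6)[OF c] that(2) by blast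
    note t = coord_vec_in_tangent[OF c that(2), of 1]
    have "coord_vec N c 1 p = (\<lambda>f. coord_vec N c 1 p z * coord_vec N ?c 1 p f)"
      using tangent_real[OF z _ t] p by simp
    then have "coord_vec N c 1 p (snd c) = coord_vec N c 1 p z * coord_vec N ?c 1 p (snd c)"
      by (rule fun_cong)
    then have "coord_vec N c 1 p z \<noteq> 0" using coord_vec_chart[OF c that(2), of 1] by auto
    then show ?thesis using vx[OF t] by simp
  qed
  from admissible_global_chart[OF arc x_smooth x_inj this] have x_adm: "adm (pts N, x)" .
  let ?d = "(pts N, x)"
  have "connected (x ` pts N)"
    using connected_continuous_image[OF _ conn, of x] admissible_chartD(4)[OF x_adm] by simp
  then have x_int: "is_interval (x ` pts N)" by (simp add: is_interval_connected_1)
  \<comment> \<open>The new coordinate vector has old component 1/X'.\<close>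
  have comp: "components ?c (coord_vec N ?d 1 p) = exp (- G (z p))" if p: "p \<in> pts N" for p
  proof -
    have t: "coord_vec N ?d 1 p \<in> tangent_space N p" using coord_vec_in_tangent[OF x_adm] p by simp
    have "1 = exp (G (z p)) * coord_vec N ?d 1 p z"
      using vx[OF t] coord_vec_chart[OF x_adm, of p 1] p by simp
    then show ?thesis by (simp add: components_real exp_minus field_simps)
  qed
  have "E (pts N) (coord_vec N ?d 1) (coord_vec N ?d 1) p = (\<lambda>_. 0)" if p: "p \<in> pts N" for p
  proof -
    let ?v = "coord_vec N ?d 1 p" and ?a = "exp (- G (z p))"
    have vf: "coord_vec N ?d 1 \<in> vfields N (pts N)" using coord_vec_vfield[OF x_adm, of 1] by simp
    have t: "?v \<in> tangent_space N p" using vfieldsD(1)[OF vf p] .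
    have vz: "?v z = ?a" using comp[OF p] by (simp add: components_real)
    have neg: "smooth_on ?S (\<lambda>t. exp ((-1) * G t))"
      by (rule smooth_on_compose[OF S open_UNIV subset_UNIV smooth_on_mult[OF S smooth_on_const[OF S] Gs] smooth_on_exp])
    \<comment> \<open>Differentiating exp(-G) along the new coordinate vector yields -\<Gamma>
      exp(-2G), which the Christoffel term cancels.\<close>
    have d: "((\<lambda>t. exp ((-1) * G t)) has_real_derivative - (\<Gamma> (z p) * ?a)) (at (z p))"
      by (auto intro!: derivative_eq_intros G[OF zp[OF p]])
    have "?v (\<lambda>q. components ?c (coord_vec N ?d 1 q)) = ?v (\<lambda>q. exp ((-1) * G (z q)))"
      by (rule tangent_cong[OF t open_pts p]) (simp add: comp)
    also have "\<dots> = - (\<Gamma> (z p) * ?a) * ?v z"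
      by (rule tangent_chain(2)[OF t near_z[OF p] S neg zp[OF p] d])
    finally have 1: "?v (\<lambda>q. components ?c (coord_vec N ?d 1 q)) = - (\<Gamma> (z p) * ?a * ?a)" by (simp add: vz)
    have \<Gamma>p: "\<Gamma> (z p) = christoffel ?c E p" using zi[OF p] by (simp add: \<Gamma>_def)
    have "components ?c (E (pts N) (coord_vec N ?d 1) (coord_vec N ?d 1) p)
        = ?v (\<lambda>q. components ?c (coord_vec N ?d 1 q))
          + components ?c (E (fst ?c) (coord_vec N ?c ?a) (coord_vec N ?c ?a) p)"
      using components_connection[OF E z open_pts vf vf p] p comp[OF p] by simp
    also have "\<dots> = 0" unfolding 1 christoffel_scale[OF E z] by (simp add: \<Gamma>p)
    finally have z0: "components ?c (E (pts N) (coord_vec N ?d 1) (coord_vec N ?d 1) p) = 0" .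
    have Et: "E (pts N) (coord_vec N ?d 1) (coord_vec N ?d 1) p \<in> tangent_space N p"
      by (rule vfieldsD(1)[OF affine_connectionD(1)[OF E open_pts vf vf] p])
    show ?thesis
      by (rule tangent_eqI[OF z _ Et tangent_zero[OF p]]) (use p z0 in \<open>simp_all add: components_real\<close>)
  qed
  then have "affine_coordinate N E x"
    using x_adm x_int by (simp add: affine_coordinate_def coordinate_field_def)
  then show ?thesis using that by blast
qed

lemma metric_christoffel:
  assumes E: "affine_connection N E" and c: "adm c" "p \<in> fst c"
  shows "g p (coord_vec N c 1 p) (E (fst c) (coord_vec N c 1) (coord_vec N c 1) p) = christoffel c E p * weight c p"
    and "g p (E (fst c) (coord_vec N c 1) (coord_vec N c 1) p) (coord_vec N c 1 p) = christoffel c E p * weight c p"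
proof -
  let ?v = "E (fst c) (coord_vec N c 1) (coord_vec N c 1) p"
  have t: "?v \<in> tangent_space N p"
    by (rule vfieldsD(1)[OF affine_connectionD(1)[OF E admissible_chartD(1)[OF c(1)]
          coord_vec_vfield[OF c(1)] coord_vec_vfield[OF c(1)]] c(2)])
  note u = coord_vec_in_tangent[OF c, of 1]
  have "?v = (\<lambda>f. christoffel c E p * coord_vec N c 1 p f)"
    using tangent_real[OF c t] by (simp add: christoffel_def components_real)
  then show 1: "g p ?v (coord_vec N c 1 p) = christoffel c E p * weight c p"
    using metric_scale[OF u u] by (simp add: weight_def)
  then show "g p (coord_vec N c 1 p) ?v = christoffel c E p * weight c p"
    using metric_sym[OF u t] by simp
qed

text \<open>On the coordinate field of the affine coordinate, duality reads w' = Gamma' w and metric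
  compatibility w' = 2 Gamma_g w. Thus w and its square root are the densities required for the
  means of \<open>E'\<close> and \<open>Eg\<close>.\<close>

lemma invariance_weight:
  assumes dual: "dual_connections N g E E'" and lc: "levi_civita N g Eg"
    and conv: "geodesically_convex N E" "geodesically_convex N E'" "geodesically_convex N Eg"
    and inv: "\<And>p q. p \<in> pts N \<Longrightarrow> q \<in> pts N \<Longrightarrow>
      midpoint_mean N Eg (midpoint_mean N E p q) (midpoint_mean N E' p q) = midpoint_mean N Eg p q"
    and x: "affine_coordinate N E x"
    and w: "\<And>p. p \<in> pts N \<Longrightarrow> g p (coordinate_field N x p) (coordinate_field N x p) = w (x p)"
  shows "(\<exists>c. \<forall>t\<in>x ` pts N. w t = c) \<or> (\<exists>c>0. \<exists>x0. x0 \<notin> x ` pts N \<and> (\<forall>t\<in>x ` pts N. w t = c / (t - x0)\<^sup>2))"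
proof -
  let ?c = "(pts N, x)"
  let ?S = "x ` pts N"
  have c: "adm ?c" and int: "is_interval ?S"
    and flat: "\<And>p. p \<in> pts N \<Longrightarrow> E (pts N) (coord_vec N ?c 1) (coord_vec N ?c 1) p = (\<lambda>_. 0)"
    using x by (auto simp: affine_coordinate_def coordinate_field_def)
  have E: "affine_connection N E" "affine_connection N E'" "affine_connection N Eg"
    using dual lc by (auto simp: dual_connections_def levi_civita_def)
  note xi = admissible_chartD(7)[OF c, simplified]
  have S: "open ?S" using admissible_chartD(2)[OF c] by simp
  have wx: "w (x p) = weight ?c p" if "p \<in> pts N" for p
    using w[OF that] by (simp add: weight_def coordinate_field_def)
  have "smooth_on ?S (\<lambda>t. weight ?c (chart_inv ?c t))"
    using chart_smooth_of_smooth_fun[OF c open_pts] weight_smooth[OF c] by (simp add: chart_smooth_def)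
  then have ws: "smooth_on ?S w"
    by (subst smooth_on_cong[OF S, where g = "\<lambda>t. weight ?c (chart_inv ?c t)"]) (auto simp: wx xi)
  have wpos: "w t > 0" if "t \<in> ?S" for t using that weight_pos[OF c] wx by auto
  define w1 where "w1 t = frechet_derivative w (at t) 1" for t
  have dw: "(w has_real_derivative w1 t) (at t)" if "t \<in> ?S" for t
    using smooth_on_has_vector_derivative[OF ws that]
    by (simp add: w1_def has_real_derivative_iff_has_vector_derivative)
  have flat0: "christoffel ?c E p = 0" if "p \<in> pts N" for p
    using flat[OF that] by (simp add: christoffel_def components_real)
  have w1: "coord_vec N ?c 1 p (\<lambda>q. g q (coord_vec N ?c 1 q) (coord_vec N ?c 1 q)) = w1 (x p)" if p: "p \<in> pts N" for p
  proof (rule coord_vec_realI[OF c])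
    show "p \<in> fst ?c" using p by simp
    show "smooth_near N p (\<lambda>q. g q (coord_vec N ?c 1 q) (coord_vec N ?c 1 q))"
      using smooth_nearI[OF open_pts p] weight_smooth[OF c] by (simp add: weight_def[abs_def])
    have "(w has_real_derivative w1 (x p)) (at (x p))" using dw p by blast
    then have "((\<lambda>t. weight ?c (chart_inv ?c t)) has_real_derivative w1 (x p)) (at (x p))"
      by (rule has_field_derivative_transform_within_open[OF _ S]) (use p wx xi in auto)
    then show "((\<lambda>t. g (chart_inv ?c t) (coord_vec N ?c 1 (chart_inv ?c t)) (coord_vec N ?c 1 (chart_inv ?c t)))
        has_real_derivative w1 (x p)) (at (snd ?c p))"
      by (simp add: weight_def)
  qed
  have vf: "coord_vec N ?c 1 \<in> vfields N (pts N)" using coord_vec_vfield[OF c, of 1] by simp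
  have chr': "w1 (x p) = christoffel ?c E' p * w (x p)" if p: "p \<in> pts N" for p
  proof -
    have "w1 (x p) = g p (E (pts N) (coord_vec N ?c 1) (coord_vec N ?c 1) p) (coord_vec N ?c 1 p)
        + g p (coord_vec N ?c 1 p) (E' (pts N) (coord_vec N ?c 1) (coord_vec N ?c 1) p)"
      using dual[unfolded dual_connections_def, THEN conjunct2, THEN conjunct2, THEN spec, THEN mp, OF open_pts,
        THEN bspec, OF vf, THEN bspec, OF vf, THEN bspec, OF vf, THEN bspec, OF p] w1[OF p] by simp
    then show ?thesis
      using metric_christoffel(2)[OF E(1) c, of p] metric_christoffel(1)[OF E(2) c, of p] flat0[OF p] wx[OF p] p by simp
  qed
  have chrg: "w1 (x p) = 2 * christoffel ?c Eg p * w (x p)" if p: "p \<in> pts N" for p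
  proof -
    have "w1 (x p) = g p (Eg (pts N) (coord_vec N ?c 1) (coord_vec N ?c 1) p) (coord_vec N ?c 1 p)
        + g p (coord_vec N ?c 1 p) (Eg (pts N) (coord_vec N ?c 1) (coord_vec N ?c 1) p)"
      using lc[unfolded levi_civita_def, THEN conjunct2, THEN conjunct2, THEN spec, THEN mp, OF open_pts,
        THEN bspec, OF vf, THEN bspec, OF vf, THEN bspec, OF vf, THEN bspec, OF p] w1[OF p] by simp
    then show ?thesis
      using metric_christoffel[OF E(3) c, of p] wx[OF p] p by simp
  qed
  obtain y where y: "\<And>t. t \<in> ?S \<Longrightarrow> (y has_real_derivative w t) (at t)"
    using antiderivative_on_open_interval[OF S int smooth_on_imp_continuous_on[OF ws]] by blast
  have "continuous_on ?S (\<lambda>t. sqrt (w t))"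
    by (intro continuous_on_real_sqrt smooth_on_imp_continuous_on ws)
  then obtain s where s: "\<And>t. t \<in> ?S \<Longrightarrow> (s has_real_derivative sqrt (w t)) (at t)"
    using antiderivative_on_open_interval[OF S int] by blast
  have dsq: "((\<lambda>t. sqrt (w t)) has_real_derivative w1 t * (inverse (sqrt (w t)) / 2)) (at t)" if "t \<in> ?S" for t
    using dw[OF that] wpos[OF that] by (auto intro!: derivative_eq_intros)
  have un: "unique_geodesic N E p q" "unique_geodesic N E' p q" "unique_geodesic N Eg p q"
    if "p \<in> pts N" "q \<in> pts N" for p q
    using conv that unfolding geodesically_convex_def by blast+
  \<comment> \<open>A vanishing symbol admits the constant density 1, so this mean is the arithmetic
    one.\<close>
  have mean_E: "x (midpoint_mean N E p q) = (x p + x q) / 2" "midpoint_mean N E p q \<in> pts N"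
    if pq: "p \<in> pts N" "q \<in> pts N" for p q
    using geodesic_quasi_arithmetic_mean[OF E(1) c _ _ _ _ un(1)[OF pq], of "\<lambda>t. t" "\<lambda>t. 1" "\<lambda>t. 0"] flat0 by simp_all
  have mean_E': "y (x (midpoint_mean N E' p q)) = (y (x p) + y (x q)) / 2" "midpoint_mean N E' p q \<in> pts N"
    if pq: "p \<in> pts N" "q \<in> pts N" for p q
    using geodesic_quasi_arithmetic_mean[OF E(2) c _ _ _ _ un(2)[OF pq], of y w w1] y dw chr' by simp_all
  have sq_rel: "w1 (x p) * (inverse (sqrt (w (x p))) / 2) = christoffel ?c Eg p * sqrt (w (x p))" if p: "p \<in> pts N" for p
  proof -
    have "w (x p) > 0" using wpos p by blast
    then have "sqrt (w (x p)) * sqrt (w (x p)) = w (x p)" "sqrt (w (x p)) > 0" by simp_all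
    then show ?thesis using chrg[OF p] by (simp add: field_simps)
  qed
  have mean_Eg: "s (x (midpoint_mean N Eg p q)) = (s (x p) + s (x q)) / 2"
    if pq: "p \<in> pts N" "q \<in> pts N" for p q
    using geodesic_quasi_arithmetic_mean(1)[OF E(3) c _ _ _ _ un(3)[OF pq], of s "\<lambda>t. sqrt (w t)"
        "\<lambda>t. w1 t * (inverse (sqrt (w t)) / 2)"] s dsq sq_rel by simp
  show ?thesis
  proof (cases "?S = {}")
    case False
    show ?thesis
    proof (rule weight_of_invariance[OF S int False ws wpos y s])
      fix a b assume "a \<in> ?S" "b \<in> ?S"
      then obtain p q where p: "p \<in> pts N" "a = x p" and q: "q \<in> pts N" "b = x q" by blast
      let ?r = "midpoint_mean N E' p q"
      have "s (x (midpoint_mean N E p q)) + s (x ?r) = s a + s b"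
        using mean_Eg[OF mean_E(2)[OF p(1) q(1)] mean_E'(2)[OF p(1) q(1)]] mean_Eg[OF p(1) q(1)]
          inv[OF p(1) q(1)] p(2) q(2) by simp
      then show "\<exists>r\<in>?S. y r = (y a + y b) / 2 \<and> s ((a + b) / 2) + s r = s a + s b"
        using mean_E[OF p(1) q(1)] mean_E'[OF p(1) q(1)] p(2) q(2) by auto
    qed
  qed blast
qed

end

theorem theorem8p6:
  fixes P :: "('a::{t2_space, second_countable_topology}, 'e::euclidean_space) manifold"
    and N :: "('a, real) manifold"
    and g :: "'a metric"
    and D D' Dg :: "'a connection"
  assumes "riemannian_manifold P g"
    and "dual_connections P g D D'"
    and "torsion_free P D" and "torsion_free P D'"
    and "levi_civita P g Dg"
    and "embedded_submanifold P N"
    and "autoparallel P N D" and "autoparallel P N Dg"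
  shows
    "(\<forall>W. open_in P W \<longrightarrow> (\<forall>X\<in>vfields P W. \<forall>Y\<in>vfields P W.
        D' W X Y = (\<lambda>p h. 2 * Dg W X Y p h - D W X Y p h)))
     \<and> autoparallel P N D'
     \<and> dual_connections N (induced_metric P g)
          (induced_connection P N D) (induced_connection P N D')
     \<and> levi_civita N (induced_metric P g) (induced_connection P N Dg)
     \<and> (\<forall>U. let
            SU = open_submanifold N U;
            DU = induced_connection P SU D;
            DU' = induced_connection P SU D';
            DgU = induced_connection P SU Dg;
            A = midpoint_mean P D; M = midpoint_mean P D'; Mg = midpoint_mean P Dg;
            AU = midpoint_mean SU DU; MU = midpoint_mean SU DU'; MgU = midpoint_mean SU DgU
          in
            open_arc N U
            \<and> geodesically_convex SU DU \<and> geodesically_convex SU DU' \<and> geodesically_convex SU DgU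
            \<and> (\<forall>p\<in>U. \<forall>q\<in>U. unique_geodesic P D p q \<and> unique_geodesic P D' p q
                  \<and> unique_geodesic P Dg p q)
            \<longrightarrow>
            (\<forall>p\<in>U. \<forall>q\<in>U. A p q \<in> U \<and> M p q \<in> U \<and> Mg p q \<in> U
                \<and> A p q = AU p q \<and> M p q = MU p q \<and> Mg p q = MgU p q)
            \<and> (invariance_identity P D D' Dg \<longrightarrow>
                (\<forall>p\<in>U. \<forall>q\<in>U. MgU (AU p q) (MU p q) = MgU p q)
                \<and> (\<exists>x. affine_coordinate SU DU x)
                \<and> (\<forall>x w. affine_coordinate SU DU x
                    \<and> (\<forall>p\<in>U. induced_metric P g p
                          (coordinate_field SU x p) (coordinate_field SU x p) = w (x p))
                    \<longrightarrow>
                    (\<exists>c. \<forall>t\<in>x ` U. w t = c)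
                    \<or> (\<exists>c>0. \<exists>x0. x0 \<notin> x ` U \<and> (\<forall>t\<in>x ` U. w t = c / (t - x0)\<^sup>2)))))"
proof -
  have g: "riemannian_metric P g" and P: "smooth_manifold P"
    using assms(1) by (auto simp: riemannian_manifold_def)
  have N: "smooth_manifold N" using assms(6) by (simp add: embedded_submanifold_def)
  interpret submfd P N
    using P N assms(6) by (simp add: submfd_def submfd_axioms_def smooth_mfd_def)
  have aff: "affine_connection P D" "affine_connection P D'" "affine_connection P Dg"
    using assms(2,5) by (auto simp: dual_connections_def levi_civita_def)
  have ap': "autoparallel P N D'" by (rule autoparallel_dual[OF g assms(2-5,7,8)])
  \<comment> \<open>The induced objects are variables with defining equations, so that the unfolded
    \<open>let\<close> is matched by reflexivity.\<close>
  have arc: "(\<forall>p\<in>U. \<forall>q\<in>U. midpoint_mean P D p q \<in> U \<and> midpoint_mean P D' p q \<in> U \<and> midpoint_mean P Dg p q \<in> U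
        \<and> midpoint_mean P D p q = midpoint_mean SU DU p q
        \<and> midpoint_mean P D' p q = midpoint_mean SU DU' p q
        \<and> midpoint_mean P Dg p q = midpoint_mean SU DgU p q)
      \<and> (invariance_identity P D D' Dg \<longrightarrow>
          (\<forall>p\<in>U. \<forall>q\<in>U. midpoint_mean SU DgU (midpoint_mean SU DU p q) (midpoint_mean SU DU' p q)
            = midpoint_mean SU DgU p q)
          \<and> (\<exists>x. affine_coordinate SU DU x)
          \<and> (\<forall>x w. affine_coordinate SU DU x
              \<and> (\<forall>p\<in>U. induced_metric P g p (coordinate_field SU x p) (coordinate_field SU x p) = w (x p))
              \<longrightarrow> (\<exists>c. \<forall>t\<in>x ` U. w t = c)
                \<or> (\<exists>c>0. \<exists>x0. x0 \<notin> x ` U \<and> (\<forall>t\<in>x ` U. w t = c / (t - x0)\<^sup>2))))"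
    if SU: "SU = open_submanifold N U" and DU: "DU = induced_connection P SU D"
      and DU': "DU' = induced_connection P SU D'" and DgU: "DgU = induced_connection P SU Dg"
      and U: "open_arc N U"
      and conv: "geodesically_convex SU DU" "geodesically_convex SU DU'" "geodesically_convex SU DgU"
      and un: "\<And>p q. p \<in> U \<Longrightarrow> q \<in> U \<Longrightarrow>
        unique_geodesic P D p q \<and> unique_geodesic P D' p q \<and> unique_geodesic P Dg p q"
    for U SU DU DU' DgU
  proof -
    have oU: "open_in N U" and homU: "U homeomorphic {0<..<1::real}" using U by (auto simp: open_arc_def)
    have pts: "pts SU = U" by (simp add: SU N.pts_open_submanifold)
    interpret S: submfd P SU unfolding SU by (rule submfd_open_submanifold[OF oU])
    have ap: "autoparallel P SU D" "autoparallel P SU D'" "autoparallel P SU Dg"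
      unfolding SU using autoparallel_open_submanifold[OF _ _ oU] aff assms(7,8) ap' by blast+
    obtain h hi where "homeomorphism (pts SU) {0<..<1::real} h hi"
      using homU pts by (auto simp: homeomorphic_def)
    then interpret R: riemannian_arc SU "induced_metric P g" h hi
      using S.riemannian_induced_metric[OF g] by unfold_locales
    have mid: "midpoint_mean P D p q \<in> U" "midpoint_mean P D' p q \<in> U" "midpoint_mean P Dg p q \<in> U"
      "midpoint_mean P D p q = midpoint_mean SU DU p q" "midpoint_mean P D' p q = midpoint_mean SU DU' p q"
      "midpoint_mean P Dg p q = midpoint_mean SU DgU p q" if "p \<in> U" "q \<in> U" for p q
      using S.midpoint_mean_induced[OF aff(1) ap(1), of p q] S.midpoint_mean_induced[OF aff(2) ap(2), of p q]
        S.midpoint_mean_induced[OF aff(3) ap(3), of p q] conv un[OF that] that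
      unfolding pts DU DU' DgU by blast+
    have "(\<forall>p\<in>U. \<forall>q\<in>U. midpoint_mean SU DgU (midpoint_mean SU DU p q) (midpoint_mean SU DU' p q)
            = midpoint_mean SU DgU p q)
          \<and> (\<exists>x. affine_coordinate SU DU x)
          \<and> (\<forall>x w. affine_coordinate SU DU x
              \<and> (\<forall>p\<in>U. induced_metric P g p (coordinate_field SU x p) (coordinate_field SU x p) = w (x p))
              \<longrightarrow> (\<exists>c. \<forall>t\<in>x ` U. w t = c)
                \<or> (\<exists>c>0. \<exists>x0. x0 \<notin> x ` U \<and> (\<forall>t\<in>x ` U. w t = c / (t - x0)\<^sup>2)))"
      if inv: "invariance_identity P D D' Dg"
    proof -
      have invU: "midpoint_mean SU DgU (midpoint_mean SU DU p q) (midpoint_mean SU DU' p q)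
          = midpoint_mean SU DgU p q" if pq: "p \<in> U" "q \<in> U" for p q
      proof -
        have "p \<in> pts P" "q \<in> pts P" using S.pts_sub pts pq by auto
        \<comment> \<open>The fourth uniqueness in \<open>invariance_identity\<close> concerns the
          two midpoints; they lie in \<open>U\<close>, where uniqueness is assumed for every
          pair.\<close>
        then have "midpoint_mean P Dg (midpoint_mean P D p q) (midpoint_mean P D' p q) = midpoint_mean P Dg p q"
          using inv un[OF pq] un[OF mid(1,2)[OF pq]] unfolding invariance_identity_def by blast
        then show ?thesis using mid(4-6)[OF pq] mid(6)[OF mid(1,2)[OF pq]] by simp
      qed
      have ex: "\<exists>x. affine_coordinate SU DU x"
        using R.affine_coordinate_exists[OF S.affine_induced_connection[OF aff(1) ap(1)]] unfolding DU by blast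
      have wt: "(\<exists>c. \<forall>t\<in>x ` U. w t = c) \<or> (\<exists>c>0. \<exists>x0. x0 \<notin> x ` U \<and> (\<forall>t\<in>x ` U. w t = c / (t - x0)\<^sup>2))"
        if x: "affine_coordinate SU DU x"
          and w: "\<And>p. p \<in> U \<Longrightarrow> induced_metric P g p (coordinate_field SU x p) (coordinate_field SU x p) = w (x p)"
        for x w
        using R.invariance_weight[OF S.dual_induced_connections[OF g assms(2) ap(1,2)]
            S.levi_civita_induced[OF g assms(5) ap(3)], folded DU DU' DgU, OF conv, unfolded pts, OF invU x w] .
      show ?thesis
      proof (intro conjI ballI allI impI)
        fix x w
        assume a: "affine_coordinate SU DU x
          \<and> (\<forall>p\<in>U. induced_metric P g p (coordinate_field SU x p) (coordinate_field SU x p) = w (x p))"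
        show "(\<exists>c. \<forall>t\<in>x ` U. w t = c) \<or> (\<exists>c>0. \<exists>x0. x0 \<notin> x ` U \<and> (\<forall>t\<in>x ` U. w t = c / (t - x0)\<^sup>2))"
          by (rule wt[OF a[THEN conjunct1] a[THEN conjunct2, THEN bspec]])
      qed (rule invU ex; assumption)+
    qed
    then show ?thesis using mid by simp
  qed
  have eq: "\<forall>W. open_in P W \<longrightarrow> (\<forall>X\<in>vfields P W. \<forall>Y\<in>vfields P W.
      D' W X Y = (\<lambda>p h. 2 * Dg W X Y p h - D W X Y p h))"
    using P.dual_connection_eq[OF g assms(2-5)] by simp
  show ?thesis
    unfolding Let_def
    by (rule conjI[OF eq conjI[OF ap' conjI[OF dual_induced_connections[OF g assms(2,7) ap']
          conjI[OF levi_civita_induced[OF g assms(5,8)]]]]],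
        intro allI impI, elim conjE, rule arc[OF refl refl refl refl]) simp_all
qed

end
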